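(* Fix $\rho>0$ and assume $(n-d)/d\to\rho$ as $n\to\infty$. Then $$ F_{[-1,1]}=e^{d\,g_\rho(r_\rho)+o(d)}, $$ where $$ g_\rho(r_\rho):=\max_{r\in\mathbb{R}}\left\{(\rho+1)\ln(\rho+1)-\rho\ln\rho-\frac{r^2}{2}+\rho\ln\Phi(r)\right\}>0 $$ and $\Phi$ is the cumulative distribution function of a standard normal random variable.
   Context: Asymptotic setting: $\mathbb{N}\ni n\to\infty$ and $d=d(n)\in\{2,\ldots,n-1\}$ is a function of $n$ which is either constant or tends to infinity. $o(d)$ stands for a sequence $g(n)$ with $g(n)/d(n)\to0$. Let $X_1,\ldots,X_n$ be i.i.d. random vectors uniformly distributed on the unit sphere $\mathbb{S}^{d-1}\subset\mathbb{R}^d$, and let $P_{n,d}=[X_1,\ldots,X_n]$ be their convex hull. $F_{[-1,1]}$ denotes the expected number of facets ($(d-1)$-dimensional faces) of $P_{n,d}$. *)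

theory Defs
  imports
    "HOL-Probability.Probability"
    "HOL-Library.Function_Algebras"
    "HOL-Library.Landau_Symbols"
begin

text \<open>
  The dimension varies along the sequence, so it cannot be a type. Vectors of \<open>\<real>\<^sup>d\<close> are functions
  from \<open>nat\<close> to \<open>real\<close> in the space of \<open>PiM {..<d}\<close>, that is, equal to \<open>undefined\<close> outside \<open>{..<d}\<close>.
  With the pointwise operations below they form an affine subspace (affine combinations of the
  constant \<open>undefined\<close> are \<open>undefined\<close>), and \<open>convex hull\<close>, \<open>face_of\<close>, \<open>affine hull\<close> and
  \<open>affine_dependent\<close> only involve affine combinations, so they have their usual meaning in \<open>\<real>\<^sup>d\<close>.
\<close>

instantiation "fun" :: (type, real_vector) real_vector
begin

definition scaleR_fun :: "real \<Rightarrow> ('a \<Rightarrow> 'b) \<Rightarrow> 'a \<Rightarrow> 'b"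
  where "scaleR_fun c f = (\<lambda>i. c *\<^sub>R f i)"

instance
  by intro_classes (auto simp: scaleR_fun_def fun_eq_iff scaleR_add_left scaleR_add_right)

end

definition enorm :: "nat \<Rightarrow> (nat \<Rightarrow> real) \<Rightarrow> real"
  where "enorm d x = sqrt (\<Sum>i<d. (x i)\<^sup>2)"

definition lebesgue_measure :: "nat \<Rightarrow> (nat \<Rightarrow> real) measure"
  where "lebesgue_measure d = PiM {..<d} (\<lambda>_. lborel)"

definition unit_ball :: "nat \<Rightarrow> (nat \<Rightarrow> real) set"
  where "unit_ball d = {x \<in> space (lebesgue_measure d). enorm d x \<le> 1}"

definition radial_projection :: "nat \<Rightarrow> (nat \<Rightarrow> real) \<Rightarrow> nat \<Rightarrow> real"
  where "radial_projection d x = (\<lambda>i\<in>{..<d}. x i / enorm d x)"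

text \<open>
  The uniform distribution on the unit sphere is the normalised spherical Lebesgue measure, which
  assigns to \<open>A\<close> the volume of the cone \<open>{t x | x \<in> A, 0 < t \<le> 1}\<close> divided by the volume of the ball.
  This cone consists of the nonzero points of the ball that are projected radially into \<open>A\<close>; the
  origin is a null set.
\<close>

definition uniform_sphere :: "nat \<Rightarrow> (nat \<Rightarrow> real) measure"
  where "uniform_sphere d =
    distr (uniform_measure (lebesgue_measure d) (unit_ball d))
      (PiM {..<d} (\<lambda>_. borel)) (radial_projection d)"

definition iid_uniform_sphere :: "nat \<Rightarrow> nat \<Rightarrow> 'a measure \<Rightarrow> (nat \<Rightarrow> 'a \<Rightarrow> nat \<Rightarrow> real) \<Rightarrow> bool"
  where "iid_uniform_sphere n d M X \<longleftrightarrow>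
    prob_space.indep_vars M (\<lambda>_. PiM {..<d} (\<lambda>_. borel)) X {1..n} \<and>
    (\<forall>i\<in>{1..n}. distr M (PiM {..<d} (\<lambda>_. borel)) (X i) = uniform_sphere d)"

text \<open>The library's \<open>aff_dim\<close> requires a Euclidean space; this is its defining property.\<close>

definition has_aff_dim :: "'a::real_vector set \<Rightarrow> nat \<Rightarrow> bool"
  where "has_aff_dim S k \<longleftrightarrow>
    (\<exists>B. affine hull B = affine hull S \<and> \<not> affine_dependent B \<and> finite B \<and> card B = k + 1)"

definition facets :: "nat \<Rightarrow> (nat \<Rightarrow> real) set \<Rightarrow> (nat \<Rightarrow> real) set set"
  where "facets d P = {F. F face_of P \<and> has_aff_dim F (d - 1)}"

definition expected_facets :: "nat \<Rightarrow> nat \<Rightarrow> 'a measure \<Rightarrow> (nat \<Rightarrow> 'a \<Rightarrow> nat \<Rightarrow> real) \<Rightarrow> ennreal"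
  where "expected_facets n d M X =
    (\<integral>\<^sup>+ \<omega>. of_nat (card (facets d (convex hull ((\<lambda>i. X i \<omega>) ` {1..n})))) \<partial>M)"

text \<open>\<open>\<Phi>\<close> is the standard normal distribution function.\<close>

definition \<Phi> :: "real \<Rightarrow> real"
  where "\<Phi> r = cdf std_normal_distribution r"

definition g :: "real \<Rightarrow> real \<Rightarrow> real"
  where "g \<rho> r = (\<rho> + 1) * ln (\<rho> + 1) - \<rho> * ln \<rho> - r\<^sup>2 / 2 + \<rho> * ln (\<Phi> r)"

end

(*
  Almost surely every facet of the polytope is the simplex of d of the points, and such a simplex is a
  facet iff the other n - d points lie on one side of the hyperplane {z. <z, v> = 1} spanned by it.
  Hence the expectation is the binomial coefficient n choose d times the mean of
  p^(n - d) + (1 - p)^(n - d), where p is the measure of the cap {z. <z, v> <= 1} at distance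
  h = 1 / |v|.

  The density of h is proportional to (1 - h^2)^((d^2 - 2d - 1) / 2). For densities (1 - |x|^2)^(1/m - 1)
  on the ball instead of the sphere this is the affine Blaschke--Petkantschin formula: substitute the
  hyperplane for the last coordinates of the points, and map each hyperplane section of the ball
  affinely to a section through the origin, which scales every integral by a power of 1 - h^2. Let m
  tend to infinity.

  A uniform point of the sphere is a normalised Gaussian vector, whose norm is sqrt d up to factors
  close to 1 with exponentially small exceptional probability. So p is Phi(sqrt d * h) up to such an
  error, and with h = r / sqrt d the integral behaves like exp (d (rho ln Phi(r) - r^2 / 2)). The
  caps p and 1 - p are bounded by the same quantity, so bounds for one side suffice. Laplace's method
  and Stirling's formula for the binomial coefficient give the rate g.

  The maximum is positive because of the value at the quantile Phi(r) = rho / (rho + 1).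
*)
theory Submission
  imports Defs "Jordan_Normal_Form.Determinant"
begin

unbundle no vec_syntax

section \<open>Linear algebra and linear substitutions in Lebesgue integrals\<close>

text \<open>The sphere carries no Lebesgue density, which is why densities on the ball are treated
  before it: there Fubini and linear substitutions apply, and the law of the distance survives a
  weak limit with \<open>d\<close> fixed. Only the shape of densities is tracked. The Jacobian is an
  unevaluated modulus of which merely the scaling is used, and normalising constants drop out when a
  test function is compared with the constant 1.

  The exponent comes from counting. Rescaling \<open>d\<close> points in a section of dimension
  \<open>d - 1\<close>, together with the Jacobian, gives the power
  \<open>(d + 1) (d - 1) / 2\<close> of \<open>1 - h^2\<close>, and the weights give
  \<open>d (1/m - 1)\<close>; the limit leaves \<open>(d^2 - 1) / 2 - d\<close>.

  The Gaussian comparison needs little precision. As \<open>h >= 0\<close>, the values of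
  \<open>\<Phi>\<close> are at least 1/2, so an additive error \<open>T\<close> amounts to a factor
  \<open>exp(O(T))\<close>; raised to a power of order \<open>d\<close> this is
  \<open>exp(o(d))\<close> once \<open>T\<close> tends to 0. Factors polynomial in \<open>d\<close>
  are equally harmless. Facets are bounded from above through closed half-spaces and from below
  through open ones, so points on the boundary need no discussion.\<close>

definition dotp :: "nat \<Rightarrow> (nat \<Rightarrow> real) \<Rightarrow> (nat \<Rightarrow> real) \<Rightarrow> real"
  where "dotp d x y = (\<Sum>j<d. x j * y j)"

text \<open>Matrices are kept as functions whose rows are the points, so that a tuple drawn from a
  product space is itself a matrix. This is the bridge to carrier-based matrices.\<close>

definition rmat :: "nat \<Rightarrow> (nat \<Rightarrow> nat \<Rightarrow> real) \<Rightarrow> real Matrix.mat"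
  where "rmat d A = Matrix.mat d d (\<lambda>(i, j). A i j)"

definition rdet :: "nat \<Rightarrow> (nat \<Rightarrow> nat \<Rightarrow> real) \<Rightarrow> real"
  where "rdet d A = Determinant.det (rmat d A)"

definition rcof :: "nat \<Rightarrow> (nat \<Rightarrow> nat \<Rightarrow> real) \<Rightarrow> nat \<Rightarrow> nat \<Rightarrow> real"
  where "rcof d A i j = Determinant.cofactor (rmat d A) i j"

definition is_inv :: "nat \<Rightarrow> (nat \<Rightarrow> nat \<Rightarrow> real) \<Rightarrow> (nat \<Rightarrow> nat \<Rightarrow> real) \<Rightarrow> bool"
  where "is_inv d A B \<longleftrightarrow> (\<forall>i<d. \<forall>k<d. (\<Sum>j<d. A i j * B j k) = (if i = k then 1 else 0))"

lemma rmat_carrier [simp]: "rmat d A \<in> carrier_mat d d"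
  by (simp add: rmat_def)

lemma is_inv_iff_mat: "is_inv d A B \<longleftrightarrow> rmat d A * rmat d B = 1\<^sub>m d"
proof -
  have "(rmat d A * rmat d B) $$ (i, k) = (\<Sum>j<d. A i j * B j k)" if "i < d" "k < d" for i k
    using that by (simp add: rmat_def scalar_prod_def lessThan_atLeast0)
  then show ?thesis
    unfolding is_inv_def by (auto simp: mat_eq_iff rmat_def one_mat_def)
qed

lemma is_inv_sym: "is_inv d A B \<Longrightarrow> is_inv d B A"
  unfolding is_inv_iff_mat using mat_mult_left_right_inverse[of "rmat d A" d "rmat d B"] by simp

lemma rdet_row:
  assumes "i < d" shows "rdet d A = (\<Sum>j<d. A i j * rcof d A i j)"
  unfolding rdet_def rcof_def
  by (subst laplace_expansion_row[OF rmat_carrier assms]) (use assms in \<open>simp add: rmat_def\<close>)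

text \<open>The minor deletes row \<open>i\<close>, so the cofactors along that row do not see it.
  This makes the determinant linear in one row while the others are frozen.\<close>

lemma rcof_cong:
  assumes "i < d" "j < d" and "\<And>k l. k < d \<Longrightarrow> k \<noteq> i \<Longrightarrow> l < d \<Longrightarrow> A k l = A' k l"
  shows "rcof d A i j = rcof d A' i j"
proof -
  have "mat_delete (rmat d A) i j = mat_delete (rmat d A') i j"
    unfolding mat_delete_def rmat_def
    by (rule eq_matI) (use assms in auto)
  then show ?thesis by (simp add: rcof_def cofactor_def)
qed

lemma rdet_cong:
  assumes "\<And>k l. k < d \<Longrightarrow> l < d \<Longrightarrow> A k l = A' k l"
  shows "rdet d A = rdet d A'"
proof -
  have "rmat d A = rmat d A'"
    unfolding rmat_def by (rule eq_matI) (use assms in auto)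
  then show ?thesis by (simp add: rdet_def)
qed

text \<open>Cramer's rule. The inverse is wanted in this explicit form because its entries are
  visibly measurable functions of the matrix.\<close>

lemma is_inv_adjugate:
  assumes "rdet d A \<noteq> 0"
  shows "is_inv d A (\<lambda>i j. rcof d A j i / rdet d A)"
proof -
  have 1: "rmat d A * adj_mat (rmat d A) = rdet d A \<cdot>\<^sub>m 1\<^sub>m d"
    using adj_mat(2)[OF rmat_carrier, of d A] by (simp add: rdet_def)
  have adj: "adj_mat (rmat d A) = rmat d (\<lambda>i j. rcof d A j i)"
    by (rule eq_matI) (auto simp: adj_mat_def rmat_def rcof_def)
  have "(\<Sum>j<d. A i j * rcof d A k j) = (if i = k then rdet d A else 0)" if "i < d" "k < d" for i k
  proof -
    have "(\<Sum>j<d. A i j * rcof d A k j) = (rmat d A * adj_mat (rmat d A)) $$ (i, k)"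
      unfolding adj using that by (simp add: rmat_def scalar_prod_def lessThan_atLeast0)
    also have "\<dots> = (if i = k then rdet d A else 0)"
      unfolding 1 using that by simp
    finally show ?thesis .
  qed
  then show ?thesis
    using assms by (auto simp: is_inv_def sum_divide_distrib[symmetric])
qed

text \<open>For the matrices met below the kernel is easier to follow through lifting, scaling and
  projection of the rows than the value of the determinant.\<close>

lemma rdet_nonzeroI:
  assumes "\<And>w. (\<And>i. i < d \<Longrightarrow> dotp d (A i) w = 0) \<Longrightarrow> \<forall>j<d. w j = 0"
  shows "rdet d A \<noteq> 0"
proof
  assume "rdet d A = 0"
  then obtain v where v: "v \<in> carrier_vec d" "v \<noteq> 0\<^sub>v d" "rmat d A *\<^sub>v v = 0\<^sub>v d"
    unfolding rdet_def det_0_iff_vec_prod_zero_field[OF rmat_carrier] by blast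
  have "dotp d (A i) (vec_index v) = 0" if "i < d" for i
  proof -
    have "dotp d (A i) (vec_index v) = vec_index (rmat d A *\<^sub>v v) i"
      using that v(1) by (simp add: rmat_def dotp_def scalar_prod_def lessThan_atLeast0)
    then show ?thesis using that v(3) by simp
  qed
  from assms[OF this] have "\<forall>j<d. vec_index v j = 0" by blast
  then have "v = 0\<^sub>v d" using v(1) by (intro eq_vecI) auto
  with v(2) show False by simp
qed

lemma rdet_id: "rdet d (\<lambda>i j. if i = j then 1 else 0) = 1"
proof -
  have "rmat d (\<lambda>i j. if i = j then 1 else 0) = 1\<^sub>m d"
    unfolding rmat_def by (rule eq_matI) auto
  then show ?thesis by (simp add: rdet_def)
qed

text \<open>The Leibniz formula writes the determinant as a polynomial in the entries.\<close>

lemma det_mat_measurable: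
  fixes F :: "nat \<Rightarrow> nat \<Rightarrow> 'a \<Rightarrow> real"
  assumes [measurable]: "\<And>i j. i < n \<Longrightarrow> j < n \<Longrightarrow> F i j \<in> borel_measurable M"
  shows "(\<lambda>\<omega>. Determinant.det (Matrix.mat n n (\<lambda>(i, j). F i j \<omega>))) \<in> borel_measurable M"
proof -
  have "Determinant.det (Matrix.mat n n (\<lambda>(i, j). F i j \<omega>)) =
     (\<Sum>p | p permutes {0..<n}. signof p * (\<Prod>i = 0..<n. F i (p i) \<omega>))" for \<omega>
    by (subst det_def'[of _ n])
       (auto intro!: sum.cong prod.cong dest: permutes_in_image)
  moreover have "(\<lambda>\<omega>. \<Sum>p | p permutes {0..<n}. signof p * (\<Prod>i = 0..<n. F i (p i) \<omega>)) \<in> borel_measurable M"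
    by (intro borel_measurable_sum borel_measurable_times borel_measurable_prod assms)
       (auto dest: permutes_in_image)
  ultimately show ?thesis by simp
qed

lemma rdet_measurable:
  assumes "\<And>i j. i < d \<Longrightarrow> j < d \<Longrightarrow> (\<lambda>\<omega>. F \<omega> i j) \<in> borel_measurable M"
  shows "(\<lambda>\<omega>. rdet d (F \<omega>)) \<in> borel_measurable M"
  unfolding rdet_def rmat_def using assms by (rule det_mat_measurable)

lemma rcof_measurable:
  assumes "i < d" "j < d" and "\<And>i j. i < d \<Longrightarrow> j < d \<Longrightarrow> (\<lambda>\<omega>. F \<omega> i j) \<in> borel_measurable M"
  shows "(\<lambda>\<omega>. rcof d (F \<omega>) i j) \<in> borel_measurable M"
proof -
  let ?ix = "\<lambda>k l. if l < k then l else Suc l :: nat"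
  have "mat_delete (rmat d (F \<omega>)) i j =
      Matrix.mat (d - 1) (d - 1) (\<lambda>(k, l). F \<omega> (?ix i k) (?ix j l))" for \<omega>
    unfolding mat_delete_def rmat_def by (rule eq_matI) auto
  moreover have "(\<lambda>\<omega>. Determinant.det (Matrix.mat (d - 1) (d - 1) (\<lambda>(k, l). F \<omega> (?ix i k) (?ix j l))))
      \<in> borel_measurable M"
    by (rule det_mat_measurable) (use assms in auto)
  ultimately show ?thesis
    unfolding rcof_def cofactor_def by simp
qed

text \<open>Boxes determine a product measure of \<sigma>-finite factors, and on a box the factor
  \<open>\<kappa>\<close> occurs once per coordinate.\<close>

lemma nn_integral_PiM_transform:
  fixes I :: "'i set" and N :: "'a measure" and T :: "'i \<Rightarrow> 'a \<Rightarrow> 'a"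
  assumes "finite I" "sigma_finite_measure N"
    and T [measurable]: "\<And>i. i \<in> I \<Longrightarrow> T i \<in> measurable N N"
    and eq: "\<And>i A. i \<in> I \<Longrightarrow> A \<in> sets N \<Longrightarrow> emeasure N A = \<kappa> * emeasure N (T i -` A \<inter> space N)"
    and f [measurable]: "f \<in> borel_measurable (PiM I (\<lambda>_. N))"
  shows "(\<integral>\<^sup>+x. f x \<partial>PiM I (\<lambda>_. N)) =
    \<kappa> ^ card I * (\<integral>\<^sup>+x. f (\<lambda>i\<in>I. T i (x i)) \<partial>PiM I (\<lambda>_. N))"
proof -
  interpret N: sigma_finite_measure N by fact
  interpret product_sigma_finite "\<lambda>_. N" by standard
  have [measurable]: "(\<lambda>x. \<lambda>i\<in>I. T i (x i)) \<in> measurable (PiM I (\<lambda>_. N)) (PiM I (\<lambda>_. N))"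
    by (intro measurable_restrict measurable_compose[OF _ T] measurable_component_singleton)
  let ?P = "scale_measure (\<kappa> ^ card I) (distr (PiM I (\<lambda>_. N)) (PiM I (\<lambda>_. N)) (\<lambda>x. \<lambda>i\<in>I. T i (x i)))"
  have "?P = PiM I (\<lambda>_. N)"
  proof (rule PiM_eqI)
    fix A assume A: "\<And>i. i \<in> I \<Longrightarrow> A i \<in> sets N"
    have vim: "(\<lambda>x. \<lambda>i\<in>I. T i (x i)) -` Pi\<^sub>E I A \<inter> space (PiM I (\<lambda>_. N))
        = Pi\<^sub>E I (\<lambda>i. T i -` A i \<inter> space N)"
      by (auto simp: space_PiM PiE_iff extensional_def)
    have [measurable]: "Pi\<^sub>E I A \<in> sets (PiM I (\<lambda>_. N))"
      using A \<open>finite I\<close> by (intro sets_PiM_I_finite) auto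
    have "emeasure ?P (Pi\<^sub>E I A) = \<kappa> ^ card I * (\<Prod>i\<in>I. emeasure N (T i -` A i \<inter> space N))"
      using A \<open>finite I\<close> by (subst emeasure_scale_measure, subst emeasure_distr, measurable)
        (auto simp: vim emeasure_PiM intro!: measurable_sets[OF T])
    also have "\<dots> = (\<Prod>i\<in>I. \<kappa> * emeasure N (T i -` A i \<inter> space N))"
      by (simp add: prod.distrib)
    also have "\<dots> = (\<Prod>i\<in>I. emeasure N (A i))"
      using A by (intro prod.cong refl eq[symmetric]) auto
    finally show "emeasure ?P (Pi\<^sub>E I A) = (\<Prod>i\<in>I. emeasure N (A i))" .
  qed (use \<open>finite I\<close> in auto)
  then have "(\<integral>\<^sup>+x. f x \<partial>PiM I (\<lambda>_. N)) = (\<integral>\<^sup>+x. f x \<partial>?P)" by simp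
  also have "\<dots> = \<kappa> ^ card I * (\<integral>\<^sup>+x. f (\<lambda>i\<in>I. T i (x i)) \<partial>PiM I (\<lambda>_. N))"
    by (simp add: nn_integral_scale_measure nn_integral_distr)
  finally show ?thesis .
qed

section \<open>Affine and linear substitutions in Lebesgue integrals\<close>

abbreviation leb :: "'i set \<Rightarrow> ('i \<Rightarrow> real) measure"
  where "leb I \<equiv> PiM I (\<lambda>_. lborel)"

lemma sigma_finite_leb: "finite I \<Longrightarrow> sigma_finite_measure (leb I)"
  by (rule product_sigma_finite.sigma_finite) (unfold_locales)

lemma leb_affine:
  fixes c :: "'i \<Rightarrow> real"
  assumes "finite I" "a \<noteq> 0" and f [measurable]: "f \<in> borel_measurable (leb I)"
  shows "(\<integral>\<^sup>+x. f x \<partial>leb I) = ennreal \<bar>a\<bar> ^ card I * (\<integral>\<^sup>+x. f (\<lambda>i\<in>I. c i + a * x i) \<partial>leb I)"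
proof (rule nn_integral_PiM_transform)
  fix i and A :: "real set" assume "A \<in> sets lborel"
  then have [measurable]: "A \<in> sets borel" by simp
  have "emeasure lborel A = (\<integral>\<^sup>+x. indicator A x \<partial>lborel)" by simp
  also have "\<dots> = ennreal \<bar>a\<bar> * (\<integral>\<^sup>+x. indicator A (c i + a * x) \<partial>lborel)"
    by (rule nn_integral_real_affine) (use \<open>a \<noteq> 0\<close> in auto)
  also have "(\<integral>\<^sup>+x. indicator A (c i + a * x) \<partial>lborel) =
      (\<integral>\<^sup>+x. indicator ((\<lambda>x. c i + a * x) -` A \<inter> space lborel) x \<partial>lborel)"
    by (intro nn_integral_cong) (auto simp: indicator_def)
  also have "\<dots> = emeasure lborel ((\<lambda>x. c i + a * x) -` A \<inter> space lborel)"
    by (intro nn_integral_indicator) measurable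
  finally show "emeasure lborel A = ennreal \<bar>a\<bar> * emeasure lborel ((\<lambda>x. c i + a * x) -` A \<inter> space lborel)" .
qed (use assms in \<open>auto intro: lborel.sigma_finite_measure_axioms\<close>)

definition mv :: "nat \<Rightarrow> (nat \<Rightarrow> nat \<Rightarrow> real) \<Rightarrow> (nat \<Rightarrow> real) \<Rightarrow> nat \<Rightarrow> real"
  where "mv d A v = (\<lambda>i\<in>{..<d}. dotp d (A i) v)"

lemma mv_measurable:
  assumes [measurable]: "\<And>i j. i < d \<Longrightarrow> j < d \<Longrightarrow> (\<lambda>\<omega>. A \<omega> i j) \<in> borel_measurable M"
    and [measurable]: "v \<in> measurable M (leb {..<d})"
  shows "(\<lambda>\<omega>. mv d (A \<omega>) (v \<omega>)) \<in> measurable M (leb {..<d})"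
proof -
  have "(\<lambda>\<omega>. v \<omega> j) \<in> borel_measurable M" if "j < d" for j
    using measurable_compose[OF assms(2) measurable_component_singleton[of j "{..<d}" "\<lambda>_. lborel"]] that
    by simp
  then show ?thesis
    unfolding mv_def dotp_def
    by (intro measurable_restrict) (auto intro!: borel_measurable_sum borel_measurable_times assms(1))
qed

lemma mv_inverse:
  assumes "is_inv d A B" "i < d"
  shows "dotp d (A i) (mv d B v) = v i"
proof -
  have "dotp d (A i) (mv d B v) = (\<Sum>j<d. \<Sum>k<d. A i j * (B j k * v k))"
    by (simp add: dotp_def mv_def sum_distrib_left)
  also have "\<dots> = (\<Sum>k<d. (\<Sum>j<d. A i j * B j k) * v k)"
    by (subst sum.swap) (simp add: sum_distrib_right mult.assoc)
  also have "\<dots> = (\<Sum>k<d. (if i = k then 1 else 0) * v k)"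
    using assms by (intro sum.cong refl) (simp add: is_inv_def)
  also have "\<dots> = v i" using assms(2) by (simp add: if_distrib[of "\<lambda>c. c * _"] cong: if_cong)
  finally show ?thesis .
qed

definition unit_box :: "nat \<Rightarrow> (nat \<Rightarrow> real) set"
  where "unit_box d = PiE {..<d} (\<lambda>_. {0..1})"

lemma unit_box_sets [measurable]: "unit_box d \<in> sets (leb {..<d})"
  unfolding unit_box_def by (intro sets_PiM_I_finite) auto

lemma emeasure_unit_box: "emeasure (leb {..<d}) (unit_box d) = 1"
proof -
  interpret product_sigma_finite "\<lambda>_::nat. lborel :: real measure" by unfold_locales
  show ?thesis unfolding unit_box_def by (subst emeasure_PiM) auto
qed

text \<open>The volume of the preimage of the unit box, which for an invertible matrix is the
  reciprocal of the absolute determinant. The value is never identified; what matters later is how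
  it scales.\<close>

definition linear_modulus :: "nat \<Rightarrow> (nat \<Rightarrow> nat \<Rightarrow> real) \<Rightarrow> ennreal"
  where "linear_modulus d A = (\<integral>\<^sup>+v. indicator (unit_box d) (mv d A v) \<partial>leb {..<d})"

text \<open>The uniqueness argument for Haar measure, with the linear bijection \<open>A\<close> built in.\<close>

lemma linear_modulus_mult_integral:
  assumes "is_inv d A B" and f [measurable]: "f \<in> borel_measurable (leb {..<d})"
  shows "(\<integral>\<^sup>+v. f (mv d A v) \<partial>leb {..<d}) = linear_modulus d A * (\<integral>\<^sup>+t. f t \<partial>leb {..<d})"
proof -
  let ?L = "leb {..<d}" and ?g = "indicator (unit_box d) :: _ \<Rightarrow> ennreal"
  interpret L: sigma_finite_measure ?L by (rule sigma_finite_leb) simp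
  interpret LL: pair_sigma_finite ?L ?L by unfold_locales
  have g [measurable]: "?g \<in> borel_measurable ?L" by measurable
  have [measurable]: "mv d A \<in> measurable ?L ?L"
    using mv_measurable[of d "\<lambda>_. A" ?L "\<lambda>v. v"] by simp
  have comp [measurable]: "(\<lambda>x. x i) \<in> borel_measurable ?L" if "i < d" for i
    using measurable_component_singleton[of i "{..<d}" "\<lambda>_. lborel :: real measure"] that by simp
  have shift: "(\<integral>\<^sup>+t. F t \<partial>?L) = (\<integral>\<^sup>+t. F (\<lambda>i\<in>{..<d}. c i + t i) \<partial>?L)"
    if "F \<in> borel_measurable ?L" for F and c :: "nat \<Rightarrow> real"
    using leb_affine[of "{..<d}" 1 F c] that by simp
  have refl: "(\<integral>\<^sup>+t. F t \<partial>?L) = (\<integral>\<^sup>+t. F (\<lambda>i\<in>{..<d}. c i - t i) \<partial>?L)"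
    if "F \<in> borel_measurable ?L" for F and c :: "nat \<Rightarrow> real"
    using leb_affine[of "{..<d}" "-1" F c] that by simp
  have plus [measurable]: "(\<lambda>p. \<lambda>i\<in>{..<d}. mv d A (fst p) i + snd p i) \<in> measurable (?L \<Otimes>\<^sub>M ?L) ?L"
    "(\<lambda>p. \<lambda>i\<in>{..<d}. mv d A (fst p) i - snd p i) \<in> measurable (?L \<Otimes>\<^sub>M ?L) ?L"
  proof -
    have *: "(\<lambda>p. mv d A (fst p) i) \<in> borel_measurable (?L \<Otimes>\<^sub>M ?L)"
      "(\<lambda>p. snd p i) \<in> borel_measurable (?L \<Otimes>\<^sub>M ?L)" if "i < d" for i
      using that by measurable
    show "(\<lambda>p. \<lambda>i\<in>{..<d}. mv d A (fst p) i + snd p i) \<in> measurable (?L \<Otimes>\<^sub>M ?L) ?L"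
     "(\<lambda>p. \<lambda>i\<in>{..<d}. mv d A (fst p) i - snd p i) \<in> measurable (?L \<Otimes>\<^sub>M ?L) ?L"
      using * by (auto intro!: measurable_restrict)
  qed
  have "(\<integral>\<^sup>+v. f (mv d A v) \<partial>?L) = (\<integral>\<^sup>+v. f (mv d A v) * (\<integral>\<^sup>+t. ?g t \<partial>?L) \<partial>?L)"
    by (simp add: emeasure_unit_box)
  \<comment> \<open>The unit mass of the box is translated by \<open>mv d A v\<close>; translation
    invariance lets the shift depend on \<open>v\<close>.\<close>
  also have "\<dots> = (\<integral>\<^sup>+v. \<integral>\<^sup>+t. f (mv d A v) * ?g (\<lambda>i\<in>{..<d}. mv d A v i + t i) \<partial>?L \<partial>?L)"
  proof (rule nn_integral_cong)
    fix v assume "v \<in> space ?L"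
    have "(\<integral>\<^sup>+t. ?g t \<partial>?L) = (\<integral>\<^sup>+t. ?g (\<lambda>i\<in>{..<d}. mv d A v i + t i) \<partial>?L)"
      by (rule shift) simp
    moreover have "(\<lambda>t. ?g (\<lambda>i\<in>{..<d}. mv d A v i + t i)) \<in> borel_measurable ?L"
      by (rule measurable_compose[OF _ g]) (auto intro!: measurable_restrict)
    ultimately show "f (mv d A v) * (\<integral>\<^sup>+t. ?g t \<partial>?L) =
        (\<integral>\<^sup>+t. f (mv d A v) * ?g (\<lambda>i\<in>{..<d}. mv d A v i + t i) \<partial>?L)"
      by (simp add: nn_integral_cmult)
  qed
  also have "\<dots> = (\<integral>\<^sup>+t. \<integral>\<^sup>+v. f (mv d A v) * ?g (\<lambda>i\<in>{..<d}. mv d A v i + t i) \<partial>?L \<partial>?L)"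
    by (rule LL.Fubini'[symmetric]) (simp add: case_prod_beta', measurable)
  also have "\<dots> = (\<integral>\<^sup>+t. \<integral>\<^sup>+v. f (\<lambda>i\<in>{..<d}. mv d A v i - t i) * ?g (mv d A v) \<partial>?L \<partial>?L)"
  proof (rule nn_integral_cong)
    fix t assume t: "t \<in> space ?L"
    \<comment> \<open>A translation of the image by \<open>t\<close> is a translation of the
      argument by the preimage \<open>w\<close> of \<open>t\<close>.\<close>
    define w where "w = mv d B t"
    have Aw: "dotp d (A i) w = t i" if "i < d" for i
      unfolding w_def by (rule mv_inverse) fact+
    have m1: "mv d A (\<lambda>i\<in>{..<d}. - w i + v i) = (\<lambda>i\<in>{..<d}. mv d A v i - t i)" for v
    proof -
      have "dotp d (A i) (\<lambda>i\<in>{..<d}. - w i + v i) = dotp d (A i) v - dotp d (A i) w" for i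
        by (simp add: dotp_def sum_subtractf[symmetric] right_diff_distrib)
      then show ?thesis by (auto simp: mv_def Aw fun_eq_iff)
    qed
    have m2: "(\<lambda>i\<in>{..<d}. mv d A (\<lambda>i\<in>{..<d}. - w i + v i) i + t i) = mv d A v" for v
      unfolding m1 by (auto simp: mv_def fun_eq_iff)
    have "(\<lambda>v. f (mv d A v) * ?g (\<lambda>i\<in>{..<d}. mv d A v i + t i)) \<in> borel_measurable ?L"
      using t measurable_compose[OF measurable_Pair1'[of t ?L ?L]]
      by (intro borel_measurable_times_ennreal measurable_compose[OF _ g] measurable_compose[OF _ f])
         (auto intro!: measurable_restrict)
    from shift[OF this, of "\<lambda>i. - w i"]
    show "(\<integral>\<^sup>+v. f (mv d A v) * ?g (\<lambda>i\<in>{..<d}. mv d A v i + t i) \<partial>?L) =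
      (\<integral>\<^sup>+v. f (\<lambda>i\<in>{..<d}. mv d A v i - t i) * ?g (mv d A v) \<partial>?L)"
      by (simp only: m2) (simp only: m1)
  qed
  also have "\<dots> = (\<integral>\<^sup>+v. \<integral>\<^sup>+t. f (\<lambda>i\<in>{..<d}. mv d A v i - t i) * ?g (mv d A v) \<partial>?L \<partial>?L)"
    by (rule LL.Fubini') (simp add: case_prod_beta', measurable)
  \<comment> \<open>Substituting \<open>mv d A v - t\<close> for \<open>t\<close> removes
    \<open>v\<close> from the argument of \<open>f\<close>, so the double integral factors.\<close>
  also have "\<dots> = (\<integral>\<^sup>+v. (\<integral>\<^sup>+t. f t \<partial>?L) * ?g (mv d A v) \<partial>?L)"
  proof (rule nn_integral_cong)
    fix v assume "v \<in> space ?L"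
    have "(\<lambda>t. f (\<lambda>i\<in>{..<d}. mv d A v i - t i)) \<in> borel_measurable ?L"
      by (rule measurable_compose[OF _ f]) (auto intro!: measurable_restrict)
    then show "(\<integral>\<^sup>+t. f (\<lambda>i\<in>{..<d}. mv d A v i - t i) * ?g (mv d A v) \<partial>?L) =
        (\<integral>\<^sup>+t. f t \<partial>?L) * ?g (mv d A v)"
      using refl[OF f, of "mv d A v"] by (simp add: nn_integral_multc)
  qed
  also have "\<dots> = (\<integral>\<^sup>+t. f t \<partial>?L) * linear_modulus d A"
    unfolding linear_modulus_def by (rule nn_integral_cmult) measurable
  finally show ?thesis by (simp add: mult.commute)
qed

lemma ennreal_inverse_mult_self:
  fixes a b :: ennreal
  assumes "a * b = 1" shows "inverse a * a = 1"
proof -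
  have "a \<noteq> 0" using assms by auto
  moreover have "a \<noteq> \<infinity>"
    using assms by (cases "b = 0") (auto simp: ennreal_top_mult)
  ultimately show ?thesis
    using ennreal_divide_self[of a] by (simp add: divide_ennreal_def mult.commute less_top)
qed

text \<open>Taking the indicator of the box composed with the inverse \<open>B\<close> as integrand
  shows that the moduli of \<open>A\<close> and \<open>B\<close> multiply to 1. So the modulus is
  neither 0 nor infinite and may be moved to the other side.\<close>

lemma linear_change_of_variables:
  assumes "is_inv d A B" and f [measurable]: "f \<in> borel_measurable (leb {..<d})"
  shows "(\<integral>\<^sup>+t. f t \<partial>leb {..<d}) = inverse (linear_modulus d A) * (\<integral>\<^sup>+v. f (mv d A v) \<partial>leb {..<d})"
proof -
  have [measurable]: "mv d B \<in> measurable (leb {..<d}) (leb {..<d})"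
    using mv_measurable[of d "\<lambda>_. B" "leb {..<d}" "\<lambda>v. v"] by simp
  have BA: "mv d B (mv d A v) = v" if "v \<in> space (leb {..<d})" for v
    using that mv_inverse[OF is_inv_sym[OF assms(1)]]
    by (auto simp: mv_def[of d B] space_PiM PiE_iff extensional_def fun_eq_iff)
  have "(\<integral>\<^sup>+v. indicator (unit_box d) (mv d B (mv d A v)) \<partial>leb {..<d}) =
      linear_modulus d A * (\<integral>\<^sup>+v. indicator (unit_box d) (mv d B v) \<partial>leb {..<d})"
    by (rule linear_modulus_mult_integral[OF assms(1)]) measurable
  moreover have "(\<integral>\<^sup>+v. indicator (unit_box d) (mv d B (mv d A v)) \<partial>leb {..<d}) =
      (\<integral>\<^sup>+v. indicator (unit_box d) v \<partial>leb {..<d} :: ennreal)"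
    by (rule nn_integral_cong) (simp add: BA)
  ultimately have 1: "linear_modulus d A * linear_modulus d B = 1"
    by (simp add: emeasure_unit_box linear_modulus_def[of d B])
  from ennreal_inverse_mult_self[OF 1] show ?thesis
    by (simp only: linear_modulus_mult_integral[OF assms] mult.assoc[symmetric] mult_1_left)
qed

section \<open>General position of random points\<close>

lemma AE_PiM_nonzero:
  fixes f :: "('i \<Rightarrow> 'a) \<Rightarrow> real"
  assumes "finite I" "sigma_finite_measure N"
    and "f \<in> borel_measurable (PiM I (\<lambda>_. N))"
    and "\<And>x i. x \<in> space (PiM I (\<lambda>_. N)) \<Longrightarrow> i \<in> I \<Longrightarrow> f x \<noteq> 0 \<Longrightarrow> AE s in N. f (x(i := s)) \<noteq> 0"
    and "x0 \<in> space (PiM I (\<lambda>_. N))" "f x0 \<noteq> 0"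
  shows "AE x in PiM I (\<lambda>_. N). f x \<noteq> 0"
proof -
  interpret N: sigma_finite_measure N by fact
  interpret product_sigma_finite "\<lambda>_. N" by standard
  show ?thesis
    using assms(1,3-)
  proof (induction I arbitrary: f x0 rule: finite_induct)
    case empty
    have "AE x in PiM {} (\<lambda>_. N). x = x0"
      using empty by (intro AE_I2) (auto simp: space_PiM)
    then show ?case by (rule AE_mp) (use empty in auto)
  next
    case (insert k I)
    note f [measurable] = insert.prems(1)
    interpret I: sigma_finite_measure "PiM I (\<lambda>_. N)" using insert by (intro sigma_finite)
    define f' where "f' = (\<lambda>x. f (x(k := x0 k)))"
    have x0k: "x0 k \<in> space N" and x0I: "x0(k := undefined) \<in> space (PiM I (\<lambda>_. N))"
      using insert.prems(3) insert.hyps by (auto simp: space_PiM PiE_iff extensional_def)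
    have up: "x(k := s) \<in> space (PiM (insert k I) (\<lambda>_. N))"
      if "x \<in> space (PiM I (\<lambda>_. N))" "s \<in> space N" for x s
      using that by (auto simp: space_PiM PiE_iff extensional_def)
    have 1: "AE x in PiM I (\<lambda>_. N). f' x \<noteq> 0"
    proof (rule insert.IH)
      show "f' \<in> borel_measurable (PiM I (\<lambda>_. N))"
        unfolding f'_def using x0k by (intro measurable_compose[OF _ f] measurable_fun_upd[where J=I]) auto
      show "f' (x0(k := undefined)) \<noteq> 0"
        using insert.prems(4) by (simp add: f'_def)
      show "AE s in N. f' (x(i := s)) \<noteq> 0"
        if "x \<in> space (PiM I (\<lambda>_. N))" "i \<in> I" "f' x \<noteq> 0" for x i
      proof -
        have "i \<noteq> k" using that insert.hyps by auto
        moreover have "AE s in N. f ((x(k := x0 k))(i := s)) \<noteq> 0"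
          by (rule insert.prems(2)[OF up[OF that(1) x0k] _ that(3)[unfolded f'_def]]) (use that in simp)
        moreover have "(x(k := x0 k))(i := s) = (x(i := s))(k := x0 k)" for s
          using \<open>i \<noteq> k\<close> by (rule fun_upd_twist[symmetric])
        ultimately show ?thesis by (simp only: f'_def)
      qed
    qed (fact x0I)
    have 2: "AE x in PiM I (\<lambda>_. N). AE s in N. f (x(k := s)) \<noteq> 0"
      using 1 AE_space
    proof eventually_elim
      case (elim x)
      then have "AE s in N. f ((x(k := x0 k))(k := s)) \<noteq> 0"
        by (intro insert.prems(2)[OF up[OF _ x0k] _ elim(1)[unfolded f'_def]]) auto
      then show ?case by (simp only: fun_upd_upd)
    qed
    have "(\<integral>\<^sup>+x. indicator {0} (f x) \<partial>PiM (insert k I) (\<lambda>_. N)) =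
        (\<integral>\<^sup>+x. \<integral>\<^sup>+s. indicator {0} (f (x(k := s))) \<partial>N \<partial>PiM I (\<lambda>_. N))"
      using insert.hyps by (intro product_nn_integral_insert) auto
    also have "\<dots> = (\<integral>\<^sup>+x. 0 \<partial>PiM I (\<lambda>_. N))"
    proof (rule nn_integral_cong_AE, use 2 in eventually_elim)
      case (elim x)
      have "(\<integral>\<^sup>+s. indicator {0} (f (x(k := s))) \<partial>N) = (\<integral>\<^sup>+s. 0 \<partial>N :: ennreal)"
        using elim by (intro nn_integral_cong_AE) (auto elim!: eventually_mono)
      then show ?case by simp
    qed
    finally have z: "(\<integral>\<^sup>+x. indicator {0} (f x) \<partial>PiM (insert k I) (\<lambda>_. N)) = (0::ennreal)" by simp
    have "AE x in PiM (insert k I) (\<lambda>_. N). indicator {0} (f x) = (0::ennreal)"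
      by (rule nn_integral_0_iff_AE[THEN iffD1, OF _ z]) measurable
    then show ?case by (rule AE_mp) (auto split: split_indicator_asm)
  qed
qed

lemma AE_lborel_affine_nonzero:
  assumes "p \<noteq> 0 \<or> q \<noteq> (0::real)"
  shows "AE s in lborel. p + q * s \<noteq> 0"
proof (cases "q = 0")
  case False
  have "AE s in lborel. s \<notin> {- p / q}" by (rule AE_not_in) (simp add: null_sets_def)
  then show ?thesis using False by (rule_tac AE_mp) (auto simp: field_simps)
qed (use assms in auto)

lemma AE_leb_affine_nonzero:
  fixes c :: "nat \<Rightarrow> real"
  assumes "p + dotp d c x0 \<noteq> 0" "x0 \<in> space (leb {..<d})"
  shows "AE x in leb {..<d}. p + dotp d c x \<noteq> 0"
proof (rule AE_PiM_nonzero[where ?x0.0 = x0])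
  show "AE s in lborel. p + dotp d c (x(i := s)) \<noteq> 0"
    if "i \<in> {..<d}" "p + dotp d c x \<noteq> 0" for x i
  proof -
    have "dotp d c (x(i := s)) = dotp d c (x(i := 0)) + c i * s" for s
    proof -
      have "dotp d c (x(i := s)) = (\<Sum>j<d. c j * (x(i := 0)) j + (if j = i then c i * s else 0))"
        unfolding dotp_def by (intro sum.cong) auto
      also have "\<dots> = dotp d c (x(i := 0)) + c i * s"
        using that by (simp add: sum.distrib dotp_def)
      finally show ?thesis .
    qed
    note * = this
    have "p + dotp d c (x(i := 0)) \<noteq> 0 \<or> c i \<noteq> 0"
      using *[of "x i"] that by auto
    from AE_lborel_affine_nonzero[OF this] show ?thesis
      by (subst *) (simp add: add.assoc)
  qed
qed (use assms in \<open>auto simp: dotp_def intro: lborel.sigma_finite_measure_axioms\<close>)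

lemma rdet_upd_row:
  assumes "i < d"
  shows "rdet d (A(i := r)) = dotp d (\<lambda>j. rcof d A i j) r"
proof -
  have "rcof d (A(i := r)) i j = rcof d A i j" if "j < d" for j
    by (rule rcof_cong) (use that assms in auto)
  then show ?thesis
    by (subst rdet_row[OF assms]) (auto simp: dotp_def intro!: sum.cong)
qed

lemma entry_measurable:
  assumes "i \<in> I" "j \<in> J"
  shows "(\<lambda>x. x i j) \<in> borel_measurable (PiM I (\<lambda>_. leb J))"
  using measurable_compose[OF measurable_component_singleton[OF assms(1)] measurable_component_singleton[OF assms(2), of "\<lambda>_. lborel"]]
  by simp

text \<open>The determinant is linear in each row, hence nonzero for almost every replacement of a
  row once it is nonzero for one. The identity matrix is the starting point.\<close>

lemma AE_rdet_nonzero: "AE x in PiM {..<d} (\<lambda>_. leb {..<d}). rdet d x \<noteq> 0"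
proof (rule AE_PiM_nonzero)
  let ?e = "\<lambda>i\<in>{..<d}. \<lambda>j\<in>{..<d}. if i = j then 1 else 0 :: real"
  show "?e \<in> space (PiM {..<d} (\<lambda>_. leb {..<d}))" by (auto simp: space_PiM)
  have "rdet d ?e = 1" by (subst rdet_id[symmetric, of d], rule rdet_cong) auto
  then show "rdet d ?e \<noteq> 0" by simp
  show "(\<lambda>x. rdet d x) \<in> borel_measurable (PiM {..<d} (\<lambda>_. leb {..<d}))"
    by (rule rdet_measurable) (auto intro: entry_measurable)
  fix x i assume x: "x \<in> space (PiM {..<d} (\<lambda>_. leb {..<d}))" "i \<in> {..<d}" "rdet d x \<noteq> 0"
  have "x i \<in> space (leb {..<d})" using x by (auto simp: space_PiM)
  moreover have "0 + dotp d (rcof d x i) (x i) \<noteq> 0"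
    using x rdet_upd_row[of i d x "x i"] by simp
  ultimately show "AE s in leb {..<d}. rdet d (x(i := s)) \<noteq> 0"
    using AE_leb_affine_nonzero[of 0 d "rcof d x i" "x i"] x(2) by (simp add: rdet_upd_row)
qed (auto intro: sigma_finite_leb)

section \<open>Splitting off the last coordinates\<close>

lemma nn_integral_leb_Suc:
  assumes "f \<in> borel_measurable (leb {..<Suc e})"
  shows "(\<integral>\<^sup>+x. f x \<partial>leb {..<Suc e}) = (\<integral>\<^sup>+y. \<integral>\<^sup>+t. f (y(e := t)) \<partial>lborel \<partial>leb {..<e})"
proof -
  interpret product_sigma_finite "\<lambda>_::nat. lborel :: real measure" by unfold_locales
  show ?thesis
    using product_nn_integral_insert[of "{..<e}" e f] assms by (simp add: lessThan_Suc)
qed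

lemma upd_measurable:
  fixes f :: "'a \<Rightarrow> nat \<Rightarrow> real" and g :: "'a \<Rightarrow> real"
  assumes "f \<in> measurable M (leb {..<e})" "g \<in> borel_measurable M"
  shows "(\<lambda>x. (f x)(e := g x)) \<in> measurable M (leb {..<Suc e})"
  by (rule measurable_fun_upd[where J = "{..<e}"]) (use assms in \<open>auto simp: lessThan_Suc\<close>)

definition glue :: "'i set \<Rightarrow> nat \<Rightarrow> ('i \<Rightarrow> nat \<Rightarrow> real) \<Rightarrow> ('i \<Rightarrow> real) \<Rightarrow> 'i \<Rightarrow> nat \<Rightarrow> real"
  where "glue I e y t = (\<lambda>i\<in>I. (y i)(e := t i))"

lemma glue_measurable:
  fixes f :: "'a \<Rightarrow> 'i \<Rightarrow> nat \<Rightarrow> real" and g :: "'a \<Rightarrow> 'i \<Rightarrow> real"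
  assumes [measurable]: "f \<in> measurable M (PiM I (\<lambda>_. leb {..<e}))" "g \<in> measurable M (leb I)"
  shows "(\<lambda>x. glue I e (f x) (g x)) \<in> measurable M (PiM I (\<lambda>_. leb {..<Suc e}))"
  unfolding glue_def
proof (rule measurable_restrict, rule upd_measurable)
  fix i assume "i \<in> I"
  then show "(\<lambda>x. f x i) \<in> measurable M (leb {..<e})" by measurable
  have "(\<lambda>x. g x i) \<in> measurable M lborel" using \<open>i \<in> I\<close> by measurable
  then show "(\<lambda>x. g x i) \<in> borel_measurable M" by simp
qed

text \<open>The coordinates are regrouped across the points: the first \<open>e\<close> coordinates
  of every point outside, the last coordinate of every point inside. On boxes both orders give a
  product over the points, by Fubini for a single point.\<close>

lemma nn_integral_glue:
  fixes I :: "'i set"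
  assumes "finite I" and f [measurable]: "f \<in> borel_measurable (PiM I (\<lambda>_. leb {..<Suc e}))"
  shows "(\<integral>\<^sup>+x. f x \<partial>PiM I (\<lambda>_. leb {..<Suc e})) =
    (\<integral>\<^sup>+y. \<integral>\<^sup>+t. f (glue I e y t) \<partial>leb I \<partial>PiM I (\<lambda>_. leb {..<e}))"
proof -
  let ?Y = "PiM I (\<lambda>_. leb {..<e}) :: ('i \<Rightarrow> nat \<Rightarrow> real) measure" and ?T = "leb I :: ('i \<Rightarrow> real) measure"
  let ?X = "PiM I (\<lambda>_. leb {..<Suc e}) :: ('i \<Rightarrow> nat \<Rightarrow> real) measure"
  interpret E: sigma_finite_measure "leb {..<e}" by (rule sigma_finite_leb) simp
  interpret E': sigma_finite_measure "leb {..<Suc e}" by (rule sigma_finite_leb) simp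
  interpret Y: product_sigma_finite "\<lambda>_::'i. leb {..<e}" by standard
  interpret X: product_sigma_finite "\<lambda>_::'i. leb {..<Suc e}" by standard
  interpret T: product_sigma_finite "\<lambda>_::'i. lborel :: real measure" by unfold_locales
  interpret Y': sigma_finite_measure ?Y by (rule Y.sigma_finite) fact
  interpret T': sigma_finite_measure ?T by (rule T.sigma_finite) fact
  have [measurable]: "(\<lambda>p. glue I e (fst p) (snd p)) \<in> measurable (?Y \<Otimes>\<^sub>M ?T) ?X"
    using glue_measurable[OF measurable_fst measurable_snd, where I = I and e = e] by simp
  let ?P = "distr (?Y \<Otimes>\<^sub>M ?T) ?X (\<lambda>p. glue I e (fst p) (snd p))"
  have "?P = ?X"
  proof (rule X.PiM_eqI)
    fix A assume A: "\<And>i. i \<in> I \<Longrightarrow> A i \<in> sets (leb {..<Suc e})"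
    have [measurable]: "Pi\<^sub>E I A \<in> sets ?X"
      using A \<open>finite I\<close> by (intro sets_PiM_I_finite) auto
    have m: "(\<lambda>p. indicator (A i) ((fst p)(e := snd p)) :: ennreal) \<in> borel_measurable (leb {..<e} \<Otimes>\<^sub>M lborel)"
      if "i \<in> I" for i
      by (rule measurable_compose[OF upd_measurable borel_measurable_indicator]) (use A that in auto)
    have m1: "(\<lambda>s. indicator (A i) (y(e := s)) :: ennreal) \<in> borel_measurable lborel"
      if "i \<in> I" "y \<in> space (leb {..<e})" for i y
      using measurable_compose[OF measurable_Pair1'[OF that(2)] m[OF that(1)]] by simp
    have m2: "(\<lambda>y. \<integral>\<^sup>+s. indicator (A i) (y(e := s)) \<partial>lborel) \<in> borel_measurable (leb {..<e})" if "i \<in> I" for i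
      using lborel.borel_measurable_nn_integral_fst[OF m[OF that]] by simp
    have "emeasure ?P (Pi\<^sub>E I A) = (\<integral>\<^sup>+x. indicator (Pi\<^sub>E I A) x \<partial>?P)" by simp
    also have "\<dots> = (\<integral>\<^sup>+p. indicator (Pi\<^sub>E I A) (glue I e (fst p) (snd p)) \<partial>(?Y \<Otimes>\<^sub>M ?T))"
      by (subst nn_integral_distr) auto
    also have "\<dots> = (\<integral>\<^sup>+y. \<integral>\<^sup>+t. indicator (Pi\<^sub>E I A) (glue I e y t) \<partial>?T \<partial>?Y)"
      by (subst T'.nn_integral_fst[symmetric]) auto
    also have "\<dots> = (\<integral>\<^sup>+y. \<integral>\<^sup>+t. (\<Prod>i\<in>I. indicator (A i) ((y i)(e := t i))) \<partial>?T \<partial>?Y)"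
    proof (intro nn_integral_cong)
      fix y t
      show "indicator (Pi\<^sub>E I A) (glue I e y t) = (\<Prod>i\<in>I. indicator (A i) ((y i)(e := t i)) :: ennreal)"
      proof (cases "\<forall>i\<in>I. (y i)(e := t i) \<in> A i")
        case True
        then show ?thesis by (simp add: glue_def indicator_def)
      next
        case False
        then obtain i where "i \<in> I" "(y i)(e := t i) \<notin> A i" by blast
        then have "(\<Prod>i\<in>I. indicator (A i) ((y i)(e := t i)) :: ennreal) = 0"
          using \<open>finite I\<close> by (intro prod_zero) (auto intro!: bexI[of _ i])
        moreover have "glue I e y t \<notin> Pi\<^sub>E I A"
          using False by (auto simp: glue_def PiE_iff)
        ultimately show ?thesis by simp
      qed
    qed
    also have "\<dots> = (\<integral>\<^sup>+y. (\<Prod>i\<in>I. \<integral>\<^sup>+s. indicator (A i) ((y i)(e := s)) \<partial>lborel) \<partial>?Y)"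
    proof (rule nn_integral_cong)
      fix y assume y: "y \<in> space ?Y"
      show "(\<integral>\<^sup>+t. (\<Prod>i\<in>I. indicator (A i) ((y i)(e := t i))) \<partial>?T) =
          (\<Prod>i\<in>I. \<integral>\<^sup>+s. indicator (A i) ((y i)(e := s)) \<partial>lborel :: ennreal)"
        by (rule T.product_nn_integral_prod) (use \<open>finite I\<close> y m1 in \<open>auto simp: space_PiM PiE_iff\<close>)
    qed
    also have "\<dots> = (\<Prod>i\<in>I. \<integral>\<^sup>+y. \<integral>\<^sup>+s. indicator (A i) (y(e := s)) \<partial>lborel \<partial>leb {..<e})"
      by (rule Y.product_nn_integral_prod) (use \<open>finite I\<close> m2 in auto)
    also have "\<dots> = (\<Prod>i\<in>I. emeasure (leb {..<Suc e}) (A i))"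
      using A by (intro prod.cong refl) (simp add: nn_integral_leb_Suc[symmetric])
    finally show "emeasure ?P (Pi\<^sub>E I A) = (\<Prod>i\<in>I. emeasure (leb {..<Suc e}) (A i))" .
  qed (use \<open>finite I\<close> in auto)
  then have "(\<integral>\<^sup>+x. f x \<partial>?X) = (\<integral>\<^sup>+x. f x \<partial>?P)" by simp
  also have "\<dots> = (\<integral>\<^sup>+p. f (glue I e (fst p) (snd p)) \<partial>(?Y \<Otimes>\<^sub>M ?T))"
    by (subst nn_integral_distr) auto
  also have "\<dots> = (\<integral>\<^sup>+y. \<integral>\<^sup>+t. f (glue I e y t) \<partial>?T \<partial>?Y)"
    by (subst T'.nn_integral_fst[symmetric]) auto
  finally show ?thesis .
qed

definition sqn :: "nat \<Rightarrow> (nat \<Rightarrow> real) \<Rightarrow> real"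
  where "sqn d x = (\<Sum>i<d. (x i)\<^sup>2)"

section \<open>The affine Blaschke--Petkantschin formula\<close>

text \<open>The reciprocal norm of the solution \<open>v\<close> of \<open>\<langle>x\<^sub>i, v\<rangle> = 1\<close>, written by Cramer's rule to make
  its measurability evident: the distance of the origin to the hyperplane through the \<open>x\<^sub>i\<close>.\<close>

definition plane_dist :: "nat \<Rightarrow> (nat \<Rightarrow> nat \<Rightarrow> real) \<Rightarrow> real"
  where "plane_dist d x = \<bar>rdet d x\<bar> / sqrt (\<Sum>j<d. (\<Sum>i<d. rcof d x i j)\<^sup>2)"

lemma sqn_nonneg [simp]: "0 \<le> sqn d x"
  by (simp add: sqn_def sum_nonneg)

lemma solve_linear:
  assumes "rdet d A \<noteq> 0" "j < d"
  shows "w j = (\<Sum>i<d. rcof d A i j * dotp d (A i) w) / rdet d A"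
proof -
  let ?B = "\<lambda>i j. rcof d A j i / rdet d A"
  have "is_inv d ?B A" by (rule is_inv_sym[OF is_inv_adjugate[OF assms(1)]])
  from mv_inverse[OF this assms(2), of w]
  have "w j = dotp d (\<lambda>i. rcof d A i j / rdet d A) (mv d A w)" ..
  also have "\<dots> = (\<Sum>i<d. rcof d A i j * dotp d (A i) w) / rdet d A"
    unfolding dotp_def[of d "\<lambda>i. rcof d A i j / rdet d A"] sum_divide_distrib
    by (intro sum.cong) (auto simp: mv_def)
  finally show ?thesis .
qed

lemma kernel_trivial:
  assumes "rdet d A \<noteq> 0" "\<And>i. i < d \<Longrightarrow> dotp d (A i) w = 0" "j < d"
  shows "w j = 0"
  by (subst solve_linear[OF assms(1,3)]) (simp add: assms(2))

lemma plane_dist_eq: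
  assumes "rdet d x \<noteq> 0" "\<And>i. i < d \<Longrightarrow> dotp d (x i) v = 1"
  shows "plane_dist d x = 1 / sqrt (sqn d v)"
proof -
  have "v j = (\<Sum>i<d. rcof d x i j) / rdet d x" if "j < d" for j
    by (subst solve_linear[OF assms(1) that]) (simp add: assms(2))
  then have "sqn d v = (\<Sum>j<d. (\<Sum>i<d. rcof d x i j)\<^sup>2) / (rdet d x)\<^sup>2"
    unfolding sqn_def by (simp add: power_divide sum_divide_distrib[symmetric])
  then show ?thesis by (simp add: plane_dist_def real_sqrt_divide)
qed

text \<open>The argument \<open>q\<close> stands for a squared norm. Two kinds of exponent occur:
  \<open>1/m - 1\<close> for the densities of the points, which then concentrate at norm 1, and one
  of order \<open>d^2\<close> for the distance of the hyperplane.\<close>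

definition beta_weight :: "real \<Rightarrow> real \<Rightarrow> ennreal"
  where "beta_weight \<beta> q = (if q < 1 then ennreal ((1 - q) powr \<beta>) else 0)"

lemma beta_weight_measurable [measurable]: "beta_weight \<beta> \<in> borel_measurable borel"
  unfolding beta_weight_def by measurable

text \<open>Its rows are the vectors \<open>(y i, 1)\<close>. Applied to the coefficients
  \<open>(a, b)\<close> of an affine function, the matrix returns the values at the points
  \<open>y i\<close>; it is nonsingular exactly when these points are affinely independent.\<close>

definition affmat :: "nat \<Rightarrow> (nat \<Rightarrow> nat \<Rightarrow> real) \<Rightarrow> nat \<Rightarrow> nat \<Rightarrow> real"
  where "affmat e y = (\<lambda>i j. if j < e then y i j else 1)"

lemma dotp_Suc: "dotp (Suc e) x y = dotp e x y + x e * y e"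
  by (simp add: dotp_def)

lemma dotp_cong: "(\<And>j. j < d \<Longrightarrow> x j = x' j) \<Longrightarrow> (\<And>j. j < d \<Longrightarrow> y j = y' j) \<Longrightarrow> dotp d x y = dotp d x' y'"
  by (simp add: dotp_def)

lemma sqn_cong: "(\<And>j. j < d \<Longrightarrow> x j = x' j) \<Longrightarrow> sqn d x = sqn d x'"
  by (simp add: sqn_def)

text \<open>The determinant is affine in each point separately, so almost every replacement of a
  point keeps it nonzero.\<close>

lemma AE_affmat_nonsingular:
  "AE y in PiM {..<Suc e} (\<lambda>_. leb {..<e}). rdet (Suc e) (affmat e y) \<noteq> 0"
proof (rule AE_PiM_nonzero)
  let ?d = "Suc e"
  \<comment> \<open>Affinely independent starting points: the unit vectors, and the origin as the
    point with index \<open>e\<close>.\<close>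
  let ?y = "\<lambda>i\<in>{..<?d}. \<lambda>j\<in>{..<e}. if i = j then 1 else 0 :: real"
  show "?y \<in> space (PiM {..<?d} (\<lambda>_. leb {..<e}))" by (auto simp: space_PiM)
  show "rdet ?d (affmat e ?y) \<noteq> 0"
  proof (rule rdet_nonzeroI)
    fix w assume w: "\<And>i. i < ?d \<Longrightarrow> dotp ?d (affmat e ?y i) w = 0"
    have "dotp e (affmat e ?y e) w = dotp e (\<lambda>_. 0) w"
      by (rule dotp_cong) (auto simp: affmat_def)
    with w[of e] have we: "w e = 0" by (simp add: dotp_Suc affmat_def dotp_def)
    have "w i = 0" if "i < e" for i
    proof -
      have "dotp e (affmat e ?y i) w = dotp e (\<lambda>j. if i = j then 1 else 0) w"
        using that by (intro dotp_cong) (auto simp: affmat_def)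
      also have "\<dots> = (\<Sum>j<e. if i = j then w j else 0)"
        unfolding dotp_def by (intro sum.cong) auto
      also have "\<dots> = w i" using that by simp
      finally show ?thesis using w[of i] that we by (simp add: dotp_Suc)
    qed
    with we show "\<forall>j<?d. w j = 0" by (auto simp: less_Suc_eq)
  qed
  show "(\<lambda>y. rdet ?d (affmat e y)) \<in> borel_measurable (PiM {..<?d} (\<lambda>_. leb {..<e}))"
    unfolding affmat_def
  proof (rule rdet_measurable)
    fix i j assume "i < ?d" "j < ?d"
    then show "(\<lambda>y. if j < e then y i j else 1 :: real) \<in> borel_measurable (PiM {..<?d} (\<lambda>_. leb {..<e}))"
      by (cases "j < e") (auto intro: entry_measurable)
  qed
  fix y i assume y: "y \<in> space (PiM {..<?d} (\<lambda>_. leb {..<e}))" "i \<in> {..<?d}" "rdet ?d (affmat e y) \<noteq> 0"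
  let ?C = "\<lambda>j. rcof ?d (affmat e y) i j"
  have *: "rdet ?d (affmat e (y(i := s))) = ?C e + dotp e ?C s" for s
  proof -
    have "affmat e (y(i := s)) = (affmat e y)(i := \<lambda>j. if j < e then s j else 1)"
      by (auto simp: affmat_def fun_eq_iff)
    then have "rdet ?d (affmat e (y(i := s))) = dotp ?d ?C (\<lambda>j. if j < e then s j else 1)"
      using y(2) by (simp add: rdet_upd_row)
    also have "\<dots> = ?C e + dotp e ?C s"
      by (simp add: dotp_def)
    finally show ?thesis .
  qed
  have "y i \<in> space (leb {..<e})" using y by (auto simp: space_PiM)
  moreover have "?C e + dotp e ?C (y i) \<noteq> 0"
    using y(3) *[of "y i"] by simp
  ultimately show "AE s in leb {..<e}. rdet ?d (affmat e (y(i := s))) \<noteq> 0"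
    unfolding * by (intro AE_leb_affine_nonzero[of _ _ _ "y i"]) auto
qed (auto intro: sigma_finite_leb)

definition plane_lift :: "nat \<Rightarrow> (nat \<Rightarrow> nat \<Rightarrow> real) \<Rightarrow> (nat \<Rightarrow> real) \<Rightarrow> real \<Rightarrow> nat \<Rightarrow> nat \<Rightarrow> real"
  where "plane_lift e y a b = glue {..<Suc e} e y (\<lambda>i\<in>{..<Suc e}. dotp e (y i) a + b)"

lemma mv_affmat: "mv (Suc e) (affmat e y) (a(e := b)) = (\<lambda>i\<in>{..<Suc e}. dotp e (y i) a + b)"
  by (auto simp: mv_def dotp_Suc affmat_def fun_eq_iff intro!: dotp_cong)

lemma dotp_measurable:
  assumes [measurable]: "f \<in> measurable M (leb {..<d})" "u \<in> measurable M (leb {..<d})"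
  shows "(\<lambda>x. dotp d (f x) (u x)) \<in> borel_measurable M"
proof -
  have "(\<lambda>x. f x i) \<in> measurable M lborel" "(\<lambda>x. u x i) \<in> measurable M lborel" if "i \<in> {..<d}" for i
    using that by measurable
  then show ?thesis unfolding dotp_def by (auto intro!: borel_measurable_sum borel_measurable_times)
qed

lemma sqn_measurable:
  assumes [measurable]: "f \<in> measurable M (leb {..<d})"
  shows "(\<lambda>x. sqn d (f x)) \<in> borel_measurable M"
proof -
  have "(\<lambda>x. f x i) \<in> measurable M lborel" if "i \<in> {..<d}" for i
    using that by measurable
  then show ?thesis unfolding sqn_def by (auto intro!: borel_measurable_sum borel_measurable_power)
qed

lemma dotp_row_measurable:
  assumes [measurable]: "f \<in> measurable M (PiM I (\<lambda>_. leb {..<e}))" "u \<in> measurable M (leb {..<e})" and "i \<in> I"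
  shows "(\<lambda>x. dotp e (f x i) (u x)) \<in> borel_measurable M"
  by (rule dotp_measurable) (use \<open>i \<in> I\<close> in measurable)

lemma linear_modulus_affmat_measurable:
  "(\<lambda>y. linear_modulus (Suc e) (affmat e y)) \<in> borel_measurable (PiM {..<Suc e} (\<lambda>_. leb {..<e}))"
proof -
  let ?Y = "PiM {..<Suc e} (\<lambda>_. leb {..<e}) :: (nat \<Rightarrow> nat \<Rightarrow> real) measure"
  interpret L: sigma_finite_measure "leb {..<Suc e}" by (rule sigma_finite_leb) simp
  have [measurable]: "(\<lambda>p. mv (Suc e) (affmat e (fst p)) (snd p)) \<in> measurable (?Y \<Otimes>\<^sub>M leb {..<Suc e}) (leb {..<Suc e})"
  proof (rule mv_measurable)
    fix i j assume ij: "i < Suc e" "j < Suc e"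
    have "(\<lambda>p. fst p i j) \<in> borel_measurable (?Y \<Otimes>\<^sub>M leb {..<Suc e})" if "j < e"
      by (rule measurable_compose[OF measurable_fst entry_measurable]) (use ij that in auto)
    then show "(\<lambda>p. affmat e (fst p) i j) \<in> borel_measurable (?Y \<Otimes>\<^sub>M leb {..<Suc e})"
      by (cases "j < e") (auto simp: affmat_def)
  qed simp
  have "(\<lambda>p. indicator (unit_box (Suc e)) (mv (Suc e) (affmat e (fst p)) (snd p)) :: ennreal)
      \<in> borel_measurable (?Y \<Otimes>\<^sub>M leb {..<Suc e})"
    by measurable
  from L.borel_measurable_nn_integral_fst[OF this] show ?thesis
    unfolding linear_modulus_def by simp
qed

lemma plane_lift_measurable:
  assumes [measurable]: "f \<in> measurable M (PiM {..<Suc e} (\<lambda>_. leb {..<e}))" "u \<in> measurable M (leb {..<e})"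
    "h \<in> borel_measurable M"
  shows "(\<lambda>x. plane_lift e (f x) (u x) (h x)) \<in> measurable M (PiM {..<Suc e} (\<lambda>_. leb {..<Suc e}))"
proof -
  have "(\<lambda>x. dotp e (f x i) (u x) + h x) \<in> measurable M lborel" if "i \<in> {..<Suc e}" for i
    using dotp_row_measurable[OF assms(1,2) that] by simp
  then show ?thesis
    unfolding plane_lift_def by (intro glue_measurable assms(1) measurable_restrict)
qed

lemma plane_lift_integrand_measurable:
  assumes F: "F \<in> borel_measurable (PiM {..<Suc e} (\<lambda>_. leb {..<Suc e}))"
    and f: "f \<in> measurable M (PiM {..<Suc e} (\<lambda>_. leb {..<e}))"
    and "u \<in> measurable M (leb {..<e})" "h \<in> borel_measurable M"
  shows "(\<lambda>x. inverse (linear_modulus (Suc e) (affmat e (f x))) * F (plane_lift e (f x) (u x) (h x)) :: ennreal)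
    \<in> borel_measurable M"
proof (rule borel_measurable_times_ennreal)
  have "(\<lambda>x. linear_modulus (Suc e) (affmat e (f x))) \<in> borel_measurable M"
    by (rule measurable_compose[OF f linear_modulus_affmat_measurable])
  then show "(\<lambda>x. inverse (linear_modulus (Suc e) (affmat e (f x)))) \<in> borel_measurable M"
    by measurable
qed (rule measurable_compose[OF plane_lift_measurable[OF assms(2-4)] F])

text \<open>The affine Blaschke--Petkantschin formula in graph coordinates: the points \<open>(y\<^sub>i, t\<^sub>i)\<close> lie on the
  hyperplane \<open>t = \<langle>a, y\<rangle> + b\<close>, and for fixed \<open>y\<close> the passage from \<open>t\<close> to \<open>(a, b)\<close> is linear.\<close>

lemma hyperplane_coordinates:
  assumes F [measurable]: "F \<in> borel_measurable (PiM {..<Suc e} (\<lambda>_. leb {..<Suc e}))"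
  shows "(\<integral>\<^sup>+x. F x \<partial>PiM {..<Suc e} (\<lambda>_. leb {..<Suc e})) =
    (\<integral>\<^sup>+a. \<integral>\<^sup>+b. \<integral>\<^sup>+y. inverse (linear_modulus (Suc e) (affmat e y)) * F (plane_lift e y a b)
      \<partial>PiM {..<Suc e} (\<lambda>_. leb {..<e}) \<partial>lborel \<partial>leb {..<e})"
proof -
  let ?d = "Suc e"
  let ?Y = "PiM {..<?d} (\<lambda>_. leb {..<e}) :: (nat \<Rightarrow> nat \<Rightarrow> real) measure" and ?E = "leb {..<e}"
  let ?k = "\<lambda>y. inverse (linear_modulus ?d (affmat e y))"
  interpret E: sigma_finite_measure ?E by (rule sigma_finite_leb) simp
  interpret Y: product_sigma_finite "\<lambda>_::nat. leb {..<e}" by standard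
  interpret Y': sigma_finite_measure ?Y by (rule Y.sigma_finite) simp
  interpret YE: pair_sigma_finite ?E ?Y by standard
  interpret LY: pair_sigma_finite lborel ?Y by standard
  have k [measurable]: "?k \<in> borel_measurable ?Y"
    using linear_modulus_affmat_measurable[of e] by measurable
  note mF = plane_lift_integrand_measurable[OF F]
  have "(\<integral>\<^sup>+x. F x \<partial>PiM {..<?d} (\<lambda>_. leb {..<?d})) =
      (\<integral>\<^sup>+y. \<integral>\<^sup>+t. F (glue {..<?d} e y t) \<partial>leb {..<?d} \<partial>?Y)"
    by (rule nn_integral_glue) auto
  also have "\<dots> = (\<integral>\<^sup>+y. \<integral>\<^sup>+a. \<integral>\<^sup>+b. ?k y * F (plane_lift e y a b) \<partial>lborel \<partial>?E \<partial>?Y)"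
  proof (rule nn_integral_cong_AE, use AE_affmat_nonsingular[of e] AE_space in eventually_elim)
    case (elim y)
    note y = elim(2)
    have inv: "is_inv ?d (affmat e y) (\<lambda>i j. rcof ?d (affmat e y) j i / rdet ?d (affmat e y))"
      by (rule is_inv_adjugate[OF elim(1)])
    have G: "(\<lambda>t. F (glue {..<?d} e y t)) \<in> borel_measurable (leb {..<?d})"
      by (rule measurable_compose[OF glue_measurable F]) (use y in auto)
    have mvm: "mv ?d (affmat e y) \<in> measurable (leb {..<?d}) (leb {..<?d})"
      using mv_measurable[of ?d "\<lambda>_. affmat e y" "leb {..<?d}" "\<lambda>v. v"] by simp
    have G2: "(\<lambda>v. F (glue {..<?d} e y (mv ?d (affmat e y) v))) \<in> borel_measurable (leb {..<?d})"
      by (rule measurable_compose[OF mvm G])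
    have mb: "(\<lambda>b. F (plane_lift e y a b)) \<in> borel_measurable lborel" if "a \<in> space ?E" for a
      by (rule measurable_compose[OF plane_lift_measurable F]) (use y that in auto)
    have mab: "(\<lambda>p. F (plane_lift e y (fst p) (snd p))) \<in> borel_measurable (?E \<Otimes>\<^sub>M lborel)"
      by (rule measurable_compose[OF plane_lift_measurable F]) (use y in auto)
    have ma: "(\<lambda>a. \<integral>\<^sup>+b. F (plane_lift e y a b) \<partial>lborel) \<in> borel_measurable ?E"
      using lborel.borel_measurable_nn_integral_fst[OF mab] by simp
    have "(\<integral>\<^sup>+t. F (glue {..<?d} e y t) \<partial>leb {..<?d}) =
        ?k y * (\<integral>\<^sup>+v. F (glue {..<?d} e y (mv ?d (affmat e y) v)) \<partial>leb {..<?d})"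
      by (rule linear_change_of_variables[OF inv G])
    also have "\<dots> = ?k y * (\<integral>\<^sup>+a. \<integral>\<^sup>+b. F (plane_lift e y a b) \<partial>lborel \<partial>?E)"
      by (subst nn_integral_leb_Suc[OF G2]) (simp add: mv_affmat plane_lift_def)
    also have "\<dots> = (\<integral>\<^sup>+a. ?k y * (\<integral>\<^sup>+b. F (plane_lift e y a b) \<partial>lborel) \<partial>?E)"
      by (rule nn_integral_cmult[symmetric, OF ma])
    also have "\<dots> = (\<integral>\<^sup>+a. \<integral>\<^sup>+b. ?k y * F (plane_lift e y a b) \<partial>lborel \<partial>?E)"
      by (intro nn_integral_cong nn_integral_cmult[symmetric] mb)
    finally show ?case .
  qed
  \<comment> \<open>The hyperplane \<open>(a, b)\<close> moves outside, so that its points can be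
    integrated with it held fixed.\<close>
  also have "\<dots> = (\<integral>\<^sup>+a. \<integral>\<^sup>+y. \<integral>\<^sup>+b. ?k y * F (plane_lift e y a b) \<partial>lborel \<partial>?Y \<partial>?E)"
  proof (rule YE.Fubini')
    have "(\<lambda>q. ?k (snd (fst q)) * F (plane_lift e (snd (fst q)) (fst (fst q)) (snd q))) \<in> borel_measurable ((?E \<Otimes>\<^sub>M ?Y) \<Otimes>\<^sub>M lborel)"
      by (rule mF) measurable
    from lborel.borel_measurable_nn_integral_fst[OF this]
    show "(\<lambda>(a, y). \<integral>\<^sup>+b. ?k y * F (plane_lift e y a b) \<partial>lborel) \<in> borel_measurable (?E \<Otimes>\<^sub>M ?Y)"
      by (simp add: case_prod_beta')
  qed
  also have "\<dots> = (\<integral>\<^sup>+a. \<integral>\<^sup>+b. \<integral>\<^sup>+y. ?k y * F (plane_lift e y a b) \<partial>?Y \<partial>lborel \<partial>?E)"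
  proof (rule nn_integral_cong)
    fix a assume a: "a \<in> space ?E"
    show "(\<integral>\<^sup>+y. \<integral>\<^sup>+b. ?k y * F (plane_lift e y a b) \<partial>lborel \<partial>?Y) = (\<integral>\<^sup>+b. \<integral>\<^sup>+y. ?k y * F (plane_lift e y a b) \<partial>?Y \<partial>lborel)"
      by (rule LY.Fubini', unfold case_prod_beta', rule mF) (use a in auto)
  qed
  finally show ?thesis .
qed

section \<open>Distance and ball sections of a graph hyperplane\<close>

lemma plane_lift_apply: "i < Suc e \<Longrightarrow> plane_lift e y a b i = (y i)(e := dotp e (y i) a + b)"
  by (simp add: plane_lift_def glue_def)

lemma sqn_Suc: "sqn (Suc e) x = sqn e x + (x e)\<^sup>2"
  by (simp add: sqn_def)

text \<open>All lifted points have product 1 with the vector \<open>(-a, 1) / b\<close>, whose norm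
  is \<open>sqrt (1 + sqn e a) / \<bar>b\<bar>\<close>. The excluded case \<open>b = 0\<close> is
  that of a hyperplane through the origin.\<close>

lemma plane_dist_plane_lift:
  assumes "b \<noteq> 0" and A: "rdet (Suc e) (affmat e y) \<noteq> 0"
  shows "plane_dist (Suc e) (plane_lift e y a b) = \<bar>b\<bar> / sqrt (1 + sqn e a)"
proof -
  let ?v = "\<lambda>j. if j < e then - a j / b else 1 / b"
  have "plane_dist (Suc e) (plane_lift e y a b) = 1 / sqrt (sqn (Suc e) ?v)"
  proof (rule plane_dist_eq)
    show "rdet (Suc e) (plane_lift e y a b) \<noteq> 0"
    proof (rule rdet_nonzeroI)
      fix w assume w: "\<And>i. i < Suc e \<Longrightarrow> dotp (Suc e) (plane_lift e y a b i) w = 0"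
      \<comment> \<open>The pairing of \<open>w\<close> with a lifted point equals the pairing of
        \<open>?u\<close> with the row \<open>(y i, 1)\<close>, which transfers the trivial kernel
        from \<open>affmat\<close> to the lifted points.\<close>
      let ?u = "\<lambda>j. if j < e then w j + w e * a j else b * w e"
      have "dotp (Suc e) (affmat e y i) ?u = 0" if "i < Suc e" for i
      proof -
        have "dotp (Suc e) (affmat e y i) ?u = dotp e (y i) w + dotp e (y i) a * w e + b * w e"
          by (simp add: dotp_def affmat_def sum.distrib distrib_left sum_distrib_left sum_distrib_right mult_ac)
        also have "\<dots> = dotp (Suc e) (plane_lift e y a b i) w"
        proof -
          have "dotp e ((y i)(e := dotp e (y i) a + b)) w = dotp e (y i) w"
            by (rule dotp_cong) auto
          then show ?thesis using that by (simp add: plane_lift_apply dotp_Suc distrib_right)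
        qed
        finally show ?thesis using w[OF that] by simp
      qed
      then have u: "?u j = 0" if "j < Suc e" for j
        using kernel_trivial[OF A] that by blast
      have "w e = 0" using u[of e] \<open>b \<noteq> 0\<close> by simp
      moreover have "w j = 0" if "j < e" for j using u[of j] that \<open>w e = 0\<close> by simp
      ultimately show "\<forall>j<Suc e. w j = 0" by (auto simp: less_Suc_eq)
    qed
    show "dotp (Suc e) (plane_lift e y a b i) ?v = 1" if "i < Suc e" for i
    proof -
      have "dotp e ((y i)(e := dotp e (y i) a + b)) ?v = - (dotp e (y i) a / b)"
        unfolding dotp_def by (simp add: sum_negf sum_divide_distrib)
      then show ?thesis using that \<open>b \<noteq> 0\<close> by (simp add: plane_lift_apply dotp_Suc add_divide_distrib)
    qed
  qed
  also have "sqn (Suc e) ?v = (1 + sqn e a) / b\<^sup>2"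
    by (simp add: sqn_def power_divide sum_divide_distrib[symmetric] add_divide_distrib)
  finally show ?thesis by (simp add: real_sqrt_divide)
qed

text \<open>The ellipsoid that the hyperplane cuts out of a ball, shifted to its centre \<open>- a b / s\<close> and rescaled.\<close>

lemma sphere_section:
  fixes a :: "nat \<Rightarrow> real" and e :: nat and b l :: real
  defines "s \<equiv> 1 + sqn e a"
  defines "z' \<equiv> \<lambda>z j. - (a j * b / s) + l * z j"
  shows "sqn e (z' z) + (dotp e (z' z) a + b)\<^sup>2 = b\<^sup>2 / s + l\<^sup>2 * (sqn e z + (dotp e z a)\<^sup>2)"
proof -
  have "s > 0" unfolding s_def using sqn_nonneg[of e a] by linarith
  define D where "D = dotp e z a"
  have 1: "sqn e (z' z) = (s - 1) * b\<^sup>2 / s\<^sup>2 - 2 * l * b * D / s + l\<^sup>2 * sqn e z"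
  proof -
    have "(z' z j)\<^sup>2 = (b / s)\<^sup>2 * (a j)\<^sup>2 - (2 * l * b / s) * (z j * a j) + l\<^sup>2 * (z j)\<^sup>2" for j
      unfolding z'_def using \<open>s > 0\<close> by (simp add: power2_eq_square field_simps)
    then have "sqn e (z' z) = (b / s)\<^sup>2 * sqn e a - (2 * l * b / s) * D + l\<^sup>2 * sqn e z"
      unfolding sqn_def D_def dotp_def by (simp add: sum.distrib sum_subtractf sum_distrib_left)
    then show ?thesis by (simp add: s_def power_divide mult_ac)
  qed
  have 2: "dotp e (z' z) a = - (b / s) * (s - 1) + l * D"
  proof -
    have "dotp e (z' z) a = (\<Sum>j<e. - (b / s) * (a j)\<^sup>2 + l * (z j * a j))"
      unfolding dotp_def z'_def by (intro sum.cong) (auto simp: power2_eq_square field_simps)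
    also have "\<dots> = - (b / s) * sqn e a + l * D"
      by (simp only: sum.distrib sum_distrib_left[symmetric] sqn_def D_def dotp_def)
    finally show ?thesis by (simp add: s_def)
  qed
  have 3: "dotp e (z' z) a + b = b / s + l * D"
    unfolding 2 using \<open>s > 0\<close> by (simp add: field_simps)
  show ?thesis
    unfolding 1 3 D_def[symmetric] using \<open>s > 0\<close>
    by (simp add: field_simps power2_eq_square)
qed

text \<open>The inner integral of \<open>hyperplane_coordinates\<close> for independent points with
  beta weights, without the factor that depends on the distance. It acts as an unnormalised density
  of the hyperplane \<open>(a, b)\<close>.\<close>

definition section_integral :: "nat \<Rightarrow> real \<Rightarrow> (nat \<Rightarrow> real) \<Rightarrow> real \<Rightarrow> ennreal"
  where "section_integral e \<beta> a b = (\<integral>\<^sup>+y. inverse (linear_modulus (Suc e) (affmat e y)) *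
     (\<Prod>i<Suc e. beta_weight \<beta> (sqn e (y i) + (dotp e (y i) a + b)\<^sup>2)) \<partial>PiM {..<Suc e} (\<lambda>_. leb {..<e}))"

text \<open>The squared distance of the hyperplane to the origin is
  \<open>b\<^sup>2 / (1 + sqn e a)\<close>. From distance 1 on the hyperplane misses the open ball,
  outside of which the weights vanish.\<close>

lemma section_integral_zero:
  assumes "b\<^sup>2 / (1 + sqn e a) \<ge> 1"
  shows "section_integral e \<beta> a b = 0"
proof -
  have "beta_weight \<beta> (sqn e y + (dotp e y a + b)\<^sup>2) = 0" for y
  proof -
    \<comment> \<open>Recentres at the point of the hyperplane nearest to the origin;
      \<open>sphere_section\<close> with \<open>l = 1\<close> then splits off the squared
      distance.\<close>
    define z where "z j = y j + a j * b / (1 + sqn e a)" for j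
    have "y = (\<lambda>j. - (a j * b / (1 + sqn e a)) + 1 * z j)" by (simp add: z_def)
    with sphere_section[where e = e and a = a and b = b and l = 1 and z = z]
    have "sqn e y + (dotp e y a + b)\<^sup>2 = b\<^sup>2 / (1 + sqn e a) + (sqn e z + (dotp e z a)\<^sup>2)"
      by (simp only: power_one mult_1_left)
    moreover have "0 \<le> sqn e z + (dotp e z a)\<^sup>2" by simp
    ultimately have "sqn e y + (dotp e y a + b)\<^sup>2 \<ge> 1"
      using assms by linarith
    then show ?thesis by (simp add: beta_weight_def)
  qed
  then show ?thesis by (simp add: section_integral_def)
qed

text \<open>With \<open>b\<close> integrated over the whole line, translating the points by
  \<open>c\<close> only shifts \<open>b\<close>. A dilation by \<open>l\<close> is undone by
  replacing \<open>a\<close> with \<open>l a\<close>, a substitution in \<open>e\<close>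
  variables.\<close>

lemma linear_modulus_affmat_scale:
  fixes c :: "nat \<Rightarrow> real"
  assumes "l > 0" and yz: "\<And>i j. i < Suc e \<Longrightarrow> j < e \<Longrightarrow> y i j = c j + l * z i j"
    and z: "z \<in> space (PiM {..<Suc e} (\<lambda>_. leb {..<e}))"
  shows "linear_modulus (Suc e) (affmat e z) = ennreal l ^ e * linear_modulus (Suc e) (affmat e y)"
proof -
  let ?d = "Suc e"
  define G where "G w a = (\<integral>\<^sup>+b. indicator (unit_box ?d) (\<lambda>i\<in>{..<?d}. dotp e (w i) a + b) \<partial>lborel :: ennreal)"
    for w :: "nat \<Rightarrow> nat \<Rightarrow> real" and a
  have meas: "(\<lambda>v. indicator (unit_box ?d) (mv ?d (affmat e w) v) :: ennreal) \<in> borel_measurable (leb {..<?d})" for w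
    using mv_measurable[of ?d "\<lambda>_. affmat e w" "leb {..<?d}" "\<lambda>v. v"] by measurable
  have mod: "linear_modulus ?d (affmat e w) = (\<integral>\<^sup>+a. G w a \<partial>leb {..<e})" for w
    unfolding linear_modulus_def G_def by (subst nn_integral_leb_Suc[OF meas]) (simp add: mv_affmat)
  have mG: "G z \<in> borel_measurable (leb {..<e})"
  proof -
    have "(\<lambda>p. \<lambda>i\<in>{..<?d}. dotp e (z i) (fst p) + snd p) \<in> measurable (leb {..<e} \<Otimes>\<^sub>M lborel) (leb {..<?d})"
    proof (rule measurable_restrict)
      fix i assume "i \<in> {..<?d}"
      have "(\<lambda>p. dotp e (z i) (fst p)) \<in> borel_measurable (leb {..<e} \<Otimes>\<^sub>M lborel)"
        by (rule dotp_measurable) (use z \<open>i \<in> {..<?d}\<close> in \<open>auto simp: space_PiM PiE_iff\<close>)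
      from borel_measurable_add[OF this, of snd]
      show "(\<lambda>p. dotp e (z i) (fst p) + snd p) \<in> measurable (leb {..<e} \<Otimes>\<^sub>M lborel) lborel"
        using measurable_snd[of "leb {..<e}" lborel] by simp
    qed
    then have "(\<lambda>p. indicator (unit_box ?d) (\<lambda>i\<in>{..<?d}. dotp e (z i) (fst p) + snd p) :: ennreal)
        \<in> borel_measurable (leb {..<e} \<Otimes>\<^sub>M lborel)"
      by measurable
    from lborel.borel_measurable_nn_integral_fst[OF this] show ?thesis
      unfolding G_def by simp
  qed
  have GY: "G y a = G z (\<lambda>i\<in>{..<e}. 0 + l * a i)" if a: "a \<in> space (leb {..<e})" for a
  proof -
    let ?a = "\<lambda>i\<in>{..<e}. 0 + l * a i"
    have rw: "dotp e (y i) a = dotp e c a + dotp e (z i) ?a" if "i < ?d" for i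
      using yz[OF that] by (simp add: dotp_def sum.distrib[symmetric] algebra_simps)
    have ma: "(\<lambda>b. indicator (unit_box ?d) (\<lambda>i\<in>{..<?d}. dotp e (z i) ?a + b) :: ennreal) \<in> borel_measurable lborel"
    proof (rule measurable_compose[where N = "leb {..<?d}"])
      show "(\<lambda>b. \<lambda>i\<in>{..<?d}. dotp e (z i) ?a + b) \<in> measurable lborel (leb {..<?d})"
        by (rule measurable_restrict) simp
    qed measurable
    have "G y a = (\<integral>\<^sup>+b. indicator (unit_box ?d) (\<lambda>i\<in>{..<?d}. dotp e (z i) ?a + (dotp e c a + 1 * b)) \<partial>lborel)"
    proof -
      have "(\<lambda>i\<in>{..<?d}. dotp e (y i) a + b) = (\<lambda>i\<in>{..<?d}. dotp e (z i) ?a + (dotp e c a + 1 * b))" for b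
        by (auto simp: fun_eq_iff rw)
      then show ?thesis unfolding G_def by simp
    qed
    also have "\<dots> = G z ?a"
      unfolding G_def using nn_integral_real_affine[of "\<lambda>b. indicator (unit_box ?d) (\<lambda>i\<in>{..<?d}. dotp e (z i) ?a + b)" 1 "dotp e c a"] ma
      by simp
    finally show ?thesis .
  qed
  have "linear_modulus ?d (affmat e z) = ennreal \<bar>l\<bar> ^ card {..<e} * (\<integral>\<^sup>+a. G z (\<lambda>i\<in>{..<e}. 0 + l * a i) \<partial>leb {..<e})"
    unfolding mod by (rule leb_affine) (use \<open>l > 0\<close> mG in auto)
  also have "(\<integral>\<^sup>+a. G z (\<lambda>i\<in>{..<e}. 0 + l * a i) \<partial>leb {..<e}) = linear_modulus ?d (affmat e y)"
    unfolding mod by (rule nn_integral_cong) (simp add: GY)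
  finally show ?thesis using \<open>l > 0\<close> by simp
qed

lemma section_integral_integrand_measurable:
  assumes f: "f \<in> measurable M (PiM {..<Suc e} (\<lambda>_. leb {..<e}))"
    and u: "u \<in> measurable M (leb {..<e})" and h: "h \<in> borel_measurable M"
  shows "(\<lambda>x. inverse (linear_modulus (Suc e) (affmat e (f x))) *
     (\<Prod>i<Suc e. beta_weight \<beta> (sqn e (f x i) + (dotp e (f x i) (u x) + h x)\<^sup>2))) \<in> borel_measurable M"
proof (rule borel_measurable_times_ennreal)
  have "(\<lambda>x. linear_modulus (Suc e) (affmat e (f x))) \<in> borel_measurable M"
    by (rule measurable_compose[OF f linear_modulus_affmat_measurable])
  then show "(\<lambda>x. inverse (linear_modulus (Suc e) (affmat e (f x)))) \<in> borel_measurable M"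
    by measurable
  have fi: "(\<lambda>x. f x i) \<in> measurable M (leb {..<e})" if "i \<in> {..<Suc e}" for i
    using f that by measurable
  have "(\<lambda>x. sqn e (f x i) + (dotp e (f x i) (u x) + h x)\<^sup>2) \<in> borel_measurable M" if "i \<in> {..<Suc e}" for i
    using sqn_measurable[OF fi[OF that]] dotp_measurable[OF fi[OF that] u] h by measurable
  then show "(\<lambda>x. \<Prod>i<Suc e. beta_weight \<beta> (sqn e (f x i) + (dotp e (f x i) (u x) + h x)\<^sup>2)) \<in> borel_measurable M"
    by (intro borel_measurable_prod_ennreal measurable_compose[OF _ beta_weight_measurable])
qed

text \<open>The substitution \<open>y i = c + l z i\<close> with \<open>l = sqrt q\<close> carries
  the section through the origin to the one at height \<open>b\<close>. It contributes the power
  \<open>e (e + 1)\<close> of \<open>l\<close> from the \<open>e + 1\<close> points, the power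
  \<open>e\<close> of \<open>l\<close> from the modulus, and \<open>q powr \<beta>\<close> from each
  weight; the powers of \<open>l\<close> add up to \<open>(e + 2) e\<close>, half of which is the
  power of \<open>q\<close>.\<close>

lemma section_integral_scale:
  fixes a :: "nat \<Rightarrow> real" and e :: nat and b :: real
  defines "q \<equiv> 1 - b\<^sup>2 / (1 + sqn e a)"
  assumes "q > 0" and a: "a \<in> space (leb {..<e})"
  shows "section_integral e \<beta> a b = ennreal (q powr (real (Suc e) * \<beta> + real ((e + 2) * e) / 2)) * section_integral e \<beta> a 0"
proof -
  let ?d = "Suc e"
  let ?Y = "PiM {..<?d} (\<lambda>_. leb {..<e}) :: (nat \<Rightarrow> nat \<Rightarrow> real) measure"
  define l where "l = sqrt q"
  have l: "l > 0" "l\<^sup>2 = q" using \<open>q > 0\<close> by (auto simp: l_def)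
  define s where "s = 1 + sqn e a"
  define c where "c j = - (a j * b / s)" for j
  define T where "T z = (\<lambda>j\<in>{..<e}. c j + l * z j)" for z :: "nat \<Rightarrow> real"
  define f where "f b y = inverse (linear_modulus ?d (affmat e y)) *
     (\<Prod>i<?d. beta_weight \<beta> (sqn e (y i) + (dotp e (y i) a + b)\<^sup>2))" for b y
  have fm [measurable]: "f b \<in> borel_measurable ?Y" for b
    unfolding f_def using section_integral_integrand_measurable[of "\<lambda>y. y" ?Y e "\<lambda>_. a" "\<lambda>_. b" \<beta>] a by simp
  have Tm [measurable]: "T \<in> measurable (leb {..<e}) (leb {..<e})"
    unfolding T_def by (rule measurable_restrict) (auto intro!: borel_measurable_add borel_measurable_times)
  interpret E: sigma_finite_measure "leb {..<e}" by (rule sigma_finite_leb) simp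
  have "section_integral e \<beta> a b = (\<integral>\<^sup>+y. f b y \<partial>?Y)"
    by (simp add: section_integral_def f_def)
  also have "\<dots> = (ennreal l ^ e) ^ card {..<?d} * (\<integral>\<^sup>+z. f b (\<lambda>i\<in>{..<?d}. T (z i)) \<partial>?Y)"
  proof (rule nn_integral_PiM_transform[where T = "\<lambda>_. T"])
    fix A assume A: "A \<in> sets (leb {..<e})"
    have "emeasure (leb {..<e}) A = (\<integral>\<^sup>+x. indicator A x \<partial>leb {..<e})" using A by simp
    also have "\<dots> = ennreal \<bar>l\<bar> ^ card {..<e} * (\<integral>\<^sup>+x. indicator A (\<lambda>i\<in>{..<e}. c i + l * x i) \<partial>leb {..<e})"
      by (rule leb_affine) (use l A in auto)
    also have "(\<integral>\<^sup>+x. indicator A (\<lambda>i\<in>{..<e}. c i + l * x i) \<partial>leb {..<e}) =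
        (\<integral>\<^sup>+x. indicator (T -` A \<inter> space (leb {..<e})) x \<partial>leb {..<e})"
      by (rule nn_integral_cong) (simp add: T_def indicator_def)
    also have "\<dots> = emeasure (leb {..<e}) (T -` A \<inter> space (leb {..<e}))"
      using A Tm by (intro nn_integral_indicator measurable_sets)
    finally show "emeasure (leb {..<e}) A = ennreal l ^ e * emeasure (leb {..<e}) (T -` A \<inter> space (leb {..<e}))"
      using l by simp
  qed (auto intro: E.sigma_finite_measure_axioms)
  also have "(\<integral>\<^sup>+z. f b (\<lambda>i\<in>{..<?d}. T (z i)) \<partial>?Y) =
      (\<integral>\<^sup>+z. ennreal l ^ e * ennreal (q powr \<beta>) ^ ?d * f 0 z \<partial>?Y)"
  proof (rule nn_integral_cong)
    fix z assume z: "z \<in> space ?Y"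
    let ?z = "\<lambda>i\<in>{..<?d}. T (z i)"
    have "linear_modulus ?d (affmat e z) = ennreal l ^ e * linear_modulus ?d (affmat e ?z)"
      by (rule linear_modulus_affmat_scale[where c = c]) (use l z in \<open>auto simp: T_def\<close>)
    then have m: "inverse (linear_modulus ?d (affmat e ?z)) = ennreal l ^ e * inverse (linear_modulus ?d (affmat e z))"
    proof -
      have "ennreal l ^ e * inverse (ennreal l ^ e * x) = inverse x" for x
      proof -
        have "ennreal l ^ e = ennreal (l ^ e)" using l by (simp add: ennreal_power)
        moreover have "l ^ e > 0" using l by simp
        moreover have "ennreal p * inverse (ennreal p * x) = inverse x" if "p > 0" for p
          using that by (cases x) (auto simp: ennreal_mult[symmetric] inverse_ennreal ennreal_mult_top
            zero_less_mult_iff le_less)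
        ultimately show ?thesis by metis
      qed
      with \<open>linear_modulus ?d (affmat e z) = _\<close> show ?thesis by metis
    qed
    have B: "beta_weight \<beta> (sqn e (?z i) + (dotp e (?z i) a + b)\<^sup>2) =
        ennreal (q powr \<beta>) * beta_weight \<beta> (sqn e (z i) + (dotp e (z i) a + 0)\<^sup>2)" if "i \<in> {..<?d}" for i
    proof -
      let ?w = "\<lambda>j. - (a j * b / s) + l * z i j" and ?q = "sqn e (z i) + (dotp e (z i) a)\<^sup>2"
      have "sqn e (?z i) = sqn e ?w" by (rule sqn_cong) (use that in \<open>auto simp: T_def c_def\<close>)
      moreover have "dotp e (?z i) a = dotp e ?w a"
        by (rule dotp_cong) (use that in \<open>auto simp: T_def c_def\<close>)
      moreover have "sqn e ?w + (dotp e ?w a + b)\<^sup>2 = b\<^sup>2 / s + l\<^sup>2 * ?q"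
        unfolding s_def by (rule sphere_section)
      ultimately have 1: "1 - (sqn e (?z i) + (dotp e (?z i) a + b)\<^sup>2) = q * (1 - ?q)"
        unfolding l(2) by (simp add: q_def s_def algebra_simps)
      have 2: "sqn e (?z i) + (dotp e (?z i) a + b)\<^sup>2 < 1 \<longleftrightarrow> ?q < 1"
        using 1 \<open>q > 0\<close> by (smt (verit) zero_less_mult_iff)
      show ?thesis
        unfolding beta_weight_def 2 1 using \<open>q > 0\<close> by (auto simp: powr_mult ennreal_mult)
    qed
    have "f b ?z = ennreal l ^ e * inverse (linear_modulus ?d (affmat e z)) *
       (\<Prod>i<?d. ennreal (q powr \<beta>) * beta_weight \<beta> (sqn e (z i) + (dotp e (z i) a + 0)\<^sup>2))"
      unfolding f_def m by (intro arg_cong2[where f = "(*)"] refl prod.cong B) auto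
    also have "\<dots> = ennreal l ^ e * ennreal (q powr \<beta>) ^ ?d * f 0 z"
      unfolding f_def prod.distrib by (simp add: mult_ac del: power_Suc prod.lessThan_Suc)
    finally show "f b ?z = ennreal l ^ e * ennreal (q powr \<beta>) ^ ?d * f 0 z" .
  qed
  also have "\<dots> = ennreal l ^ e * ennreal (q powr \<beta>) ^ ?d * section_integral e \<beta> a 0"
    unfolding section_integral_def f_def[symmetric] by (rule nn_integral_cmult) measurable
  finally have "section_integral e \<beta> a b = ((ennreal l ^ e) ^ ?d * (ennreal l ^ e * ennreal (q powr \<beta>) ^ ?d)) * section_integral e \<beta> a 0"
    by (simp only: card_lessThan mult.assoc)
  also have "(ennreal l ^ e) ^ ?d * (ennreal l ^ e * ennreal (q powr \<beta>) ^ ?d) =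
      ennreal (l ^ ((e + 2) * e) * (q powr \<beta>) ^ ?d)"
  proof -
    have "l ^ ((e + 2) * e) = (l ^ e) ^ ?d * l ^ e"
      by (simp add: power_mult[symmetric] power_add[symmetric] algebra_simps)
    then show ?thesis
      using l by (simp add: ennreal_power ennreal_mult[symmetric] mult.assoc del: power_Suc)
  qed
  also have "l ^ ((e + 2) * e) * (q powr \<beta>) ^ ?d = q powr (real ?d * \<beta> + real ((e + 2) * e) / 2)"
  proof -
    have "l ^ ((e + 2) * e) = q powr (real ((e + 2) * e) / 2)"
      unfolding l_def using \<open>q > 0\<close>
      by (simp add: powr_half_sqrt[symmetric] powr_powr powr_realpow[symmetric] del: of_nat_mult)
    moreover have "(q powr \<beta>) ^ ?d = q powr (real ?d * \<beta>)"
      using \<open>q > 0\<close> by (subst powr_realpow[symmetric]) (simp_all add: powr_powr mult.commute)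
    ultimately show ?thesis by (simp add: powr_add mult.commute)
  qed
  finally show ?thesis .
qed

lemma plane_dist_measurable: "plane_dist d \<in> borel_measurable (PiM {..<d} (\<lambda>_. leb {..<d}))"
proof -
  let ?M = "PiM {..<d} (\<lambda>_. leb {..<d}) :: (nat \<Rightarrow> nat \<Rightarrow> real) measure"
  have c: "(\<lambda>x. x i j) \<in> borel_measurable ?M" if "i < d" "j < d" for i j
    by (rule entry_measurable) (use that in auto)
  have 1: "(\<lambda>x. rdet d x) \<in> borel_measurable ?M"
    by (rule rdet_measurable) (rule c)
  have 2: "(\<lambda>x. rcof d x i j) \<in> borel_measurable ?M" if "i < d" "j < d" for i j
    by (rule rcof_measurable[OF that c])
  have 3: "(\<lambda>x. \<Sum>j<d. (\<Sum>i<d. rcof d x i j)\<^sup>2) \<in> borel_measurable ?M"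
    using 2 by (intro borel_measurable_sum borel_measurable_power) auto
  show ?thesis
    unfolding plane_dist_def using 1 3 by measurable
qed

lemma section_integral_eq:
  assumes "a \<in> space (leb {..<e})"
  shows "section_integral e \<beta> a b =
    section_integral e \<beta> a 0 * beta_weight (real (Suc e) * \<beta> + real ((e + 2) * e) / 2) (b\<^sup>2 / (1 + sqn e a))"
  using section_integral_zero[of b e a \<beta>] section_integral_scale[of b e a \<beta>] assms
  by (cases "b\<^sup>2 / (1 + sqn e a) < 1") (simp_all add: beta_weight_def mult.commute)

text \<open>For fixed \<open>a\<close> the substitution
  \<open>b = sqrt (1 + sqn e a) * \<eta>\<close> separates the integral into a factor depending on
  \<open>a\<close> and an integral over the signed distance \<open>\<eta>\<close>. Everything that
  depends on \<open>a\<close> is collected in \<open>K\<close>, which is common to all test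
  functions \<open>\<phi>\<close>.\<close>

lemma plane_dist_law_beta:
  fixes e :: nat and \<beta> :: real
  defines "d \<equiv> Suc e"
  shows "\<exists>K. \<forall>\<phi> \<in> borel_measurable borel.
    (\<integral>\<^sup>+x. (\<Prod>i<d. beta_weight \<beta> (sqn d (x i))) * \<phi> (plane_dist d x) \<partial>PiM {..<d} (\<lambda>_. leb {..<d})) =
      K * (\<integral>\<^sup>+\<eta>. \<phi> \<bar>\<eta>\<bar> * beta_weight (real d * \<beta> + real ((e + 2) * e) / 2) (\<eta>\<^sup>2) \<partial>lborel)"
proof (rule exI, rule ballI)
  let ?Y = "PiM {..<d} (\<lambda>_. leb {..<e}) :: (nat \<Rightarrow> nat \<Rightarrow> real) measure" and ?E = "leb {..<e}"
  let ?N = "real d * \<beta> + real ((e + 2) * e) / 2"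
  define K where "K = (\<integral>\<^sup>+a. section_integral e \<beta> a 0 * ennreal (sqrt (1 + sqn e a)) \<partial>?E)"
  fix \<phi> :: "real \<Rightarrow> ennreal" assume \<phi> [measurable]: "\<phi> \<in> borel_measurable borel"
  interpret E: sigma_finite_measure ?E by (rule sigma_finite_leb) simp
  interpret Y: product_sigma_finite "\<lambda>_::nat. leb {..<e}" by standard
  interpret Y': sigma_finite_measure ?Y by (rule Y.sigma_finite) simp
  let ?F = "\<lambda>x. (\<Prod>i<d. beta_weight \<beta> (sqn d (x i))) * \<phi> (plane_dist d x)"
  have F: "?F \<in> borel_measurable (PiM {..<d} (\<lambda>_. leb {..<d}))"
  proof (rule borel_measurable_times_ennreal)
    show "(\<lambda>x. \<Prod>i<d. beta_weight \<beta> (sqn d (x i))) \<in> borel_measurable (PiM {..<d} (\<lambda>_. leb {..<d}))"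
      by (intro borel_measurable_prod_ennreal measurable_compose[OF _ beta_weight_measurable] sqn_measurable) measurable
    show "(\<lambda>x. \<phi> (plane_dist d x)) \<in> borel_measurable (PiM {..<d} (\<lambda>_. leb {..<d}))"
      by (rule measurable_compose[OF plane_dist_measurable \<phi>])
  qed
  have mJ: "(\<lambda>a. section_integral e \<beta> a 0) \<in> borel_measurable ?E"
  proof -
    have "(\<lambda>p. inverse (linear_modulus (Suc e) (affmat e (snd p))) *
       (\<Prod>i<Suc e. beta_weight \<beta> (sqn e (snd p i) + (dotp e (snd p i) (fst p) + 0)\<^sup>2))) \<in> borel_measurable (?E \<Otimes>\<^sub>M ?Y)"
      by (rule section_integral_integrand_measurable) (auto simp: d_def)
    from Y'.borel_measurable_nn_integral_fst[OF this] show ?thesis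
      unfolding section_integral_def d_def by simp
  qed
  have inner: "(\<integral>\<^sup>+b. \<integral>\<^sup>+y. inverse (linear_modulus d (affmat e y)) * ?F (plane_lift e y a b) \<partial>?Y \<partial>lborel) =
      section_integral e \<beta> a 0 * ennreal (sqrt (1 + sqn e a)) * (\<integral>\<^sup>+\<eta>. \<phi> \<bar>\<eta>\<bar> * beta_weight ?N (\<eta>\<^sup>2) \<partial>lborel)"
    if a: "a \<in> space ?E" for a
  proof -
    define s where "s = 1 + sqn e a"
    have s: "s > 0" unfolding s_def using sqn_nonneg[of e a] by linarith
    have "(\<integral>\<^sup>+b. \<integral>\<^sup>+y. inverse (linear_modulus d (affmat e y)) * ?F (plane_lift e y a b) \<partial>?Y \<partial>lborel) =
        (\<integral>\<^sup>+b. \<phi> (\<bar>b\<bar> / sqrt s) * section_integral e \<beta> a b \<partial>lborel)"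
    proof (rule nn_integral_cong_AE)
      \<comment> \<open>Hyperplanes through the origin form a null set and are discarded, since the
        formula for the distance excludes them.\<close>
      have "AE b in lborel. (b::real) \<notin> {0}" by (rule AE_not_in) (simp add: null_sets_def)
      then show "AE b in lborel. (\<integral>\<^sup>+y. inverse (linear_modulus d (affmat e y)) * ?F (plane_lift e y a b) \<partial>?Y) =
          \<phi> (\<bar>b\<bar> / sqrt s) * section_integral e \<beta> a b"
      proof eventually_elim
        case (elim b)
        let ?G = "\<lambda>y. inverse (linear_modulus (Suc e) (affmat e y)) *
          (\<Prod>i<Suc e. beta_weight \<beta> (sqn e (y i) + (dotp e (y i) a + b)\<^sup>2))"
        have mG: "?G \<in> borel_measurable ?Y"
          by (rule section_integral_integrand_measurable) (use a in \<open>auto simp: d_def\<close>)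
        have "(\<integral>\<^sup>+y. inverse (linear_modulus d (affmat e y)) * ?F (plane_lift e y a b) \<partial>?Y) =
            (\<integral>\<^sup>+y. \<phi> (\<bar>b\<bar> / sqrt s) * ?G y \<partial>?Y)"
        proof (rule nn_integral_cong_AE)
          show "AE y in ?Y. inverse (linear_modulus d (affmat e y)) * ?F (plane_lift e y a b) = \<phi> (\<bar>b\<bar> / sqrt s) * ?G y"
            using AE_affmat_nonsingular[of e] unfolding d_def
          proof eventually_elim
            case (elim y)
            have "plane_dist (Suc e) (plane_lift e y a b) = \<bar>b\<bar> / sqrt s"
              unfolding s_def by (rule plane_dist_plane_lift) (use \<open>b \<notin> {0}\<close> elim in auto)
            moreover have "sqn (Suc e) (plane_lift e y a b i) = sqn e (y i) + (dotp e (y i) a + b)\<^sup>2" if "i < Suc e" for i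
            proof -
              have "sqn e ((y i)(e := dotp e (y i) a + b)) = sqn e (y i)" by (rule sqn_cong) auto
              then show ?thesis using that by (simp add: plane_lift_apply sqn_Suc)
            qed
            ultimately show ?case
              by (simp add: mult_ac del: prod.lessThan_Suc cong: prod.cong_simp)
          qed
        qed
        also have "\<dots> = \<phi> (\<bar>b\<bar> / sqrt s) * section_integral e \<beta> a b"
          unfolding section_integral_def d_def[symmetric] by (rule nn_integral_cmult[OF mG[unfolded d_def[symmetric]]])
        finally show ?case .
      qed
    qed
    also have "\<dots> = (\<integral>\<^sup>+b. section_integral e \<beta> a 0 * (\<phi> (\<bar>b\<bar> / sqrt s) * beta_weight ?N (b\<^sup>2 / s)) \<partial>lborel)"
      unfolding s_def d_def by (subst section_integral_eq[OF a]) (simp add: mult_ac)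
    also have "\<dots> = section_integral e \<beta> a 0 * (\<integral>\<^sup>+b. \<phi> (\<bar>b\<bar> / sqrt s) * beta_weight ?N (b\<^sup>2 / s) \<partial>lborel)"
      by (rule nn_integral_cmult) measurable
    also have "(\<integral>\<^sup>+b. \<phi> (\<bar>b\<bar> / sqrt s) * beta_weight ?N (b\<^sup>2 / s) \<partial>lborel) =
        ennreal \<bar>sqrt s\<bar> * (\<integral>\<^sup>+\<eta>. \<phi> (\<bar>0 + sqrt s * \<eta>\<bar> / sqrt s) * beta_weight ?N ((0 + sqrt s * \<eta>)\<^sup>2 / s) \<partial>lborel)"
      by (rule nn_integral_real_affine) (use s in \<open>measurable, auto\<close>)
    also have "(\<integral>\<^sup>+\<eta>. \<phi> (\<bar>0 + sqrt s * \<eta>\<bar> / sqrt s) * beta_weight ?N ((0 + sqrt s * \<eta>)\<^sup>2 / s) \<partial>lborel) =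
        (\<integral>\<^sup>+\<eta>. \<phi> \<bar>\<eta>\<bar> * beta_weight ?N (\<eta>\<^sup>2) \<partial>lborel)"
      by (rule nn_integral_cong) (use s in \<open>simp add: abs_mult power_mult_distrib\<close>)
    finally show ?thesis using s by (simp add: s_def mult.assoc)
  qed
  have "(\<integral>\<^sup>+x. ?F x \<partial>PiM {..<d} (\<lambda>_. leb {..<d})) =
      (\<integral>\<^sup>+a. \<integral>\<^sup>+b. \<integral>\<^sup>+y. inverse (linear_modulus d (affmat e y)) * ?F (plane_lift e y a b) \<partial>?Y \<partial>lborel \<partial>?E)"
    unfolding d_def by (rule hyperplane_coordinates[OF F[unfolded d_def]])
  also have "\<dots> = (\<integral>\<^sup>+a. section_integral e \<beta> a 0 * ennreal (sqrt (1 + sqn e a)) * (\<integral>\<^sup>+\<eta>. \<phi> \<bar>\<eta>\<bar> * beta_weight ?N (\<eta>\<^sup>2) \<partial>lborel) \<partial>?E)"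
    by (rule nn_integral_cong) (rule inner)
  also have "\<dots> = K * (\<integral>\<^sup>+\<eta>. \<phi> \<bar>\<eta>\<bar> * beta_weight ?N (\<eta>\<^sup>2) \<partial>lborel)"
  proof -
    have "(\<lambda>a. sqn e a) \<in> borel_measurable ?E" by (rule sqn_measurable) simp
    then have "(\<lambda>a. section_integral e \<beta> a 0 * ennreal (sqrt (1 + sqn e a))) \<in> borel_measurable ?E"
      using mJ by measurable
    then show ?thesis unfolding K_def by (rule nn_integral_multc)
  qed
  finally show "(\<integral>\<^sup>+x. ?F x \<partial>PiM {..<d} (\<lambda>_. leb {..<d})) = K * (\<integral>\<^sup>+\<eta>. \<phi> \<bar>\<eta>\<bar> * beta_weight ?N (\<eta>\<^sup>2) \<partial>lborel)" .
qed

section \<open>Polar coordinates\<close>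

lemma density_PiM:
  assumes "finite I" "sigma_finite_measure N" and w [measurable]: "w \<in> borel_measurable N"
    and sf: "sigma_finite_measure (density N w)"
  shows "PiM I (\<lambda>_. density N w) = density (PiM I (\<lambda>_. N)) (\<lambda>x. \<Prod>i\<in>I. w (x i))"
proof -
  interpret N: sigma_finite_measure N by fact
  interpret D: sigma_finite_measure "density N w" by fact
  interpret PN: product_sigma_finite "\<lambda>_. N" by standard
  interpret PD: product_sigma_finite "\<lambda>_. density N w" by standard
  have sets_eq: "sets (PiM I (\<lambda>_. density N w)) = sets (PiM I (\<lambda>_. N))"
    by (rule sets_PiM_cong) auto
  have [measurable]: "(\<lambda>x. \<Prod>i\<in>I. w (x i)) \<in> borel_measurable (PiM I (\<lambda>_. N))"
    by (intro borel_measurable_prod_ennreal measurable_compose[OF _ w] measurable_component_singleton)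
  show ?thesis
  proof (rule PD.PiM_eqI[symmetric])
    fix A assume A: "\<And>i. i \<in> I \<Longrightarrow> A i \<in> sets (density N w)"
    have [measurable]: "Pi\<^sub>E I A \<in> sets (PiM I (\<lambda>_. N))"
      using A \<open>finite I\<close> by (intro sets_PiM_I_finite) auto
    have "emeasure (density (PiM I (\<lambda>_. N)) (\<lambda>x. \<Prod>i\<in>I. w (x i))) (Pi\<^sub>E I A) =
        (\<integral>\<^sup>+x. (\<Prod>i\<in>I. w (x i)) * indicator (Pi\<^sub>E I A) x \<partial>PiM I (\<lambda>_. N))"
      by (rule emeasure_density) measurable
    also have "\<dots> = (\<integral>\<^sup>+x. (\<Prod>i\<in>I. w (x i) * indicator (A i) (x i)) \<partial>PiM I (\<lambda>_. N))"
    proof (rule nn_integral_cong)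
      fix x assume x: "x \<in> space (PiM I (\<lambda>_. N))"
      have "indicator (Pi\<^sub>E I A) x = (\<Prod>i\<in>I. indicator (A i) (x i) :: ennreal)"
      proof (cases "\<forall>i\<in>I. x i \<in> A i")
        case False
        then obtain i where "i \<in> I" "x i \<notin> A i" by blast
        then have "(\<Prod>i\<in>I. indicator (A i) (x i) :: ennreal) = 0"
          using \<open>finite I\<close> by (intro prod_zero) (auto intro!: bexI[of _ i])
        with False show ?thesis by (auto simp: indicator_def PiE_iff)
      qed (use x in \<open>auto simp: space_PiM PiE_iff\<close>)
      then show "(\<Prod>i\<in>I. w (x i)) * indicator (Pi\<^sub>E I A) x = (\<Prod>i\<in>I. w (x i) * indicator (A i) (x i))"
        by (simp add: prod.distrib)
    qed
    also have "\<dots> = (\<Prod>i\<in>I. \<integral>\<^sup>+x. w x * indicator (A i) x \<partial>N)"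
      by (rule PN.product_nn_integral_prod) (use A \<open>finite I\<close> in auto)
    also have "\<dots> = (\<Prod>i\<in>I. emeasure (density N w) (A i))"
      using A by (intro prod.cong refl emeasure_density[symmetric]) auto
    finally show "emeasure (density (PiM I (\<lambda>_. N)) (\<lambda>x. \<Prod>i\<in>I. w (x i))) (Pi\<^sub>E I A) =
        (\<Prod>i\<in>I. emeasure (density N w) (A i))" .
  qed (use \<open>finite I\<close> sets_eq in auto)
qed

lemma distr_PiM_map:
  assumes "finite I" "sigma_finite_measure N" and T [measurable]: "T \<in> measurable N N'"
    and sf: "sigma_finite_measure (distr N N' T)"
  shows "PiM I (\<lambda>_. distr N N' T) = distr (PiM I (\<lambda>_. N)) (PiM I (\<lambda>_. N')) (\<lambda>x. \<lambda>i\<in>I. T (x i))"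
proof -
  interpret N: sigma_finite_measure N by fact
  interpret D: sigma_finite_measure "distr N N' T" by fact
  interpret PN: product_sigma_finite "\<lambda>_. N" by standard
  interpret PD: product_sigma_finite "\<lambda>_. distr N N' T" by standard
  have sets_eq: "sets (PiM I (\<lambda>_. distr N N' T)) = sets (PiM I (\<lambda>_. N'))"
    by (rule sets_PiM_cong) auto
  have [measurable]: "(\<lambda>x. \<lambda>i\<in>I. T (x i)) \<in> measurable (PiM I (\<lambda>_. N)) (PiM I (\<lambda>_. N'))"
    by (intro measurable_restrict measurable_compose[OF _ T] measurable_component_singleton)
  show ?thesis
  proof (rule PD.PiM_eqI[symmetric])
    fix A assume A: "\<And>i. i \<in> I \<Longrightarrow> A i \<in> sets (distr N N' T)"
    have m: "Pi\<^sub>E I A \<in> sets (PiM I (\<lambda>_. N'))"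
      using A \<open>finite I\<close> by (intro sets_PiM_I_finite) auto
    have vim: "(\<lambda>x. \<lambda>i\<in>I. T (x i)) -` Pi\<^sub>E I A \<inter> space (PiM I (\<lambda>_. N)) =
        Pi\<^sub>E I (\<lambda>i. T -` A i \<inter> space N)"
      by (auto simp: space_PiM PiE_iff extensional_def)
    show "emeasure (distr (PiM I (\<lambda>_. N)) (PiM I (\<lambda>_. N')) (\<lambda>x. \<lambda>i\<in>I. T (x i))) (Pi\<^sub>E I A) =
        (\<Prod>i\<in>I. emeasure (distr N N' T) (A i))"
      using A \<open>finite I\<close> m by (subst emeasure_distr)
        (auto simp: vim PN.emeasure_PiM emeasure_distr intro!: prod.cong measurable_sets[OF T])
  qed (use \<open>finite I\<close> sets_eq in auto)
qed

section \<open>Volume of the ball and the uniform distribution on the sphere\<close>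

lemma enorm_eq: "enorm d x = sqrt (sqn d x)"
  by (simp add: enorm_def sqn_def)

lemma enorm_measurable [measurable]: "enorm d \<in> borel_measurable (leb {..<d})"
  unfolding enorm_eq using sqn_measurable[of "\<lambda>x. x" "leb {..<d}" d] by measurable

lemma sets_leb: "sets (leb I) = sets (PiM I (\<lambda>_. borel))"
  by (rule sets_PiM_cong) auto

lemma radial_projection_measurable [measurable]:
  "radial_projection d \<in> measurable (leb {..<d}) (PiM {..<d} (\<lambda>_. borel))"
  unfolding radial_projection_def
proof (rule measurable_restrict)
  fix i assume "i \<in> {..<d}"
  then have "(\<lambda>x. x i) \<in> borel_measurable (leb {..<d})"
    using measurable_component_singleton[of i "{..<d}" "\<lambda>_. lborel :: real measure"] by simp
  then show "(\<lambda>x. x i / enorm d x) \<in> borel_measurable (leb {..<d})"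
    by (rule borel_measurable_divide[OF _ enorm_measurable])
qed

lemma unit_ball_sets [measurable]: "unit_ball d \<in> sets (leb {..<d})"
  unfolding unit_ball_def lebesgue_measure_def by measurable

lemma sqn_scale: "sqn d (\<lambda>i\<in>{..<d}. c * x i) = c\<^sup>2 * sqn d x"
  by (simp add: sqn_def power_mult_distrib sum_distrib_left)

lemma enorm_scale: "c \<ge> 0 \<Longrightarrow> enorm d (\<lambda>i\<in>{..<d}. c * x i) = c * enorm d x"
  by (simp add: enorm_eq sqn_scale real_sqrt_mult)

lemma radial_projection_scale: "c > 0 \<Longrightarrow> radial_projection d (\<lambda>i\<in>{..<d}. c * x i) = radial_projection d x"
  by (auto simp: radial_projection_def enorm_scale fun_eq_iff)

definition ball_volume :: "nat \<Rightarrow> ennreal"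
  where "ball_volume d = emeasure (leb {..<d}) (unit_ball d)"

lemma ball_volume_finite: "ball_volume d < \<infinity>"
proof -
  interpret product_sigma_finite "\<lambda>_::nat. lborel :: real measure" by unfold_locales
  have "x i \<in> {-1..1}" if "x \<in> unit_ball d" "i < d" for x i
  proof -
    have "(x i)\<^sup>2 \<le> sqn d x" unfolding sqn_def using that by (intro member_le_sum) auto
    also have "\<dots> \<le> 1" using that by (simp add: unit_ball_def enorm_eq)
    finally show ?thesis by (simp add: abs_square_le_1 abs_le_iff)
  qed
  then have "unit_ball d \<subseteq> PiE {..<d} (\<lambda>_. {-1..1})"
    unfolding PiE_iff subset_iff by (auto simp: unit_ball_def lebesgue_measure_def space_PiM PiE_def)
  then have "ball_volume d \<le> emeasure (leb {..<d}) (PiE {..<d} (\<lambda>_. {-1..1}))"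
    unfolding ball_volume_def by (rule emeasure_mono) (auto intro!: sets_PiM_I_finite)
  also have "\<dots> = 2 ^ d" by (subst emeasure_PiM) auto
  also have "\<dots> < \<infinity>" by (simp add: power_less_top_ennreal)
  finally show ?thesis .
qed

lemma ball_volume_pos: "ball_volume d > 0"
proof -
  interpret product_sigma_finite "\<lambda>_::nat. lborel :: real measure" by unfold_locales
  \<comment> \<open>A cube of this side fits into the ball: coordinates between 0 and
    \<open>c\<close> have squares at most \<open>c\<close>, and \<open>d\<close> of them sum to at
    most 1.\<close>
  define c where "c = 1 / real (Suc d)"
  have c: "c > 0" "c \<le> 1" "real d * c \<le> 1" by (auto simp: c_def field_simps)
  have "enorm d x \<le> 1" if "\<And>i. i < d \<Longrightarrow> 0 \<le> x i \<and> x i \<le> c" for x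
  proof -
    have "sqn d x \<le> (\<Sum>i<d. c)"
      unfolding sqn_def
    proof (rule sum_mono)
      fix i assume "i \<in> {..<d}"
      then have "0 \<le> x i" "x i \<le> c" using that by auto
      then show "(x i)\<^sup>2 \<le> c" using mult_mono[of "x i" c "x i" 1] c by (simp add: power2_eq_square)
    qed
    then show ?thesis using c by (simp add: enorm_eq)
  qed
  then have "PiE {..<d} (\<lambda>_. {0..c}) \<subseteq> unit_ball d"
    by (auto simp: unit_ball_def lebesgue_measure_def space_PiM PiE_iff)
  then have "emeasure (leb {..<d}) (PiE {..<d} (\<lambda>_. {0..c})) \<le> ball_volume d"
    unfolding ball_volume_def by (rule emeasure_mono) auto
  moreover have "emeasure (leb {..<d}) (PiE {..<d} (\<lambda>_. {0..c})) = ennreal c ^ d"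
    using c by (subst emeasure_PiM) auto
  moreover have "ennreal c ^ d > 0" using c by (simp add: ennreal_power)
  ultimately show ?thesis by simp
qed

lemma prob_space_uniform_sphere: "prob_space (uniform_sphere d)"
proof -
  have "prob_space (uniform_measure (leb {..<d}) (unit_ball d))"
    using ball_volume_pos[of d] ball_volume_finite[of d]
    by (intro prob_space_uniform_measure) (auto simp: ball_volume_def)
  then show ?thesis
    unfolding uniform_sphere_def lebesgue_measure_def by (intro prob_space.prob_space_distr) auto
qed

lemma sets_uniform_sphere [simp]: "sets (uniform_sphere d) = sets (PiM {..<d} (\<lambda>_. borel))"
  by (simp add: uniform_sphere_def)

lemma measurable_uniform_sphere [simp]: "measurable (uniform_sphere d) N = measurable (PiM {..<d} (\<lambda>_. borel)) N"
  by (rule measurable_cong_sets) simp_all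

lemma emeasure_uniform_sphere:
  assumes "C \<in> sets (PiM {..<d} (\<lambda>_. borel))"
  shows "emeasure (leb {..<d}) {x \<in> unit_ball d. radial_projection d x \<in> C} = ball_volume d * emeasure (uniform_sphere d) C"
proof -
  have eq: "{x \<in> unit_ball d. radial_projection d x \<in> C} = unit_ball d \<inter> (radial_projection d -` C \<inter> space (leb {..<d}))"
    by (auto simp: unit_ball_def lebesgue_measure_def)
  have "emeasure (uniform_sphere d) C = emeasure (leb {..<d}) {x \<in> unit_ball d. radial_projection d x \<in> C} / ball_volume d"
    unfolding uniform_sphere_def lebesgue_measure_def eq ball_volume_def using assms
    by (subst emeasure_distr, simp, simp, subst emeasure_uniform_measure) (auto intro!: measurable_sets[OF radial_projection_measurable])
  moreover have "ball_volume d * (x / ball_volume d) = x" for x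
    using ball_volume_pos[of d] ball_volume_finite[of d] ennreal_mult_divide_eq[of "ball_volume d" x]
    by (simp add: ennreal_times_divide mult.commute[of "ball_volume d"])
  ultimately show ?thesis by simp
qed

text \<open>The density of the norm under Lebesgue measure with the volume of the unit ball divided
  out: the norms below \<open>r\<close> get mass \<open>r ^ d\<close>.\<close>

definition radial_density :: "nat \<Rightarrow> real \<Rightarrow> ennreal"
  where "radial_density d s = ennreal (real d * s ^ (d - 1)) * indicator {0..} s"

lemma radial_density_measurable [measurable]: "radial_density d \<in> borel_measurable borel"
  unfolding radial_density_def by measurable

lemma radial_density_integral:
  assumes "d > 0" "r > 0"
  shows "(\<integral>\<^sup>+s. radial_density d s * indicator {..<r} s \<partial>lborel) = ennreal (r ^ d)"
proof -
  have "((\<lambda>s. real d * s ^ (d - 1)) has_integral (r ^ d - 0 ^ d)) {0..r}"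
    using assms by (intro fundamental_theorem_of_calculus)
      (auto intro!: derivative_eq_intros simp: has_real_derivative_iff_has_vector_derivative[symmetric])
  then have "((\<lambda>s. real d * s ^ (d - 1)) has_integral r ^ d) {0..r}"
    using assms by (simp add: zero_power)
  then have "(\<integral>\<^sup>+s. ennreal (real d * s ^ (d - 1)) * indicator {0..r} s \<partial>lborel) = ennreal (r ^ d)"
    by (intro nn_integral_has_integral_lebesgue') auto
  moreover have "(\<integral>\<^sup>+s. radial_density d s * indicator {..<r} s \<partial>lborel) =
      (\<integral>\<^sup>+s. ennreal (real d * s ^ (d - 1)) * indicator {0..r} s \<partial>lborel)"
  proof (rule nn_integral_cong_AE)
    have "AE s in lborel. s \<notin> {r}" by (rule AE_not_in) (simp add: null_sets_def)
    then show "AE s in lborel. radial_density d s * indicator {..<r} s = ennreal (real d * s ^ (d - 1)) * indicator {0..r} s"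
      by (rule AE_mp) (auto simp: radial_density_def indicator_def)
  qed
  ultimately show ?thesis by simp
qed

text \<open>Dilation by \<open>r\<close> multiplies volumes by \<open>r ^ d\<close>, so
  \<open>r = 1\<close> suffices. There the open cone segment is compared with the closed one
  underlying \<open>uniform_sphere\<close>, which is contained in the open segments of radius
  \<open>1 + 1 / (n + 1)\<close> for all \<open>n\<close>.\<close>

lemma emeasure_cone_segment:
  assumes C: "C \<in> sets (PiM {..<d} (\<lambda>_. borel))" and "d > 0" "r > 0"
  shows "emeasure (leb {..<d}) {x \<in> space (leb {..<d}). enorm d x < r \<and> radial_projection d x \<in> C} =
    ennreal (r ^ d) * (ball_volume d * emeasure (uniform_sphere d) C)"
proof -
  let ?L = "leb {..<d} :: (nat \<Rightarrow> real) measure"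
  let ?S = "\<lambda>r. {x \<in> space ?L. enorm d x < r \<and> radial_projection d x \<in> C}"
  note C [measurable]
  have m [measurable]: "?S r \<in> sets ?L" for r by measurable
  have scale: "emeasure ?L (?S r) = ennreal (r ^ d) * emeasure ?L (?S 1)" if "r > 0" for r
  proof -
    have "emeasure ?L (?S r) = (\<integral>\<^sup>+x. indicator (?S r) x \<partial>?L)" by simp
    also have "\<dots> = ennreal \<bar>r\<bar> ^ card {..<d} * (\<integral>\<^sup>+x. indicator (?S r) (\<lambda>i\<in>{..<d}. 0 + r * x i) \<partial>?L)"
      by (rule leb_affine) (use that in auto)
    also have "(\<integral>\<^sup>+x. indicator (?S r) (\<lambda>i\<in>{..<d}. 0 + r * x i) \<partial>?L) = (\<integral>\<^sup>+x. indicator (?S 1) x \<partial>?L)"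
      by (rule nn_integral_cong)
         (use that in \<open>auto simp: indicator_def enorm_scale radial_projection_scale space_PiM\<close>)
    finally show ?thesis using that by (simp add: ennreal_power)
  qed
  have "emeasure ?L (?S 1) = ball_volume d * emeasure (uniform_sphere d) C" (is "?a = ?b")
  proof (rule antisym)
    have b: "emeasure ?L {x \<in> unit_ball d. radial_projection d x \<in> C} = ?b"
      by (rule emeasure_uniform_sphere[OF C])
    have bm: "{x \<in> unit_ball d. radial_projection d x \<in> C} \<in> sets ?L"
      unfolding unit_ball_def lebesgue_measure_def by measurable
    show "?a \<le> ?b" unfolding b[symmetric]
      by (rule emeasure_mono[OF _ bm]) (auto simp: unit_ball_def lebesgue_measure_def)
    have le: "?b \<le> ennreal ((1 + 1 / real (Suc n)) ^ d) * ?a" for n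
    proof -
      have "?b \<le> emeasure ?L (?S (1 + 1 / real (Suc n)))" unfolding b[symmetric]
      proof (rule emeasure_mono[OF _ m])
        have "1 < 1 + 1 / real (Suc n)" by simp
        then show "{x \<in> unit_ball d. radial_projection d x \<in> C} \<subseteq> ?S (1 + 1 / real (Suc n))"
          by (auto simp: unit_ball_def lebesgue_measure_def intro: le_less_trans)
      qed
      also have "\<dots> = ennreal ((1 + 1 / real (Suc n)) ^ d) * ?a"
        by (rule scale) (simp add: add_pos_pos)
      finally show ?thesis .
    qed
    have "(\<lambda>n. (1 + 1 / real (Suc n)) ^ d) \<longlonglongrightarrow> (1 + 0) ^ d"
      by (intro tendsto_intros LIMSEQ_Suc lim_1_over_n)
    then have "(\<lambda>n. ennreal ((1 + 1 / real (Suc n)) ^ d) * ?a) \<longlonglongrightarrow> ennreal ((1 + 0) ^ d) * ?a"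
      by (intro tendsto_mult_ennreal tendsto_const tendsto_ennrealI) auto
    then have "(\<lambda>n. ennreal ((1 + 1 / real (Suc n)) ^ d) * ?a) \<longlonglongrightarrow> ?a" by simp
    then show "?b \<le> ?a" by (rule LIMSEQ_le_const) (use le in blast)
  qed
  then show ?thesis using scale[OF \<open>r > 0\<close>] by simp
qed

text \<open>Reflection turns half-lines bounded above, which have finite mass under the law of a
  norm, into the half-lines bounded below that identify a measure.\<close>

lemma distr_uminus_eqI:
  fixes M N :: "real measure"
  assumes sets: "sets M = sets borel" "sets N = sets borel"
    and fin: "\<And>r. emeasure M {..<r} < \<infinity>" and eq: "\<And>r. emeasure M {..<r} = emeasure N {..<r}"
  shows "M = N"
proof -
  have um: "uminus \<in> measurable M borel" "uminus \<in> measurable N borel"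
    unfolding measurable_cong_sets[OF sets(1) refl] measurable_cong_sets[OF sets(2) refl] by simp_all
  have sp: "space M = UNIV" "space N = UNIV"
    using sets by (auto dest: sets_eq_imp_space_eq)
  have e: "emeasure (distr K borel uminus) {x<..} = emeasure K {..<- x}"
    if "uminus \<in> measurable K borel" "space K = UNIV" for K :: "real measure" and x
  proof -
    have "uminus -` {x<..} = {..<- x}" by auto
    then show ?thesis using that by (simp add: emeasure_distr)
  qed
  have eqd: "distr M borel uminus = distr N borel uminus"
  proof (rule measure_eqI_lessThan)
    show "emeasure (distr M borel uminus) {x<..} < \<infinity>" for x
      using fin[of "- x"] by (simp only: e[OF um(1) sp(1)])
    show "emeasure (distr M borel uminus) {x<..} = emeasure (distr N borel uminus) {x<..}" for x
      using eq[of "- x"] by (simp only: e[OF um(1) sp(1)] e[OF um(2) sp(2)])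
  qed auto
  show "M = N"
  proof (rule measure_eqI)
    fix A assume "A \<in> sets M"
    then have A: "A \<in> sets borel" using sets by simp
    have "uminus -` A \<inter> space borel \<in> sets borel"
      by (rule measurable_sets[OF _ A]) simp
    then have B: "uminus -` A \<in> sets borel" by simp
    have "uminus -` (uminus -` A) = A" by auto
    then have *: "emeasure (distr K borel uminus) (uminus -` A) = emeasure K A"
      if "uminus \<in> measurable K borel" "space K = UNIV" for K
      using that B by (simp add: emeasure_distr)
    show "emeasure M A = emeasure N A"
      using *[OF um(1) sp(1)] *[OF um(2) sp(2)] eqd by simp
  qed (simp add: sets)
qed

text \<open>For a fixed set \<open>C\<close> of directions both sides are measures in
  \<open>B\<close>. They are finite on the half-lines \<open>{..<r}\<close> and agree there by
  \<open>emeasure_cone_segment\<close>.\<close>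

lemma polar_set:
  assumes C [measurable]: "C \<in> sets (PiM {..<d} (\<lambda>_. borel))" and "d > 0"
    and B [measurable]: "B \<in> sets borel"
  shows "emeasure (leb {..<d}) {x \<in> space (leb {..<d}). enorm d x \<in> B \<and> radial_projection d x \<in> C} =
    ball_volume d * emeasure (uniform_sphere d) C * emeasure (density lborel (radial_density d)) B"
proof -
  let ?L = "leb {..<d} :: (nat \<Rightarrow> real) measure"
  define k where "k = ball_volume d * emeasure (uniform_sphere d) C"
  interpret S: prob_space "uniform_sphere d" by (rule prob_space_uniform_sphere)
  have k: "k < \<infinity>"
    unfolding k_def using ball_volume_finite[of d] S.emeasure_le_1[of C]
    by (metis ennreal_mult_less_top ennreal_one_less_top infinity_ennreal_def le_less_trans)
  define D where "D = density ?L (\<lambda>x. indicator C (radial_projection d x))"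
  have Dm: "measurable D N = measurable ?L N" for N :: "real measure"
    unfolding D_def by (rule measurable_cong_sets) auto
  let ?M = "distr D borel (enorm d)" and ?N = "scale_measure k (density lborel (radial_density d))"
  have M: "emeasure ?M A = emeasure ?L {x \<in> space ?L. enorm d x \<in> A \<and> radial_projection d x \<in> C}"
    if [measurable]: "A \<in> sets borel" for A
  proof -
    have "emeasure ?M A = emeasure D (enorm d -` A \<inter> space ?L)"
      by (subst emeasure_distr) (auto simp: Dm D_def)
    also have "\<dots> = (\<integral>\<^sup>+x. indicator C (radial_projection d x) * indicator (enorm d -` A \<inter> space ?L) x \<partial>?L)"
      unfolding D_def by (rule emeasure_density) measurable
    also have "\<dots> = (\<integral>\<^sup>+x. indicator {x \<in> space ?L. enorm d x \<in> A \<and> radial_projection d x \<in> C} x \<partial>?L)"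
      by (rule nn_integral_cong) (auto simp: indicator_def)
    also have "\<dots> = emeasure ?L {x \<in> space ?L. enorm d x \<in> A \<and> radial_projection d x \<in> C}"
      by (rule nn_integral_indicator) measurable
    finally show ?thesis .
  qed
  have pos: "emeasure ?M {..<r} = k * ennreal (r ^ d)" if "r > 0" for r
    using emeasure_cone_segment[OF C \<open>d > 0\<close> that] by (simp add: M k_def mult.commute)
  have neg: "emeasure ?M {..<r} = 0" if "\<not> r > 0" for r
  proof -
    have "{x \<in> space ?L. enorm d x \<in> {..<r} \<and> radial_projection d x \<in> C} = {}"
      using that by (auto simp: enorm_eq not_less intro: order_trans)
    then have "emeasure ?M {..<r} = emeasure ?L {}"
      using M[of "{..<r}"] by (simp only: borel_open open_lessThan)
    then show ?thesis by simp
  qed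
  have Npos: "emeasure ?N {..<r} = k * ennreal (r ^ d)" if "r > 0" for r
    using radial_density_integral[OF \<open>d > 0\<close> that] by (simp add: emeasure_density)
  have Nneg: "emeasure ?N {..<r} = 0" if "\<not> r > 0" for r
  proof -
    have "(\<lambda>s. radial_density d s * indicator {..<r} s) = (\<lambda>_. 0)"
      using that by (auto simp: radial_density_def indicator_def fun_eq_iff)
    then show ?thesis by (simp add: emeasure_density)
  qed
  have "?M = ?N"
  proof (rule distr_uminus_eqI)
    show "emeasure ?M {..<r} < \<infinity>" for r
      using k pos[of r] neg[of r] by (cases "r > 0") (auto simp: ennreal_mult_less_top)
    show "emeasure ?M {..<r} = emeasure ?N {..<r}" for r
      using pos[of r] neg[of r] Npos[of r] Nneg[of r] by (cases "r > 0") auto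
  qed auto
  then have "emeasure ?M B = emeasure ?N B" by simp
  then show ?thesis by (simp add: M k_def)
qed

text \<open>By \<open>polar_set\<close> the joint image of norm and direction gives every rectangle
  the mass of a product measure, which determines it because both factors are \<sigma>-finite. The
  rest is Fubini for that product.\<close>

lemma polar_coordinates:
  assumes "d > 0" and F [measurable]: "F \<in> borel_measurable (borel \<Otimes>\<^sub>M PiM {..<d} (\<lambda>_. borel))"
  shows "(\<integral>\<^sup>+x. F (enorm d x, radial_projection d x) \<partial>leb {..<d}) =
    ball_volume d * (\<integral>\<^sup>+s. radial_density d s * (\<integral>\<^sup>+\<theta>. F (s, \<theta>) \<partial>uniform_sphere d) \<partial>lborel)"
proof -
  let ?L = "leb {..<d} :: (nat \<Rightarrow> real) measure" and ?B = "PiM {..<d} (\<lambda>_. borel) :: (nat \<Rightarrow> real) measure"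
  let ?R = "density lborel (radial_density d)" and ?S = "uniform_sphere d"
  interpret S: prob_space ?S by (rule prob_space_uniform_sphere)
  let ?Q = "density lborel (\<lambda>s. ball_volume d * radial_density d s)"
  have sQ: "sigma_finite_measure ?Q"
    using ball_volume_finite[of d]
    by (subst sigma_finite_measure.sigma_finite_iff_density_finite[OF lborel.sigma_finite_measure_axioms])
       (auto simp: radial_density_def indicator_def ennreal_mult_eq_top_iff)
  have QR: "emeasure ?Q A = ball_volume d * emeasure ?R A" if "A \<in> sets borel" for A
    using that by (simp add: emeasure_density mult.assoc nn_integral_cmult)
  have pm [measurable]: "(\<lambda>x. (enorm d x, radial_projection d x)) \<in> measurable ?L (borel \<Otimes>\<^sub>M ?B)"
    by measurable
  have "?Q \<Otimes>\<^sub>M ?S = distr ?L (borel \<Otimes>\<^sub>M ?B) (\<lambda>x. (enorm d x, radial_projection d x))"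
  proof (rule pair_measure_eqI[OF sQ])
    fix A C assume A: "A \<in> sets ?Q" and C: "C \<in> sets ?S"
    have "emeasure (distr ?L (borel \<Otimes>\<^sub>M ?B) (\<lambda>x. (enorm d x, radial_projection d x))) (A \<times> C) =
      emeasure ?L {x \<in> space ?L. enorm d x \<in> A \<and> radial_projection d x \<in> C}"
      using A C by (subst emeasure_distr) (auto intro!: arg_cong[where f = "emeasure ?L"])
    also have "\<dots> = ball_volume d * emeasure ?S C * emeasure ?R A"
      by (rule polar_set) (use A C \<open>d > 0\<close> in auto)
    finally show "emeasure ?Q A * emeasure ?S C =
        emeasure (distr ?L (borel \<Otimes>\<^sub>M ?B) (\<lambda>x. (enorm d x, radial_projection d x))) (A \<times> C)"
      using A by (simp add: QR mult_ac)
  qed (auto intro: S.sigma_finite_measure_axioms cong: sets_pair_measure_cong)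
  then have "(\<integral>\<^sup>+x. F (enorm d x, radial_projection d x) \<partial>?L) = (\<integral>\<^sup>+p. F p \<partial>(?Q \<Otimes>\<^sub>M ?S))"
    by (simp add: nn_integral_distr)
  also have "\<dots> = (\<integral>\<^sup>+s. \<integral>\<^sup>+\<theta>. F (s, \<theta>) \<partial>?S \<partial>?Q)"
    by (rule S.nn_integral_fst[symmetric]) (simp cong: measurable_cong_sets sets_pair_measure_cong)
  also have "\<dots> = (\<integral>\<^sup>+s. ball_volume d * radial_density d s * (\<integral>\<^sup>+\<theta>. F (s, \<theta>) \<partial>?S) \<partial>lborel)"
  proof (rule nn_integral_density)
    have "F \<in> borel_measurable (lborel \<Otimes>\<^sub>M ?S)" by (simp cong: measurable_cong_sets sets_pair_measure_cong)
    from S.borel_measurable_nn_integral_fst[OF this]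
    show "(\<lambda>s. \<integral>\<^sup>+\<theta>. F (s, \<theta>) \<partial>?S) \<in> borel_measurable lborel" .
  qed measurable
  also have "\<dots> = ball_volume d * (\<integral>\<^sup>+s. radial_density d s * (\<integral>\<^sup>+\<theta>. F (s, \<theta>) \<partial>?S) \<partial>lborel)"
  proof -
    have "F \<in> borel_measurable (lborel \<Otimes>\<^sub>M ?S)" by (simp cong: measurable_cong_sets sets_pair_measure_cong)
    from S.borel_measurable_nn_integral_fst[OF this]
    have "(\<lambda>s. radial_density d s * (\<integral>\<^sup>+\<theta>. F (s, \<theta>) \<partial>?S)) \<in> borel_measurable lborel"
      by measurable
    from nn_integral_cmult[OF this] show ?thesis by (simp add: mult.assoc)
  qed
  finally show ?thesis .
qed

section \<open>Radial substitution for the beta densities\<close>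

definition unif01 :: "real measure"
  where "unif01 = uniform_measure lborel {0<..<1}"

lemma prob_space_unif01: "prob_space unif01"
  unfolding unif01_def by (rule prob_space_uniform_measure) auto

lemma sets_unif01 [measurable_cong, simp]: "sets unif01 = sets borel"
  by (simp add: unif01_def)

lemma nn_integral_unif01:
  assumes [measurable]: "f \<in> borel_measurable borel"
  shows "(\<integral>\<^sup>+u. f u \<partial>unif01) = (\<integral>\<^sup>+u. f u * indicator {0<..<1} u \<partial>lborel)"
proof -
  have "emeasure lborel {0<..<1::real} = 1" by simp
  then show ?thesis
    unfolding unif01_def by (subst nn_integral_uniform_measure) (auto simp: divide_ennreal_def)
qed

lemma AE_unif01: "AE u in unif01. 0 < u \<and> u < 1"
  unfolding unif01_def by (rule AE_uniform_measureI) auto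

lemma beta_integral_tail:
  fixes m :: nat and \<tau> :: real
  assumes "m > 0" "0 \<le> \<tau>" "\<tau> < 1"
  shows "(\<integral>\<^sup>+s. ennreal ((1 - s) powr (1 / real m - 1)) * indicator {\<tau><..<1} s \<partial>lborel) =
    ennreal (real m * (1 - \<tau>) powr (1 / real m))"
proof -
  let ?b = "1 / real m - 1"
  have "(\<integral>\<^sup>+s. ennreal ((1 - s) powr ?b) * indicator {\<tau><..<1} s \<partial>lborel) =
      ennreal \<bar>-1\<bar> * (\<integral>\<^sup>+x. ennreal ((1 - (1 + -1 * x)) powr ?b) * indicator {\<tau><..<1} (1 + -1 * x) \<partial>lborel)"
    by (rule nn_integral_real_affine) auto
  also have "\<dots> = (\<integral>\<^sup>+x. ennreal (x powr ?b) * indicator {0..1 - \<tau>} x \<partial>lborel)"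
  proof -
    have "AE x in lborel. (x::real) \<notin> {0, 1 - \<tau>}" by (rule AE_not_in) (simp add: null_sets_def emeasure_lborel_countable)
    then have "AE x in lborel. ennreal ((1 - (1 + -1 * x)) powr ?b) * indicator {\<tau><..<1} (1 + -1 * x) =
        ennreal (x powr ?b) * indicator {0..1 - \<tau>} x"
      by (rule AE_mp) (auto simp: indicator_def)
    from nn_integral_cong_AE[OF this] show ?thesis by simp
  qed
  also have "\<dots> = ennreal ((1 - \<tau>) powr (?b + 1) / (?b + 1))"
    by (rule nn_integral_has_integral_lebesgue'[OF _ has_integral_powr_from_0]) (use assms in auto)
  also have "(1 - \<tau>) powr (?b + 1) / (?b + 1) = real m * (1 - \<tau>) powr (1 / real m)" using assms by simp
  finally show ?thesis .
qed

text \<open>For uniform \<open>u\<close> the variable \<open>1 - u ^ m\<close> exceeds a given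
  \<open>t\<close> between 0 and 1 with probability \<open>(1 - t) powr (1 / m)\<close>, and the
  density on the left has mass \<open>m\<close> times this on the same tail. Upper tails determine a
  finite measure.\<close>

lemma beta_integral_substitution:
  fixes m :: nat
  assumes "m > 0" and H [measurable]: "H \<in> borel_measurable borel"
  shows "(\<integral>\<^sup>+s. ennreal ((1 - s) powr (1 / real m - 1)) * indicator {0<..<1} s * H s \<partial>lborel) =
    ennreal (real m) * (\<integral>\<^sup>+u. H (1 - u ^ m) \<partial>unif01)"
proof -
  let ?w = "\<lambda>s. ennreal ((1 - s) powr (1 / real m - 1)) * indicator {0<..<1} s"
  let ?A = "density lborel ?w" and ?B = "scale_measure (ennreal (real m)) (distr unif01 borel (\<lambda>u. 1 - u ^ m))"
  interpret U: prob_space unif01 by (rule prob_space_unif01)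
  have [measurable]: "(\<lambda>u. 1 - u ^ m) \<in> borel_measurable unif01"
    by (simp add: measurable_cong_sets[OF sets_unif01 refl])
  have A: "emeasure ?A {t<..} = (\<integral>\<^sup>+s. ?w s * indicator {t<..} s \<partial>lborel)" for t
    by (rule emeasure_density) auto
  have A1: "emeasure ?A {t<..} = ennreal (real m * (1 - max t 0) powr (1 / real m))" if "t < 1" for t
  proof -
    have "emeasure ?A {t<..} = (\<integral>\<^sup>+s. ennreal ((1 - s) powr (1 / real m - 1)) * indicator {max t 0<..<1} s \<partial>lborel)"
      unfolding A by (rule nn_integral_cong) (auto simp: indicator_def)
    then show ?thesis using beta_integral_tail[of m "max t 0"] assms that by simp
  qed
  have A2: "emeasure ?A {t<..} = 0" if "\<not> t < 1" for t
  proof -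
    have "(\<lambda>s. ?w s * indicator {t<..} s) = (\<lambda>_. 0)" using that by (auto simp: indicator_def fun_eq_iff)
    then show ?thesis unfolding A by simp
  qed
  have B: "emeasure ?B {t<..} = ennreal (real m) * (\<integral>\<^sup>+u. indicator {t<..} (1 - u ^ m) * indicator {0<..<1} u \<partial>lborel)" for t
  proof -
    have "emeasure (distr unif01 borel (\<lambda>u. 1 - u ^ m)) {t<..} = (\<integral>\<^sup>+x. indicator {t<..} x \<partial>distr unif01 borel (\<lambda>u. 1 - u ^ m))"
      by simp
    also have "\<dots> = (\<integral>\<^sup>+u. indicator {t<..} (1 - u ^ m) \<partial>unif01)"
      by (rule nn_integral_distr) auto
    also have "\<dots> = (\<integral>\<^sup>+u. indicator {t<..} (1 - u ^ m) * indicator {0<..<1} u \<partial>lborel)"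
      by (rule nn_integral_unif01) measurable
    finally show ?thesis by simp
  qed
  have B1: "emeasure ?B {t<..} = ennreal (real m * (1 - max t 0) powr (1 / real m))" if "t < 1" for t
  proof -
    define z where "z = (1 - max t 0) powr (1 / real m)"
    have z: "0 < z" "z \<le> 1" using that assms by (auto simp: z_def powr_le1)
    have zm: "z ^ m = 1 - max t 0"
      using that assms by (simp add: z_def powr_realpow[symmetric] powr_powr)
    have "indicator {t<..} (1 - u ^ m) * indicator {0<..<1} u = (indicator {0<..<z} u :: ennreal)" for u :: real
    proof (cases "0 < u \<and> u < 1")
      case True
      then have "u ^ m < 1" using \<open>m > 0\<close> by (simp add: power_less_one_iff)
      have "u < z \<longleftrightarrow> u ^ m < z ^ m" using True z power_mono_iff[of z u m] \<open>m > 0\<close> by linarith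
      also have "\<dots> \<longleftrightarrow> t < 1 - u ^ m" unfolding zm using \<open>u ^ m < 1\<close> by (auto simp: max_def)
      finally show ?thesis using True by (simp add: indicator_def)
    next
      case False
      then show ?thesis using z by (auto simp: indicator_def)
    qed
    then have "emeasure ?B {t<..} = ennreal (real m) * emeasure lborel {0<..<z}" unfolding B by simp
    then show ?thesis using z by (simp add: ennreal_mult z_def)
  qed
  have B2: "emeasure ?B {t<..} = 0" if "\<not> t < 1" for t
  proof -
    have "(\<lambda>u. indicator {t<..} (1 - u ^ m) * indicator {0<..<1} u :: ennreal) = (\<lambda>_. 0)"
    proof
      fix u :: real
      show "indicator {t<..} (1 - u ^ m) * indicator {0<..<1} u = (0 :: ennreal)"
      proof (cases "0 < u")
        case True
        then have "u ^ m > 0" by simp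
        then show ?thesis using that by (simp add: indicator_def)
      qed simp
    qed
    then show ?thesis unfolding B by simp
  qed
  have "?A = ?B"
  proof (rule measure_eqI_lessThan)
    show "emeasure ?A {t<..} < \<infinity>" for t using A1[of t] A2[of t] by (cases "t < 1") auto
    show "emeasure ?A {t<..} = emeasure ?B {t<..}" for t using A1[of t] A2[of t] B1[of t] B2[of t] by (cases "t < 1") auto
  qed auto
  then have "(\<integral>\<^sup>+s. H s \<partial>?A) = (\<integral>\<^sup>+s. H s \<partial>?B)" by simp
  moreover have "(\<integral>\<^sup>+s. H s \<partial>?A) = (\<integral>\<^sup>+s. ?w s * H s \<partial>lborel)"
    by (rule nn_integral_density) auto
  moreover have "(\<integral>\<^sup>+s. H s \<partial>?B) = ennreal (real m) * (\<integral>\<^sup>+u. H (1 - u ^ m) \<partial>unif01)"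
    by (simp add: nn_integral_scale_measure nn_integral_distr)
  ultimately show ?thesis by simp
qed

text \<open>What is left of the radial density times the beta weight when
  \<open>1 - s\<^sup>2\<close> is split into \<open>1 - s\<close> and \<open>1 + s\<close> and the
  power of \<open>1 - s\<close> is absorbed into the law of the radius.\<close>

definition radial_weight :: "nat \<Rightarrow> nat \<Rightarrow> real \<Rightarrow> ennreal"
  where "radial_weight d m s = ennreal (real d * s ^ (d - 1) * (1 + s) powr (1 / real m - 1))"

lemma radial_weight_measurable [measurable]: "radial_weight d m \<in> borel_measurable borel"
  unfolding radial_weight_def by measurable

text \<open>For uniform \<open>u\<close> the substitution \<open>s = 1 - u ^ m\<close> of the radius absorbs the singular factor
  \<open>(1 - s) powr (1/m - 1)\<close>, so that the remaining weight stays bounded as \<open>m \<longlongrightarrow> \<infinity>\<close>.\<close>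

definition thicken :: "nat \<Rightarrow> nat \<Rightarrow> real \<times> (nat \<Rightarrow> real) \<Rightarrow> nat \<Rightarrow> real"
  where "thicken d m p = (\<lambda>i\<in>{..<d}. (1 - fst p ^ m) * snd p i)"

abbreviation radius_direction :: "nat \<Rightarrow> (real \<times> (nat \<Rightarrow> real)) measure"
  where "radius_direction d \<equiv> unif01 \<Otimes>\<^sub>M uniform_sphere d"

lemma scale_vector_measurable:
  fixes d :: nat
  shows
  "(\<lambda>p. \<lambda>i\<in>{..<d}. fst p * snd p i :: real) \<in> measurable (borel \<Otimes>\<^sub>M PiM {..<d} (\<lambda>_. borel)) (leb {..<d})"
proof (rule measurable_restrict)
  fix i assume i: "i \<in> {..<d}"
  have "(\<lambda>p. snd p i) \<in> borel_measurable (borel \<Otimes>\<^sub>M PiM {..<d} (\<lambda>_. borel) :: (real \<times> (nat \<Rightarrow> real)) measure)"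
    using i by measurable
  from borel_measurable_times[OF measurable_fst this]
  show "(\<lambda>p. fst p * snd p i :: real) \<in> measurable (borel \<Otimes>\<^sub>M PiM {..<d} (\<lambda>_. borel)) lborel"
    by simp
qed

lemma sets_radius_direction: "sets (radius_direction d) = sets (borel \<Otimes>\<^sub>M PiM {..<d} (\<lambda>_. borel))"
  by (rule sets_pair_measure_cong) simp_all

lemma thicken_measurable: "thicken d m \<in> measurable (radius_direction d) (leb {..<d})"
proof -
  have "(\<lambda>p. (1 - fst p ^ m, snd p)) \<in> measurable (borel \<Otimes>\<^sub>M PiM {..<d} (\<lambda>_. borel))
     (borel \<Otimes>\<^sub>M PiM {..<d} (\<lambda>_. borel) :: (real \<times> (nat \<Rightarrow> real)) measure)"
    by measurable
  from measurable_compose[OF this scale_vector_measurable]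
  show ?thesis
    unfolding thicken_def[abs_def] measurable_cong_sets[OF sets_radius_direction refl] by simp
qed

lemma vector_eq_scaled_direction:
  assumes "x \<in> space (leb {..<d})"
  shows "(\<lambda>i\<in>{..<d}. enorm d x * radial_projection d x i) = x"
proof
  fix i
  show "(\<lambda>i\<in>{..<d}. enorm d x * radial_projection d x i) i = x i"
  proof (cases "i < d")
    case True
    show ?thesis
    proof (cases "enorm d x = 0")
      case z: True
      then have "(\<Sum>i<d. (x i)\<^sup>2) = 0" by (simp add: enorm_def)
      then have "x i = 0" using True by (subst (asm) sum_nonneg_eq_0_iff) auto
      then show ?thesis using z True by simp
    qed (use True in \<open>simp add: radial_projection_def\<close>)
  next
    case False
    then show ?thesis using assms by (auto simp: space_PiM PiE_iff extensional_def)
  qed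
qed

text \<open>Polar coordinates write the point as radius times direction, and
  \<open>beta_integral_substitution\<close> replaces the radius by \<open>1 - u ^ m\<close>. The
  gain is an integral over the probability space \<open>radius_direction d\<close>, which is the
  same for every \<open>m\<close>, so that a limit in \<open>m\<close> becomes a limit of
  integrands.\<close>

lemma beta_point:
  assumes "d > 0" "m > 0" and G [measurable]: "G \<in> borel_measurable (leb {..<d})"
  shows "(\<integral>\<^sup>+x. beta_weight (1 / real m - 1) (sqn d x) * G x \<partial>leb {..<d}) =
    (\<integral>\<^sup>+p. ball_volume d * ennreal (real m) * radial_weight d m (1 - fst p ^ m) * G (thicken d m p) \<partial>radius_direction d)"
proof -
  let ?b = "1 / real m - 1" and ?S = "uniform_sphere d"
  let ?B = "PiM {..<d} (\<lambda>_. borel) :: (nat \<Rightarrow> real) measure"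
  interpret S: prob_space ?S by (rule prob_space_uniform_sphere)
  interpret U: prob_space unif01 by (rule prob_space_unif01)
  define Q where "Q s = (\<integral>\<^sup>+\<theta>. G (\<lambda>i\<in>{..<d}. s * \<theta> i) \<partial>?S)" for s
  have GT: "(\<lambda>p. G (\<lambda>i\<in>{..<d}. fst p * snd p i)) \<in> borel_measurable (borel \<Otimes>\<^sub>M ?B)"
    by (rule measurable_compose[OF scale_vector_measurable G])
  have GT': "(\<lambda>p. G (\<lambda>i\<in>{..<d}. fst p * snd p i)) \<in> borel_measurable (borel \<Otimes>\<^sub>M ?S)"
    using GT by (subst measurable_cong_sets[OF sets_pair_measure_cong[OF refl sets_uniform_sphere] refl])
  have Q [measurable]: "Q \<in> borel_measurable borel"
    unfolding Q_def using S.borel_measurable_nn_integral_fst[OF GT'] by simp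
  have Gs: "(\<lambda>\<theta>. G (\<lambda>i\<in>{..<d}. s * \<theta> i)) \<in> borel_measurable ?S" for s
    using measurable_compose[OF measurable_Pair1'[of s borel ?S] GT'] by simp
  have "(\<integral>\<^sup>+x. beta_weight ?b (sqn d x) * G x \<partial>leb {..<d}) =
      (\<integral>\<^sup>+x. (case (enorm d x, radial_projection d x) of (s, \<theta>) \<Rightarrow> beta_weight ?b (s\<^sup>2) * G (\<lambda>i\<in>{..<d}. s * \<theta> i)) \<partial>leb {..<d})"
  proof (rule nn_integral_cong)
    fix x assume "x \<in> space (leb {..<d})"
    then show "beta_weight ?b (sqn d x) * G x =
        (case (enorm d x, radial_projection d x) of (s, \<theta>) \<Rightarrow> beta_weight ?b (s\<^sup>2) * G (\<lambda>i\<in>{..<d}. s * \<theta> i))"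
      unfolding prod.case by (subst vector_eq_scaled_direction) (simp_all add: enorm_eq)
  qed
  also have "\<dots> = ball_volume d * (\<integral>\<^sup>+s. radial_density d s *
      (\<integral>\<^sup>+\<theta>. (case (s, \<theta>) of (s, \<theta>) \<Rightarrow> beta_weight ?b (s\<^sup>2) * G (\<lambda>i\<in>{..<d}. s * \<theta> i)) \<partial>?S) \<partial>lborel)"
  proof (rule polar_coordinates[OF \<open>d > 0\<close>])
    show "(\<lambda>(s, \<theta>). beta_weight ?b (s\<^sup>2) * G (\<lambda>i\<in>{..<d}. s * \<theta> i)) \<in> borel_measurable (borel \<Otimes>\<^sub>M ?B)"
      unfolding case_prod_beta' by (rule borel_measurable_times_ennreal[OF _ GT]) measurable
  qed
  also have "(\<integral>\<^sup>+s. radial_density d s *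
      (\<integral>\<^sup>+\<theta>. (case (s, \<theta>) of (s, \<theta>) \<Rightarrow> beta_weight ?b (s\<^sup>2) * G (\<lambda>i\<in>{..<d}. s * \<theta> i)) \<partial>?S) \<partial>lborel) =
      (\<integral>\<^sup>+s. ennreal ((1 - s) powr ?b) * indicator {0<..<1} s * (radial_weight d m s * Q s) \<partial>lborel)"
  proof (rule nn_integral_cong_AE)
    have "AE s in lborel. (s::real) \<notin> {0}" by (rule AE_not_in) (simp add: null_sets_def)
    then show "AE s in lborel. radial_density d s *
      (\<integral>\<^sup>+\<theta>. (case (s, \<theta>) of (s, \<theta>) \<Rightarrow> beta_weight ?b (s\<^sup>2) * G (\<lambda>i\<in>{..<d}. s * \<theta> i)) \<partial>?S) =
       ennreal ((1 - s) powr ?b) * indicator {0<..<1} s * (radial_weight d m s * Q s)"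
    proof eventually_elim
      case (elim s)
      have 1: "(\<integral>\<^sup>+\<theta>. (case (s, \<theta>) of (s, \<theta>) \<Rightarrow> beta_weight ?b (s\<^sup>2) * G (\<lambda>i\<in>{..<d}. s * \<theta> i)) \<partial>?S) = beta_weight ?b (s\<^sup>2) * Q s"
        unfolding Q_def using nn_integral_cmult[OF Gs] by simp
      consider "s < 0" | "0 < s" "s < 1" | "s \<ge> 1" using elim by fastforce
      then have "radial_density d s * beta_weight ?b (s\<^sup>2) = ennreal ((1 - s) powr ?b) * indicator {0<..<1} s * radial_weight d m s"
      proof cases
        case 2
        have "1 - s\<^sup>2 = (1 - s) * (1 + s)" by (simp add: power2_eq_square algebra_simps)
        then have "(1 - s\<^sup>2) powr ?b = (1 - s) powr ?b * (1 + s) powr ?b" using 2 by (simp add: powr_mult)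
        moreover have "s\<^sup>2 < 1" using 2 by (simp add: power_less_one_iff)
        ultimately show ?thesis using 2
          by (simp add: radial_density_def beta_weight_def radial_weight_def ennreal_mult[symmetric] mult_ac)
      next
        case 3
        then have "\<not> s\<^sup>2 < 1" by (simp add: not_less one_le_power)
        then show ?thesis using 3 by (simp add: beta_weight_def)
      qed (simp add: radial_density_def)
      then show ?case unfolding 1 by (simp add: mult.assoc[symmetric])
    qed
  qed
  also have "\<dots> = ennreal (real m) * (\<integral>\<^sup>+u. radial_weight d m (1 - u ^ m) * Q (1 - u ^ m) \<partial>unif01)"
    by (rule beta_integral_substitution[OF \<open>m > 0\<close>]) measurable
  finally have 2: "(\<integral>\<^sup>+x. beta_weight ?b (sqn d x) * G x \<partial>leb {..<d}) =
      ball_volume d * (ennreal (real m) * (\<integral>\<^sup>+u. radial_weight d m (1 - u ^ m) * Q (1 - u ^ m) \<partial>unif01))" .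
  have GTm: "(\<lambda>p. G (thicken d m p)) \<in> borel_measurable (radius_direction d)"
    by (rule measurable_compose[OF thicken_measurable G])
  have wm: "(\<lambda>p. radial_weight d m (1 - fst p ^ m)) \<in> borel_measurable (radius_direction d)"
    by measurable
  have "(\<integral>\<^sup>+p. ball_volume d * ennreal (real m) * radial_weight d m (1 - fst p ^ m) * G (thicken d m p) \<partial>radius_direction d) =
     ball_volume d * ennreal (real m) * (\<integral>\<^sup>+p. radial_weight d m (1 - fst p ^ m) * G (thicken d m p) \<partial>radius_direction d)"
    unfolding mult.assoc by (subst nn_integral_cmult[symmetric]) (use GTm wm in \<open>auto simp: mult.assoc nn_integral_cmult\<close>)
  also have "(\<integral>\<^sup>+p. radial_weight d m (1 - fst p ^ m) * G (thicken d m p) \<partial>radius_direction d) =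
      (\<integral>\<^sup>+u. \<integral>\<^sup>+\<theta>. radial_weight d m (1 - u ^ m) * G (thicken d m (u, \<theta>)) \<partial>?S \<partial>unif01)"
    using GTm wm by (subst S.nn_integral_fst[symmetric]) auto
  also have "\<dots> = (\<integral>\<^sup>+u. radial_weight d m (1 - u ^ m) * Q (1 - u ^ m) \<partial>unif01)"
    unfolding Q_def thicken_def by (intro nn_integral_cong) (simp add: nn_integral_cmult[OF Gs])
  finally show ?thesis unfolding 2 by (simp add: mult.assoc)
qed

section \<open>The distance of a random hyperplane to the origin\<close>

lemma AE_distr_PiM:
  assumes "finite I" "sigma_finite_measure N" "T \<in> measurable N N'" "sigma_finite_measure (distr N N' T)"
    and "AE x in PiM I (\<lambda>_. N). P (\<lambda>i\<in>I. T (x i))" and [measurable]: "{x \<in> space (PiM I (\<lambda>_. N')). P x} \<in> sets (PiM I (\<lambda>_. N'))"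
  shows "AE x in PiM I (\<lambda>_. distr N N' T). P x"
proof -
  have m: "(\<lambda>x. \<lambda>i\<in>I. T (x i)) \<in> measurable (PiM I (\<lambda>_. N)) (PiM I (\<lambda>_. N'))"
    by (intro measurable_restrict measurable_compose[OF _ assms(3)] measurable_component_singleton)
  show ?thesis
    unfolding distr_PiM_map[OF assms(1-4)] by (subst AE_distr_iff[OF m]) (use assms(5) in auto)
qed

lemma uniform_sphere_alt: "uniform_sphere d = distr (uniform_measure (leb {..<d}) (unit_ball d))
   (PiM {..<d} (\<lambda>_. borel)) (radial_projection d)"
  by (simp add: uniform_sphere_def lebesgue_measure_def)

abbreviation sphere_points :: "'i set \<Rightarrow> nat \<Rightarrow> ('i \<Rightarrow> nat \<Rightarrow> real) measure"
  where "sphere_points I d \<equiv> PiM I (\<lambda>_. uniform_sphere d)"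

lemma sets_sphere_points: "sets (sphere_points I d) = sets (PiM I (\<lambda>_. leb {..<d}))"
  by (rule sets_PiM_cong) (simp_all add: sets_leb)

lemma measurable_sphere_points: "measurable (sphere_points I d) N = measurable (PiM I (\<lambda>_. leb {..<d})) N"
  by (rule measurable_cong_sets[OF sets_sphere_points refl])

lemma rdet_measurable_points:
  "rdet d \<in> borel_measurable (PiM {..<d} (\<lambda>_. leb {..<d}))"
  by (rule rdet_measurable) (auto intro: entry_measurable)

text \<open>Uniform points of the ball have a joint density, so statements valid Lebesgue-almost
  everywhere carry over to them. Projection to the sphere divides nonzero rows by their norms, which
  leaves the kernel trivial.\<close>

lemma AE_sphere_points_nonsingular: "AE x in sphere_points {..<d} d. rdet d x \<noteq> 0"
  unfolding uniform_sphere_alt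
proof (rule AE_distr_PiM)
  let ?L = "leb {..<d} :: (nat \<Rightarrow> real) measure"
  let ?w = "\<lambda>x. indicator (unit_ball d) x / emeasure ?L (unit_ball d) :: ennreal"
  have um: "uniform_measure ?L (unit_ball d) = density ?L ?w"
    by (simp add: uniform_measure_def)
  have pU: "prob_space (uniform_measure ?L (unit_ball d))"
    using ball_volume_pos[of d] ball_volume_finite[of d]
    by (intro prob_space_uniform_measure) (auto simp: ball_volume_def)
  then interpret U: prob_space "uniform_measure ?L (unit_ball d)" .
  show "sigma_finite_measure (uniform_measure ?L (unit_ball d))"
    by (rule U.sigma_finite_measure_axioms)
  show pm: "radial_projection d \<in> measurable (uniform_measure ?L (unit_ball d)) (PiM {..<d} (\<lambda>_. borel))"
    by simp
  interpret S: prob_space "distr (uniform_measure ?L (unit_ball d)) (PiM {..<d} (\<lambda>_. borel)) (radial_projection d)"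
    by (rule U.prob_space_distr[OF pm])
  show "sigma_finite_measure (distr (uniform_measure ?L (unit_ball d)) (PiM {..<d} (\<lambda>_. borel)) (radial_projection d))"
    by (rule S.sigma_finite_measure_axioms)
  have sp: "sets (PiM {..<d} (\<lambda>_. PiM {..<d} (\<lambda>_. borel :: real measure))) = sets (PiM {..<d} (\<lambda>_. ?L))"
    by (rule sets_PiM_cong) (simp_all add: sets_leb)
  show "{x \<in> space (PiM {..<d} (\<lambda>_. PiM {..<d} (\<lambda>_. borel))). rdet d x \<noteq> 0}
      \<in> sets (PiM {..<d} (\<lambda>_. PiM {..<d} (\<lambda>_. borel)))"
    unfolding sp sets_eq_imp_space_eq[OF sp] using rdet_measurable_points[of d] by measurable
  have *: "rdet d (\<lambda>i\<in>{..<d}. radial_projection d (x i)) \<noteq> 0" if "rdet d x \<noteq> 0" for x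
  proof (rule rdet_nonzeroI)
    fix w assume w: "\<And>i. i < d \<Longrightarrow> dotp d ((\<lambda>i\<in>{..<d}. radial_projection d (x i)) i) w = 0"
    have "dotp d (x i) w = 0" if "i < d" for i
    proof (cases "enorm d (x i) = 0")
      case True
      then have "(\<Sum>j<d. (x i j)\<^sup>2) = 0" by (simp add: enorm_def)
      then have "x i j = 0" if "j < d" for j using that by (subst (asm) sum_nonneg_eq_0_iff) auto
      then show ?thesis by (simp add: dotp_def)
    next
      case False
      have "dotp d (radial_projection d (x i)) w = dotp d (x i) w / enorm d (x i)"
        by (simp add: dotp_def radial_projection_def sum_divide_distrib)
      with w[OF that] that False show ?thesis by simp
    qed
    then show "\<forall>j<d. w j = 0" using kernel_trivial[OF \<open>rdet d x \<noteq> 0\<close>] by blast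
  qed
  have D: "PiM {..<d} (\<lambda>_. uniform_measure ?L (unit_ball d)) = density (PiM {..<d} (\<lambda>_. ?L)) (\<lambda>x. \<Prod>i<d. ?w (x i))"
    unfolding um by (rule density_PiM) (auto intro: sigma_finite_leb U.sigma_finite_measure_axioms[unfolded um])
  have wm: "(\<lambda>x. \<Prod>i<d. ?w (x i)) \<in> borel_measurable (PiM {..<d} (\<lambda>_. ?L))"
    by measurable
  show "AE x in PiM {..<d} (\<lambda>_. uniform_measure ?L (unit_ball d)). rdet d (\<lambda>i\<in>{..<d}. radial_projection d (x i)) \<noteq> 0"
    unfolding D AE_density[OF wm] using AE_rdet_nonzero[of d] by (rule AE_mp) (use * in auto)
qed simp

text \<open>For indicator functions \<open>beta_point\<close> is an equality of measures for a
  single point. Such an equality passes to \<open>d\<close>-fold products, where densities multiply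
  and images are taken coordinatewise.\<close>

lemma radius_direction_product:
  assumes "d > 0" "m > 0" and G [measurable]: "G \<in> borel_measurable (PiM {..<d} (\<lambda>_. leb {..<d}))"
  shows "(\<integral>\<^sup>+x. (\<Prod>i<d. beta_weight (1 / real m - 1) (sqn d (x i))) * G x \<partial>PiM {..<d} (\<lambda>_. leb {..<d})) =
    (ball_volume d * ennreal (real m)) ^ d *
    (\<integral>\<^sup>+p. (\<Prod>i<d. radial_weight d m (1 - fst (p i) ^ m)) * G (\<lambda>i\<in>{..<d}. thicken d m (p i))
       \<partial>PiM {..<d} (\<lambda>_. radius_direction d))"
proof -
  let ?L = "leb {..<d} :: (nat \<Rightarrow> real) measure" and ?P = "radius_direction d"
  let ?w = "\<lambda>x. beta_weight (1 / real m - 1) (sqn d x)"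
  let ?v = "\<lambda>p. ball_volume d * ennreal (real m) * radial_weight d m (1 - fst p ^ m)"
  interpret S: prob_space "uniform_sphere d" by (rule prob_space_uniform_sphere)
  interpret U: prob_space unif01 by (rule prob_space_unif01)
  interpret US: pair_prob_space unif01 "uniform_sphere d" by standard
  have wm [measurable]: "?w \<in> borel_measurable ?L"
    by (intro measurable_compose[OF _ beta_weight_measurable] sqn_measurable) simp
  have vm [measurable]: "?v \<in> borel_measurable ?P" by measurable
  have Tm [measurable]: "thicken d m \<in> measurable ?P ?L" by (rule thicken_measurable)
  have Tm' [measurable]: "thicken d m \<in> measurable (density ?P ?v) ?L" by simp
  have eq: "density ?L ?w = distr (density ?P ?v) ?L (thicken d m)"
  proof (rule measure_eqI)
    fix A assume "A \<in> sets (density ?L ?w)"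
    then have A [measurable]: "A \<in> sets ?L" by simp
    have "emeasure (density ?L ?w) A = (\<integral>\<^sup>+x. ?w x * indicator A x \<partial>?L)"
      by (rule emeasure_density) measurable
    also have "\<dots> = (\<integral>\<^sup>+p. ?v p * indicator A (thicken d m p) \<partial>?P)"
      by (rule beta_point) (use assms in auto)
    also have "\<dots> = (\<integral>\<^sup>+p. ?v p * indicator (thicken d m -` A \<inter> space ?P) p \<partial>?P)"
      by (rule nn_integral_cong) (simp add: indicator_def)
    also have "\<dots> = emeasure (density ?P ?v) (thicken d m -` A \<inter> space ?P)"
      by (rule emeasure_density[symmetric]) measurable
    also have "\<dots> = emeasure (distr (density ?P ?v) ?L (thicken d m)) A"
      by (subst emeasure_distr) auto
    finally show "emeasure (density ?L ?w) A = emeasure (distr (density ?P ?v) ?L (thicken d m)) A" .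
  qed simp
  have L: "sigma_finite_measure ?L" by (rule sigma_finite_leb) simp
  have s1: "sigma_finite_measure (density ?L ?w)"
    unfolding sigma_finite_measure.sigma_finite_iff_density_finite[OF L wm] by (simp add: beta_weight_def)
  have s2: "sigma_finite_measure (density ?P ?v)"
    by (subst US.sigma_finite_iff_density_finite)
       (use ball_volume_finite[of d] in \<open>auto simp: radial_weight_def ennreal_mult_eq_top_iff\<close>)
  have Pm: "(\<lambda>p. \<lambda>i\<in>{..<d}. thicken d m (p i)) \<in> measurable (PiM {..<d} (\<lambda>_. ?P)) (PiM {..<d} (\<lambda>_. ?L))"
    by (intro measurable_restrict measurable_compose[OF _ Tm] measurable_component_singleton)
  have GP [measurable]: "(\<lambda>p. G (\<lambda>i\<in>{..<d}. thicken d m (p i))) \<in> borel_measurable (PiM {..<d} (\<lambda>_. ?P))"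
    by (rule measurable_compose[OF Pm G])
  have Wm [measurable]: "(\<lambda>x. \<Prod>i<d. ?w (x i)) \<in> borel_measurable (PiM {..<d} (\<lambda>_. ?L))"
    by (intro borel_measurable_prod_ennreal measurable_compose[OF _ wm] measurable_component_singleton)
  have Vm [measurable]: "(\<lambda>p. \<Prod>i<d. ?v (p i)) \<in> borel_measurable (PiM {..<d} (\<lambda>_. ?P))"
    by (intro borel_measurable_prod_ennreal measurable_compose[OF _ vm] measurable_component_singleton)
  have Rm [measurable]: "(\<lambda>p. \<Prod>i<d. radial_weight d m (1 - fst (p i) ^ m)) \<in> borel_measurable (PiM {..<d} (\<lambda>_. ?P))"
    by (intro borel_measurable_prod_ennreal measurable_compose[OF measurable_component_singleton]) measurable
  have "(\<integral>\<^sup>+x. (\<Prod>i<d. ?w (x i)) * G x \<partial>PiM {..<d} (\<lambda>_. ?L)) =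
      (\<integral>\<^sup>+x. G x \<partial>density (PiM {..<d} (\<lambda>_. ?L)) (\<lambda>x. \<Prod>i<d. ?w (x i)))"
    by (rule nn_integral_density[symmetric]) measurable
  also have "density (PiM {..<d} (\<lambda>_. ?L)) (\<lambda>x. \<Prod>i<d. ?w (x i)) = PiM {..<d} (\<lambda>_. density ?L ?w)"
    by (rule density_PiM[symmetric]) (use L s1 in auto)
  also have "\<dots> = distr (PiM {..<d} (\<lambda>_. density ?P ?v)) (PiM {..<d} (\<lambda>_. ?L)) (\<lambda>x. \<lambda>i\<in>{..<d}. thicken d m (x i))"
    unfolding eq by (rule distr_PiM_map) (use s1[unfolded eq] s2 in auto)
  also have "PiM {..<d} (\<lambda>_. density ?P ?v) = density (PiM {..<d} (\<lambda>_. ?P)) (\<lambda>p. \<Prod>i<d. ?v (p i))"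
    by (rule density_PiM) (use s2 in \<open>auto intro: US.sigma_finite_measure_axioms\<close>)
  also have "(\<integral>\<^sup>+x. G x \<partial>distr (density (PiM {..<d} (\<lambda>_. ?P)) (\<lambda>p. \<Prod>i<d. ?v (p i))) (PiM {..<d} (\<lambda>_. ?L)) (\<lambda>x. \<lambda>i\<in>{..<d}. thicken d m (x i))) =
      (\<integral>\<^sup>+p. G (\<lambda>i\<in>{..<d}. thicken d m (p i)) \<partial>density (PiM {..<d} (\<lambda>_. ?P)) (\<lambda>p. \<Prod>i<d. ?v (p i)))"
    by (rule nn_integral_distr) (use Pm in auto)
  also have "\<dots> = (\<integral>\<^sup>+p. (\<Prod>i<d. ?v (p i)) * G (\<lambda>i\<in>{..<d}. thicken d m (p i)) \<partial>PiM {..<d} (\<lambda>_. ?P))"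
    by (rule nn_integral_density) measurable
  also have "\<dots> = (\<integral>\<^sup>+p. (ball_volume d * ennreal (real m)) ^ d *
      ((\<Prod>i<d. radial_weight d m (1 - fst (p i) ^ m)) * G (\<lambda>i\<in>{..<d}. thicken d m (p i))) \<partial>PiM {..<d} (\<lambda>_. ?P))"
    by (simp add: prod.distrib mult.assoc power_mult_distrib)
  also have "\<dots> = (ball_volume d * ennreal (real m)) ^ d *
    (\<integral>\<^sup>+p. (\<Prod>i<d. radial_weight d m (1 - fst (p i) ^ m)) * G (\<lambda>i\<in>{..<d}. thicken d m (p i)) \<partial>PiM {..<d} (\<lambda>_. ?P))"
    by (rule nn_integral_cmult) measurable
  finally show ?thesis .
qed

text \<open>For the scaled points the equations say that \<open>v\<close> has product
  \<open>1 / s n i\<close> with \<open>x i\<close>. So \<open>v\<close> is a fixed matrix, the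
  inverse of \<open>x\<close>, applied to the vector of the \<open>1 / s n i\<close>, and depends
  continuously on the scales.\<close>

lemma plane_dist_thicken_tendsto:
  fixes x :: "nat \<Rightarrow> nat \<Rightarrow> real" and s :: "nat \<Rightarrow> nat \<Rightarrow> real"
  assumes "d > 0" and x: "rdet d x \<noteq> 0"
    and s: "\<And>i. i < d \<Longrightarrow> (\<lambda>n. s n i) \<longlonglongrightarrow> 1" "\<And>n i. i < d \<Longrightarrow> s n i > 0"
  shows "(\<lambda>n. plane_dist d (\<lambda>i\<in>{..<d}. \<lambda>j\<in>{..<d}. s n i * x i j)) \<longlonglongrightarrow> plane_dist d x"
proof -
  let ?B = "\<lambda>i j. rcof d x j i / rdet d x"
  have B: "is_inv d x ?B" by (rule is_inv_adjugate[OF x])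
  define v where "v r j = (\<Sum>i<d. ?B j i / r i)" for r :: "nat \<Rightarrow> real" and j
  have dv: "dotp d (x i) (v r) = 1 / r i" if "i < d" for i r
  proof -
    have "dotp d (x i) (v r) = dotp d (x i) (mv d ?B (\<lambda>k. 1 / r k))"
      by (rule dotp_cong) (auto simp: mv_def dotp_def v_def)
    then show ?thesis using mv_inverse[OF B that] by simp
  qed
  have H: "plane_dist d (\<lambda>i\<in>{..<d}. \<lambda>j\<in>{..<d}. r i * x i j) = 1 / sqrt (sqn d (v r))"
    if r: "\<And>i. i < d \<Longrightarrow> r i > 0" for r
  proof (rule plane_dist_eq)
    have dr: "dotp d ((\<lambda>i\<in>{..<d}. \<lambda>j\<in>{..<d}. r i * x i j) i) w = r i * dotp d (x i) w" if "i < d" for i w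
      using that by (simp add: dotp_def sum_distrib_left mult.assoc)
    show "rdet d (\<lambda>i\<in>{..<d}. \<lambda>j\<in>{..<d}. r i * x i j) \<noteq> 0"
    proof (rule rdet_nonzeroI)
      fix w assume w: "\<And>i. i < d \<Longrightarrow> dotp d ((\<lambda>i\<in>{..<d}. \<lambda>j\<in>{..<d}. r i * x i j) i) w = 0"
      have "dotp d (x i) w = 0" if "i < d" for i
        using w[OF that] r[OF that] unfolding dr[OF that] by simp
      then show "\<forall>j<d. w j = 0" using kernel_trivial[OF x] by blast
    qed
    show "dotp d ((\<lambda>i\<in>{..<d}. \<lambda>j\<in>{..<d}. r i * x i j) i) (v r) = 1" if "i < d" for i
      unfolding dr[OF that] dv[OF that] using r[OF that] by simp
  qed
  have H1: "plane_dist d x = 1 / sqrt (sqn d (v (\<lambda>_. 1)))"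
    by (rule plane_dist_eq[OF x]) (simp add: dv)
  have "sqn d (v (\<lambda>_. 1)) \<noteq> 0"
  proof
    assume "sqn d (v (\<lambda>_. 1)) = 0"
    then have "v (\<lambda>_. 1) j = 0" if "j < d" for j
      using that unfolding sqn_def by (subst (asm) sum_nonneg_eq_0_iff) auto
    then have "dotp d (x 0) (v (\<lambda>_. 1)) = 0" by (simp add: dotp_def)
    then show False using dv[OF \<open>d > 0\<close>, of "\<lambda>_. 1"] by simp
  qed
  moreover have "(\<lambda>n. sqn d (v (s n))) \<longlonglongrightarrow> sqn d (v (\<lambda>_. 1))"
  proof -
    have "(\<lambda>n. v (s n) j) \<longlonglongrightarrow> v (\<lambda>_. 1) j" for j
      unfolding v_def by (intro tendsto_sum tendsto_divide tendsto_const s(1)) auto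
    then show ?thesis unfolding sqn_def by (intro tendsto_sum tendsto_power)
  qed
  ultimately have "(\<lambda>n. 1 / sqrt (sqn d (v (s n)))) \<longlonglongrightarrow> 1 / sqrt (sqn d (v (\<lambda>_. 1)))"
    by (intro tendsto_intros) auto
  then show ?thesis unfolding H1 using H s(2) by simp
qed

lemma beta_weight_integral_finite:
  assumes "N \<ge> 0"
  shows "(\<integral>\<^sup>+\<eta>. beta_weight N (\<eta>\<^sup>2) \<partial>lborel) \<le> 2"
proof -
  have "beta_weight N (\<eta>\<^sup>2) \<le> indicator {-1..1} \<eta>" for \<eta> :: real
  proof (cases "\<eta>\<^sup>2 < 1")
    case True
    then have "\<bar>\<eta>\<bar> \<le> 1" by (simp add: abs_square_le_1[symmetric])
    moreover have "(1 - \<eta>\<^sup>2) powr N \<le> 1" using True assms by (intro powr_le1) auto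
    ultimately show ?thesis using True by (simp add: beta_weight_def abs_le_iff indicator_def)
  qed (simp add: beta_weight_def)
  then have "(\<integral>\<^sup>+\<eta>. beta_weight N (\<eta>\<^sup>2) \<partial>lborel) \<le> (\<integral>\<^sup>+\<eta>. indicator {-1..1::real} \<eta> \<partial>lborel)"
    by (intro nn_integral_mono)
  then show ?thesis by simp
qed

lemma ennreal_cancel_left:
  fixes a b c :: ennreal
  assumes "c * a = c * b" "c \<noteq> 0" "c \<noteq> \<infinity>" shows "a = b"
  using assms by (simp add: ennreal_mult_cancel_left)

text \<open>The limit \<open>m \<longlongrightarrow> \<infinity>\<close> of the corresponding law for the densities \<open>(1 - |x|\<^sup>2) powr (1/m - 1)\<close>, which
  concentrate on the sphere. The factor \<open>\<integral> beta_weight N (\<eta>\<^sup>2)\<close> on the left normalises the density.\<close>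

theorem plane_dist_law:
  fixes e :: nat and \<psi> :: "real \<Rightarrow> real"
  defines "d \<equiv> Suc e" and "N \<equiv> real ((e + 2) * e) / 2 - real (Suc e)"
  assumes "e \<ge> 2" and cont: "continuous_on UNIV \<psi>" and bnd: "\<And>r. 0 \<le> \<psi> r" "\<And>r. \<psi> r \<le> 1"
  shows "(\<integral>\<^sup>+x. ennreal (\<psi> (plane_dist d x)) \<partial>sphere_points {..<d} d) * (\<integral>\<^sup>+\<eta>. beta_weight N (\<eta>\<^sup>2) \<partial>lborel) =
    (\<integral>\<^sup>+\<eta>. ennreal (\<psi> \<bar>\<eta>\<bar>) * beta_weight N (\<eta>\<^sup>2) \<partial>lborel)"
proof -
  let ?P = "PiM {..<d} (\<lambda>_. radius_direction d)"
  have "d > 0" by (simp add: d_def)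
  \<comment> \<open>Here \<open>e \<ge> 2\<close> enters: for \<open>e = 1\<close> the exponent is
    \<open>-1 / 2\<close> and the weight is unbounded.\<close>
  have "N \<ge> 0"
  proof -
    have "2 * real (Suc e) \<le> real ((e + 2) * e)"
    proof -
      have "2 * Suc e \<le> 4 * e" using \<open>e \<ge> 2\<close> by simp
      also have "\<dots> \<le> (e + 2) * e" using \<open>e \<ge> 2\<close> by (intro mult_right_mono) auto
      finally show ?thesis by (metis of_nat_le_iff of_nat_mult of_nat_numeral)
    qed
    then show ?thesis unfolding N_def by simp
  qed
  interpret S: prob_space "uniform_sphere d" by (rule prob_space_uniform_sphere)
  interpret U: prob_space unif01 by (rule prob_space_unif01)
  interpret US: pair_prob_space unif01 "uniform_sphere d" by standard
  interpret P: product_prob_space "\<lambda>_::nat. radius_direction d" by standard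
  interpret P': prob_space ?P by (rule prob_space_PiM) (rule US.prob_space_axioms)
  \<comment> \<open>The exponent that \<open>plane_dist_law_beta\<close> gives for
    \<open>\<beta> = 1 / real (Suc n) - 1\<close>.\<close>
  define Nm where "Nm n = N + real d / real (Suc n)" for n
  define B where "B n \<phi> = (\<integral>\<^sup>+p. (\<Prod>i<d. radial_weight d (Suc n) (1 - fst (p i) ^ Suc n)) *
     ennreal (\<phi> (plane_dist d (\<lambda>i\<in>{..<d}. thicken d (Suc n) (p i)))) \<partial>?P)" for n and \<phi> :: "real \<Rightarrow> real"
  define J where "J N' \<phi> = (\<integral>\<^sup>+\<eta>. ennreal (\<phi> \<bar>\<eta>\<bar>) * beta_weight N' (\<eta>\<^sup>2) \<partial>lborel)" for N' and \<phi> :: "real \<Rightarrow> real"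
  have meas [measurable]: "\<psi> \<in> borel_measurable borel" using cont by (rule borel_measurable_continuous_onI)
  have hm: "(\<lambda>p. plane_dist d (\<lambda>i\<in>{..<d}. thicken d n (p i))) \<in> borel_measurable ?P" for n
    by (rule measurable_compose[OF _ plane_dist_measurable], rule measurable_restrict,
        rule measurable_compose[OF _ thicken_measurable], rule measurable_component_singleton)
  have rm: "(\<lambda>p. \<Prod>i<d. radial_weight d n (1 - fst (p i) ^ n)) \<in> borel_measurable ?P" for n
    by (intro borel_measurable_prod_ennreal measurable_compose[OF measurable_component_singleton]) measurable

  \<comment> \<open>The formulas for \<open>\<psi>\<close> and for the constant 1 are multiplied
    crosswise, which eliminates \<open>K\<close> without any claim about its finiteness.\<close>
  have ratio: "B n \<psi> * J (Nm n) (\<lambda>_. 1) = B n (\<lambda>_. 1) * J (Nm n) \<psi>" for n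
  proof -
    obtain K where K: "\<forall>\<phi> \<in> borel_measurable borel.
      (\<integral>\<^sup>+x. (\<Prod>i<d. beta_weight (1 / real (Suc n) - 1) (sqn d (x i))) * \<phi> (plane_dist d x) \<partial>PiM {..<d} (\<lambda>_. leb {..<d})) =
      K * (\<integral>\<^sup>+\<eta>. \<phi> \<bar>\<eta>\<bar> * beta_weight (real d * (1 / real (Suc n) - 1) + real ((e + 2) * e) / 2) (\<eta>\<^sup>2) \<partial>lborel)"
      using plane_dist_law_beta[of e "1 / real (Suc n) - 1"] unfolding d_def[symmetric] by (rule exE)
    have Nn: "real d * (1 / real (Suc n) - 1) + real ((e + 2) * e) / 2 = Nm n"
      unfolding Nm_def N_def d_def by (simp add: field_simps)
    let ?c = "(ball_volume d * ennreal (real (Suc n))) ^ d"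
    have c: "?c \<noteq> 0" "?c \<noteq> \<infinity>"
    proof -
      have "ennreal (real (Suc n)) > 0" by (subst ennreal_less_zero_iff) simp
      moreover have "ball_volume d \<noteq> 0" using ball_volume_pos[of d] by auto
      ultimately show "?c \<noteq> 0" by simp
      show "?c \<noteq> \<infinity>" using ball_volume_finite[of d]
        by (simp add: less_top power_less_top_ennreal ennreal_mult_less_top)
    qed
    have *: "?c * B n \<phi> = K * J (Nm n) \<phi>" if [measurable]: "\<phi> \<in> borel_measurable borel" for \<phi>
    proof -
      have "(\<lambda>x. ennreal (\<phi> (plane_dist d x))) \<in> borel_measurable (PiM {..<d} (\<lambda>_. leb {..<d}))"
        using plane_dist_measurable[of d] by measurable
      from radius_direction_product[OF \<open>d > 0\<close> _ this, of "Suc n"]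
      show ?thesis
        unfolding B_def J_def using bspec[OF K, of "\<lambda>r. ennreal (\<phi> r)"] Nn by simp
    qed
    have "?c * (B n \<psi> * J (Nm n) (\<lambda>_. 1)) = K * J (Nm n) \<psi> * J (Nm n) (\<lambda>_. 1)"
      by (simp only: mult.assoc[symmetric] *[OF meas])
    also have "\<dots> = K * J (Nm n) (\<lambda>_. 1) * J (Nm n) \<psi>" by (simp only: mult_ac)
    also have "\<dots> = ?c * (B n (\<lambda>_. 1) * J (Nm n) \<psi>)"
      by (simp only: mult.assoc[symmetric] *[OF borel_measurable_const])
    finally show ?thesis using c by (rule ennreal_cancel_left)
  qed

  have AEu: "AE p in ?P. \<forall>i\<in>{..<d}. 0 < fst (p i) \<and> fst (p i) < 1"
  proof (rule AE_finite_allI)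
    fix i assume "i \<in> {..<d}"
    have "AE q in radius_direction d. 0 < fst q \<and> fst q < 1"
    proof (rule US.AE_pair_measure)
      show "{q \<in> space (radius_direction d). 0 < fst q \<and> fst q < 1} \<in> sets (radius_direction d)"
        by measurable
    qed (use AE_unif01 in auto)
    then show "AE p in ?P. 0 < fst (p i) \<and> fst (p i) < 1"
      by (rule AE_PiM_component[rotated 2]) (use US.prob_space_axioms \<open>i \<in> {..<d}\<close> in auto)
  qed simp
  have snd_distr: "distr (radius_direction d) (uniform_sphere d) snd = uniform_sphere d"
  proof (rule measure_eqI)
    fix A assume "A \<in> sets (distr (radius_direction d) (uniform_sphere d) snd)"
    then have A: "A \<in> sets (uniform_sphere d)" by simp
    have "snd -` A \<inter> space (radius_direction d) = space unif01 \<times> A"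
      using sets.sets_into_space[OF A] by (auto simp: space_pair_measure)
    moreover have "space unif01 = UNIV" by (simp add: unif01_def)
    moreover have "emeasure (radius_direction d) (space unif01 \<times> A) = emeasure (uniform_sphere d) A"
      using A by (subst S.emeasure_pair_measure_Times) (use U.emeasure_space_1 in \<open>auto simp: unif01_def\<close>)
    ultimately show "emeasure (distr (radius_direction d) (uniform_sphere d) snd) A = emeasure (uniform_sphere d) A"
      using A by (subst emeasure_distr[OF measurable_snd]) auto
  qed simp
  have snd_prod: "distr ?P (PiM {..<d} (\<lambda>_. uniform_sphere d)) (\<lambda>p. \<lambda>i\<in>{..<d}. snd (p i)) = sphere_points {..<d} d"
    using distr_PiM_map[of "{..<d}" "radius_direction d" snd "uniform_sphere d"]
    by (simp add: snd_distr US.sigma_finite_measure_axioms S.sigma_finite_measure_axioms)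
  have snd_meas: "(\<lambda>p. \<lambda>i\<in>{..<d}. snd (p i)) \<in> measurable ?P (sphere_points {..<d} d)"
    by (rule measurable_restrict, rule measurable_compose[OF _ measurable_snd], rule measurable_component_singleton)
  have AEx: "AE p in ?P. rdet d (\<lambda>i\<in>{..<d}. snd (p i)) \<noteq> 0"
  proof -
    have rd: "rdet d \<in> borel_measurable (sphere_points {..<d} d)"
      using rdet_measurable_points[of d] by (simp only: measurable_sphere_points)
    have "{x \<in> space (sphere_points {..<d} d). rdet d x \<noteq> 0} \<in> sets (sphere_points {..<d} d)"
      using rd by measurable
    from AE_distr_iff[OF snd_meas this] show ?thesis
      using AE_sphere_points_nonsingular[of d] by (simp only: snd_prod)
  qed

  \<comment> \<open>A bound free of \<open>n\<close>, which provides the dominating constant: the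
    exponent of \<open>1 + s\<close> is at most 0 and its base at least 1.\<close>
  have w_le: "radial_weight d (Suc n) (1 - u ^ Suc n) \<le> ennreal (real d)" if "0 < u" "u < 1" for u n
  proof -
    let ?s = "1 - u ^ Suc n"
    have "0 < u ^ Suc n" "u ^ Suc n < 1" using that by (simp, subst power_less_one_iff, auto)
    then have s: "0 < ?s" "?s < 1" by simp_all
    have "?s ^ (d - 1) \<le> 1" using s by (intro power_le_one) auto
    moreover have "(1 + ?s) powr (1 / real (Suc n) - 1) \<le> (1 + ?s) powr 0"
      using s by (intro powr_mono) auto
    ultimately have "?s ^ (d - 1) * (1 + ?s) powr (1 / real (Suc n) - 1) \<le> 1 * 1"
      using s by (intro mult_mono) auto
    then have "real d * (?s ^ (d - 1) * (1 + ?s) powr (1 / real (Suc n) - 1)) \<le> real d * 1"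
      by (intro mult_left_mono) auto
    then show ?thesis unfolding radial_weight_def by (intro ennreal_leI) (simp add: mult.assoc)
  qed
  have s_lim: "(\<lambda>n. 1 - u ^ Suc n) \<longlonglongrightarrow> 1" if "0 < u" "u < 1" for u :: real
  proof -
    have "(\<lambda>n. u ^ n) \<longlonglongrightarrow> 0" using that by (intro LIMSEQ_power_zero) auto
    from tendsto_diff[OF tendsto_const LIMSEQ_Suc[OF this], of 1] show ?thesis by simp
  qed
  have w_lim: "(\<lambda>n. radial_weight d (Suc n) (1 - u ^ Suc n)) \<longlonglongrightarrow> ennreal (real d / 2)" if "0 < u" "u < 1" for u
  proof -
    have "(\<lambda>n. 1 / real (Suc n)) \<longlonglongrightarrow> 0" by (rule LIMSEQ_Suc[OF lim_1_over_n])
    then have "(\<lambda>n. real d * (1 - u ^ Suc n) ^ (d - 1) * (1 + (1 - u ^ Suc n)) powr (1 / real (Suc n) - 1))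
      \<longlonglongrightarrow> real d * 1 ^ (d - 1) * (1 + 1) powr (0 - 1)"
      by (intro tendsto_intros s_lim that) auto
    then have "(\<lambda>n. real d * (1 - u ^ Suc n) ^ (d - 1) * (1 + (1 - u ^ Suc n)) powr (1 / real (Suc n) - 1))
      \<longlonglongrightarrow> real d / 2" by (simp add: powr_minus_divide)
    then show ?thesis unfolding radial_weight_def by (rule tendsto_ennrealI)
  qed
  \<comment> \<open>Each radial weight tends to \<open>d / 2\<close>, because the radius tends to 1
    and the exponent of \<open>1 + s\<close> to -1. The product of \<open>d\<close> such limits
    appears on both sides and cancels.\<close>
  let ?k = "ennreal (real d / 2) ^ d"
  have Blim: "(\<lambda>n. B n \<phi>) \<longlonglongrightarrow> ?k * (\<integral>\<^sup>+x. ennreal (\<phi> (plane_dist d x)) \<partial>sphere_points {..<d} d)"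
    if phi: "continuous_on UNIV \<phi>" "\<And>r. 0 \<le> \<phi> r" "\<And>r. \<phi> r \<le> 1" for \<phi> :: "real \<Rightarrow> real"
  proof -
    have [measurable]: "\<phi> \<in> borel_measurable borel" using phi(1) by (rule borel_measurable_continuous_onI)
    let ?u = "\<lambda>n p. (\<Prod>i<d. radial_weight d (Suc n) (1 - fst (p i) ^ Suc n)) *
      ennreal (\<phi> (plane_dist d (\<lambda>i\<in>{..<d}. thicken d (Suc n) (p i))))"
    let ?l = "\<lambda>p. ?k * ennreal (\<phi> (plane_dist d (\<lambda>i\<in>{..<d}. snd (p i))))"
    have phm: "(\<lambda>x. ennreal (\<phi> (plane_dist d x))) \<in> borel_measurable (sphere_points {..<d} d)"
      unfolding measurable_sphere_points using plane_dist_measurable[of d] by measurable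
    have lm0: "(\<lambda>p. ennreal (\<phi> (plane_dist d (\<lambda>i\<in>{..<d}. snd (p i))))) \<in> borel_measurable ?P"
      by (rule measurable_compose[OF snd_meas phm])
    have "(\<lambda>n. \<integral>\<^sup>+p. ?u n p \<partial>?P) \<longlonglongrightarrow> (\<integral>\<^sup>+p. ?l p \<partial>?P)"
    proof (rule nn_integral_dominated_convergence[where w = "\<lambda>_. ennreal (real d) ^ d"])
      show "?u n \<in> borel_measurable ?P" for n
      proof (rule borel_measurable_times_ennreal[OF rm])
        show "(\<lambda>p. ennreal (\<phi> (plane_dist d (\<lambda>i\<in>{..<d}. thicken d (Suc n) (p i))))) \<in> borel_measurable ?P"
          by (rule measurable_compose[OF hm]) measurable
      qed
      show "?l \<in> borel_measurable ?P" using lm0 by measurable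
      show "(\<integral>\<^sup>+p. ennreal (real d) ^ d \<partial>?P) < \<infinity>"
        by (simp add: P'.emeasure_space_1 power_less_top_ennreal)
      show "AE p in ?P. ?u n p \<le> ennreal (real d) ^ d" for n
        using AEu
      proof eventually_elim
        case (elim p)
        have a: "(\<Prod>i<d. radial_weight d (Suc n) (1 - fst (p i) ^ Suc n)) \<le> (\<Prod>i<d. ennreal (real d))"
          by (rule prod_mono_ennreal) (use elim w_le in auto)
        have b: "ennreal (\<phi> (plane_dist d (\<lambda>i\<in>{..<d}. thicken d (Suc n) (p i)))) \<le> 1"
          using phi(3) by simp
        show ?case using mult_mono[OF a b] by simp
      qed
      show "AE p in ?P. (\<lambda>n. ?u n p) \<longlonglongrightarrow> ?l p"
        using AEu AEx
      proof eventually_elim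
        case (elim p)
        have u: "0 < fst (p i)" "fst (p i) < 1" if "i < d" for i using elim(1) that by auto
        have s0: "1 - fst (p i) ^ Suc n > 0" if "i < d" for i n
          using u[OF that] power_less_one_iff[of "fst (p i)" "Suc n"] by simp
        have "(\<lambda>n. plane_dist d (\<lambda>i\<in>{..<d}. \<lambda>j\<in>{..<d}. (1 - fst (p i) ^ Suc n) * (\<lambda>i\<in>{..<d}. snd (p i)) i j))
            \<longlonglongrightarrow> plane_dist d (\<lambda>i\<in>{..<d}. snd (p i))"
          by (rule plane_dist_thicken_tendsto[OF \<open>d > 0\<close> elim(2) s_lim[OF u]]) (use s0 in auto)
        moreover have "(\<lambda>i\<in>{..<d}. \<lambda>j\<in>{..<d}. (1 - fst (p i) ^ Suc n) * (\<lambda>i\<in>{..<d}. snd (p i)) i j) =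
            (\<lambda>i\<in>{..<d}. thicken d (Suc n) (p i))" for n
          by (auto simp: thicken_def fun_eq_iff)
        ultimately have "(\<lambda>n. plane_dist d (\<lambda>i\<in>{..<d}. thicken d (Suc n) (p i))) \<longlonglongrightarrow> plane_dist d (\<lambda>i\<in>{..<d}. snd (p i))"
          by simp
        then have 1: "(\<lambda>n. ennreal (\<phi> (plane_dist d (\<lambda>i\<in>{..<d}. thicken d (Suc n) (p i))))) \<longlonglongrightarrow>
            ennreal (\<phi> (plane_dist d (\<lambda>i\<in>{..<d}. snd (p i))))"
          using phi(1) by (intro tendsto_ennrealI) (auto intro: continuous_on_tendsto_compose)
        have 2: "(\<lambda>n. \<Prod>i<d. radial_weight d (Suc n) (1 - fst (p i) ^ Suc n)) \<longlonglongrightarrow> ?k"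
        proof -
          have "(\<lambda>n. \<Prod>i\<in>I. radial_weight d (Suc n) (1 - fst (p i) ^ Suc n)) \<longlonglongrightarrow> (\<Prod>i\<in>I. ennreal (real d / 2))"
            if "finite I" "I \<subseteq> {..<d}" for I
            using that
          proof (induction I)
            case (insert i I)
            then show ?case
              using w_lim[OF u, of i] by (auto intro!: tendsto_mult_ennreal simp: ennreal_power)
          qed simp
          from this[of "{..<d}"] show ?thesis by simp
        qed
        show ?case by (rule tendsto_mult_ennreal[OF 2 1]) (simp add: ennreal_power)
      qed
    qed simp
    also have "(\<integral>\<^sup>+p. ?l p \<partial>?P) = ?k * (\<integral>\<^sup>+x. ennreal (\<phi> (plane_dist d x)) \<partial>sphere_points {..<d} d)"
    proof -
      have "(\<integral>\<^sup>+x. ennreal (\<phi> (plane_dist d x)) \<partial>sphere_points {..<d} d) =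
          (\<integral>\<^sup>+p. ennreal (\<phi> (plane_dist d (\<lambda>i\<in>{..<d}. snd (p i)))) \<partial>?P)"
        using nn_integral_distr[OF snd_meas, of "\<lambda>x. ennreal (\<phi> (plane_dist d x))"] phm
        by (simp only: measurable_distr_eq1 snd_prod)
      then show ?thesis using nn_integral_cmult[OF lm0, of ?k] by (simp only:)
    qed
    finally show ?thesis unfolding B_def .
  qed

  have Jlim: "(\<lambda>n. J (Nm n) \<phi>) \<longlonglongrightarrow> J N \<phi>"
    if phi: "continuous_on UNIV \<phi>" "\<And>r. 0 \<le> \<phi> r" "\<And>r. \<phi> r \<le> 1" for \<phi> :: "real \<Rightarrow> real"
  proof -
    have [measurable]: "\<phi> \<in> borel_measurable borel" using phi(1) by (rule borel_measurable_continuous_onI)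
    show ?thesis
      unfolding J_def
    proof (rule nn_integral_dominated_convergence[where w = "\<lambda>\<eta>. beta_weight N (\<eta>\<^sup>2)"])
      show "(\<integral>\<^sup>+\<eta>. beta_weight N (\<eta>\<^sup>2) \<partial>lborel) < \<infinity>"
        using beta_weight_integral_finite[OF \<open>N \<ge> 0\<close>] by (rule le_less_trans) simp
      show "AE \<eta> in lborel. ennreal (\<phi> \<bar>\<eta>\<bar>) * beta_weight (Nm n) (\<eta>\<^sup>2) \<le> beta_weight N (\<eta>\<^sup>2)" for n
      proof (rule AE_I2)
        fix \<eta> :: real
        \<comment> \<open>\<open>Nm n\<close> is at least \<open>N\<close> and the base is at most
          1, so the limiting weight dominates.\<close>
        have "beta_weight (Nm n) (\<eta>\<^sup>2) \<le> beta_weight N (\<eta>\<^sup>2)"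
          unfolding beta_weight_def Nm_def by (auto intro!: ennreal_leI powr_mono')
        moreover have "ennreal (\<phi> \<bar>\<eta>\<bar>) \<le> 1" using phi(3) by simp
        ultimately show "ennreal (\<phi> \<bar>\<eta>\<bar>) * beta_weight (Nm n) (\<eta>\<^sup>2) \<le> beta_weight N (\<eta>\<^sup>2)"
          using mult_mono[of "ennreal (\<phi> \<bar>\<eta>\<bar>)" 1 "beta_weight (Nm n) (\<eta>\<^sup>2)" "beta_weight N (\<eta>\<^sup>2)"] by simp
      qed
      show "AE \<eta> in lborel. (\<lambda>n. ennreal (\<phi> \<bar>\<eta>\<bar>) * beta_weight (Nm n) (\<eta>\<^sup>2)) \<longlonglongrightarrow> ennreal (\<phi> \<bar>\<eta>\<bar>) * beta_weight N (\<eta>\<^sup>2)"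
      proof (rule AE_I2)
        fix \<eta> :: real
        have "(\<lambda>n. real d * (1 / real (Suc n))) \<longlonglongrightarrow> real d * 0"
          by (intro tendsto_intros LIMSEQ_Suc lim_1_over_n)
        then have "(\<lambda>n. N + real d / real (Suc n)) \<longlonglongrightarrow> N + real d * 0"
          by (intro tendsto_intros) simp
        then have NN: "Nm \<longlonglongrightarrow> N" unfolding Nm_def[abs_def] by simp
        have "(\<lambda>n. beta_weight (Nm n) (\<eta>\<^sup>2)) \<longlonglongrightarrow> beta_weight N (\<eta>\<^sup>2)"
          unfolding beta_weight_def using NN by (auto intro!: tendsto_ennrealI tendsto_powr)
        then show "(\<lambda>n. ennreal (\<phi> \<bar>\<eta>\<bar>) * beta_weight (Nm n) (\<eta>\<^sup>2)) \<longlonglongrightarrow> ennreal (\<phi> \<bar>\<eta>\<bar>) * beta_weight N (\<eta>\<^sup>2)"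
          by (intro tendsto_mult_ennreal tendsto_const) (auto simp: beta_weight_def)
      qed
    qed measurable
  qed

  have c1: "continuous_on UNIV (\<lambda>_::real. 1::real)" by simp
  let ?E = "\<integral>\<^sup>+x. ennreal (\<psi> (plane_dist d x)) \<partial>sphere_points {..<d} d"
  interpret SP: prob_space "sphere_points {..<d} d"
    by (rule prob_space_PiM) (rule prob_space_uniform_sphere)
  have E1: "?E \<le> 1"
    by (rule order_trans[OF nn_integral_mono[of _ _ "\<lambda>_. 1"]]) (auto simp: SP.emeasure_space_1 bnd)
  have kk: "?k \<noteq> 0" "?k \<noteq> \<infinity>" using \<open>d > 0\<close> by (auto simp: ennreal_power)
  have J1: "J N \<phi> \<le> 2" if "\<And>r. \<phi> r \<le> 1" for \<phi>
  proof -
    have "J N \<phi> \<le> (\<integral>\<^sup>+\<eta>. beta_weight N (\<eta>\<^sup>2) \<partial>lborel)"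
      unfolding J_def
    proof (rule nn_integral_mono)
      fix \<eta> :: real
      have "ennreal (\<phi> \<bar>\<eta>\<bar>) \<le> 1" using that by simp
      then show "ennreal (\<phi> \<bar>\<eta>\<bar>) * beta_weight N (\<eta>\<^sup>2) \<le> beta_weight N (\<eta>\<^sup>2)"
        using mult_mono[of "ennreal (\<phi> \<bar>\<eta>\<bar>)" 1 "beta_weight N (\<eta>\<^sup>2)" "beta_weight N (\<eta>\<^sup>2)"] by simp
    qed
    then show ?thesis using beta_weight_integral_finite[OF \<open>N \<ge> 0\<close>] by (rule order_trans)
  qed
  have Jf: "J N (\<lambda>_. 1) \<noteq> \<infinity>" "J N \<psi> \<noteq> \<infinity>"
    using J1[of "\<lambda>_. 1"] J1[of \<psi>] bnd by (auto simp: top_unique)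
  have Ef: "?k * ?E \<noteq> \<infinity>" using kk E1 by (auto simp: ennreal_mult_eq_top_iff top_unique)
  have "(\<lambda>n. B n \<psi> * J (Nm n) (\<lambda>_. 1)) \<longlonglongrightarrow> ?k * ?E * J N (\<lambda>_. 1)"
    by (intro tendsto_mult_ennreal Blim Jlim cont bnd c1) (use Jf Ef in auto)
  moreover have "(\<lambda>n. B n (\<lambda>_. 1) * J (Nm n) \<psi>) \<longlonglongrightarrow> ?k * 1 * J N \<psi>"
  proof -
    have "(\<lambda>n. B n (\<lambda>_. 1)) \<longlonglongrightarrow> ?k * 1"
      using Blim[OF c1] by (simp add: SP.emeasure_space_1)
    then show ?thesis
      by (intro tendsto_mult_ennreal Jlim cont bnd) (use Jf kk in auto)
  qed
  ultimately have "?k * ?E * J N (\<lambda>_. 1) = ?k * 1 * J N \<psi>"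
    unfolding ratio by (rule LIMSEQ_unique)
  then have "?k * (?E * J N (\<lambda>_. 1)) = ?k * J N \<psi>" by (simp add: mult.assoc)
  then have "?E * J N (\<lambda>_. 1) = J N \<psi>" using kk by (rule ennreal_cancel_left)
  then show ?thesis by (simp add: J_def)
qed

section \<open>Gaussian approximation of spherical caps\<close>

definition gauss :: "nat \<Rightarrow> (nat \<Rightarrow> real) measure"
  where "gauss d = PiM {..<d} (\<lambda>_. std_normal_distribution)"

lemma prob_space_std_normal: "prob_space std_normal_distribution"
  by (rule prob_space_normal_density) simp

lemma prob_space_gauss: "prob_space (gauss d)"
  unfolding gauss_def by (rule prob_space_PiM) (rule prob_space_std_normal)

lemma sets_gauss [measurable_cong]: "sets (gauss d) = sets (leb {..<d})"
  unfolding gauss_def by (rule sets_PiM_cong) simp_all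

lemma space_gauss: "space (gauss d) = space (leb {..<d})"
  by (rule sets_eq_imp_space_eq[OF sets_gauss])

text \<open>The product of the one-dimensional densities is brought into a form depending on
  \<open>enorm d x\<close> alone, to which polar coordinates apply.\<close>

lemma gauss_density:
  "gauss d = density (leb {..<d}) (\<lambda>x. ennreal ((1 / sqrt (2 * pi)) ^ d * exp (- (enorm d x)\<^sup>2 / 2)))"
proof -
  have sf: "sigma_finite_measure (density lborel (\<lambda>x. ennreal (std_normal_density x)))"
    using prob_space_imp_sigma_finite[OF prob_space_std_normal] .
  have "gauss d = density (leb {..<d}) (\<lambda>x. \<Prod>i<d. ennreal (std_normal_density (x i)))"
    unfolding gauss_def by (rule density_PiM) (use sf lborel.sigma_finite_measure_axioms in auto)
  moreover have "(\<Prod>i<d. ennreal (std_normal_density (x i))) = ennreal ((1 / sqrt (2 * pi)) ^ d * exp (- (enorm d x)\<^sup>2 / 2))" for x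
  proof -
    have "(\<Prod>i<d. ennreal (std_normal_density (x i))) = ennreal (\<Prod>i<d. std_normal_density (x i))"
      by (rule prod_ennreal) simp
    also have "(\<Prod>i<d. std_normal_density (x i)) = (1 / sqrt (2 * pi)) ^ d * exp (\<Sum>i<d. - (x i)\<^sup>2 / 2)"
      by (simp only: std_normal_density_def prod.distrib exp_sum[OF finite_lessThan] prod_constant card_lessThan)
    also have "(\<Sum>i<d. - (x i)\<^sup>2 / 2) = - (enorm d x)\<^sup>2 / 2"
      by (simp add: enorm_eq sqn_def sum_nonneg sum_negf sum_divide_distrib[symmetric])
    finally show ?thesis .
  qed
  ultimately show ?thesis by simp
qed

text \<open>A density that depends only on the norm factors out of the integral over directions, so
  the image is a multiple \<open>Z\<close> of the uniform distribution. Comparing total masses gives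
  \<open>Z = 1\<close> without evaluating the radial integral.\<close>

lemma uniform_sphere_eq_gauss:
  assumes "d > 0"
  shows "uniform_sphere d = distr (gauss d) (PiM {..<d} (\<lambda>_. borel)) (radial_projection d)"
proof -
  let ?f = "\<lambda>s::real. ennreal ((1 / sqrt (2 * pi)) ^ d * exp (- s\<^sup>2 / 2))"
  let ?B = "PiM {..<d} (\<lambda>_. borel) :: (nat \<Rightarrow> real) measure"
  interpret G: prob_space "gauss d" by (rule prob_space_gauss)
  interpret S: prob_space "uniform_sphere d" by (rule prob_space_uniform_sphere)
  define Z where "Z = ball_volume d * (\<integral>\<^sup>+s. radial_density d s * ?f s \<partial>lborel)"
  have pm [measurable]: "radial_projection d \<in> measurable (gauss d) ?B"
    by (simp add: measurable_cong_sets[OF sets_gauss refl])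
  have E: "emeasure (distr (gauss d) ?B (radial_projection d)) C = Z * emeasure (uniform_sphere d) C"
    if C [measurable]: "C \<in> sets ?B" for C
  proof -
    have "emeasure (distr (gauss d) ?B (radial_projection d)) C = emeasure (gauss d) (radial_projection d -` C \<inter> space (leb {..<d}))"
      by (subst emeasure_distr) (auto simp: space_gauss)
    also have "\<dots> = (\<integral>\<^sup>+x. ?f (enorm d x) * indicator (radial_projection d -` C \<inter> space (leb {..<d})) x \<partial>leb {..<d})"
      unfolding gauss_density by (rule emeasure_density) measurable
    also have "\<dots> = (\<integral>\<^sup>+x. (case (enorm d x, radial_projection d x) of (s, \<theta>) \<Rightarrow> ?f s * indicator C \<theta>) \<partial>leb {..<d})"
      by (rule nn_integral_cong) (simp add: indicator_def)
    also have "\<dots> = ball_volume d * (\<integral>\<^sup>+s. radial_density d s *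
        (\<integral>\<^sup>+\<theta>. (case (s, \<theta>) of (s, \<theta>) \<Rightarrow> ?f s * indicator C \<theta>) \<partial>uniform_sphere d) \<partial>lborel)"
    proof (rule polar_coordinates[OF \<open>d > 0\<close>])
      show "(\<lambda>(s, \<theta>). ?f s * indicator C \<theta>) \<in> borel_measurable (borel \<Otimes>\<^sub>M ?B)"
        by measurable
    qed
    also have "\<dots> = ball_volume d * (\<integral>\<^sup>+s. (radial_density d s * ?f s) * emeasure (uniform_sphere d) C \<partial>lborel)"
      using C by (simp add: nn_integral_cmult mult.assoc)
    also have "\<dots> = Z * emeasure (uniform_sphere d) C"
      unfolding Z_def by (subst nn_integral_multc) (auto simp: mult.assoc)
    finally show ?thesis .
  qed
  have "emeasure (distr (gauss d) ?B (radial_projection d)) (space ?B) = 1"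
    using G.prob_space_distr[OF pm] by (simp add: prob_space.emeasure_space_1[of "distr _ _ _", simplified])
  moreover have "emeasure (uniform_sphere d) (space ?B) = 1"
    using S.emeasure_space_1 sets_eq_imp_space_eq[OF sets_uniform_sphere[of d]] by simp
  ultimately have "Z = 1" using E[of "space ?B"] by simp
  then show ?thesis by (intro measure_eqI) (auto simp: E)
qed

lemma dotp_measurable_gauss [measurable]: "(\<lambda>x. dotp d x v) \<in> borel_measurable (gauss d)"
proof -
  have "(\<lambda>x. x i) \<in> borel_measurable (leb {..<d})" if "i \<in> {..<d}" for i
    using measurable_component_singleton[OF that, of "\<lambda>_. lborel :: real measure"] by simp
  then show ?thesis
    unfolding measurable_cong_sets[OF sets_gauss refl] dotp_def
    by (intro borel_measurable_sum borel_measurable_times) auto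
qed

text \<open>A sum of independent centred normal variables is normal, here with variance
  \<open>sqn d v\<close>.\<close>

lemma gauss_linear_cdf:
  assumes "sqn d v > 0"
  shows "measure (gauss d) {x \<in> space (gauss d). dotp d x v \<le> t} = \<Phi> (t / sqrt (sqn d v))"
proof -
  interpret G: prob_space "gauss d" by (rule prob_space_gauss)
  let ?s = "sqrt (sqn d v)"
  \<comment> \<open>Vanishing coefficients are removed so that every summand has positive
    variance.\<close>
  define I where "I = {i. i < d \<and> v i \<noteq> 0}"
  have fin: "finite I" by (auto simp: I_def)
  have sqnI: "sqn d v = (\<Sum>i\<in>I. \<bar>v i\<bar>\<^sup>2)"
    unfolding sqn_def I_def by (intro sum.mono_neutral_cong_right) auto
  have "I \<noteq> {}" using assms sqnI by auto
  have comp: "(\<lambda>x. x i) \<in> borel_measurable (gauss d)" if "i < d" for i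
    using measurable_component_singleton[of i "{..<d}" "\<lambda>_. lborel :: real measure"] that
    unfolding measurable_cong_sets[OF sets_gauss refl] by simp
  have distr_c: "distr (gauss d) borel (\<lambda>x. x i) = std_normal_distribution" if "i < d" for i
  proof -
    have "distr (gauss d) borel (\<lambda>x. x i) = distr (gauss d) std_normal_distribution (\<lambda>x. x i)"
      by (rule distr_cong) auto
    also have "\<dots> = std_normal_distribution"
      unfolding gauss_def by (rule distr_PiM_component) (use that prob_space_std_normal in auto)
    finally show ?thesis .
  qed
  have "d \<noteq> 0" using assms by (cases d) (auto simp: sqn_def)
  have "G.indep_vars (\<lambda>_. borel) (\<lambda>i x. x i) {..<d}"
  proof -
    have "distr (gauss d) (PiM {..<d} (\<lambda>_. borel)) (\<lambda>x. \<lambda>i\<in>{..<d}. x i) = distr (gauss d) (gauss d) (\<lambda>x. x)"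
      by (rule distr_cong) (auto simp: sets_gauss sets_leb space_gauss space_PiM)
    also have "\<dots> = gauss d" by (rule distr_id)
    also have "\<dots> = PiM {..<d} (\<lambda>i. distr (gauss d) borel (\<lambda>x. x i))"
      unfolding gauss_def by (rule PiM_cong) (use distr_c in \<open>auto simp: gauss_def\<close>)
    finally show ?thesis
      using \<open>d \<noteq> 0\<close> by (subst G.indep_vars_iff_distr_eq_PiM') (use comp in auto)
  qed
  then have "G.indep_vars (\<lambda>_. borel) (\<lambda>i x. x i) I"
    by (rule G.indep_vars_subset) (auto simp: I_def)
  then have ind: "G.indep_vars (\<lambda>_. borel) (\<lambda>i x. v i * x i) I"
    using G.indep_vars_compose2[of "\<lambda>_. borel" "\<lambda>i x. x i" I "\<lambda>i y. v i * y" "\<lambda>_. borel"] by simp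
  have dist: "distributed (gauss d) lborel (\<lambda>x. v i * x i) (normal_density 0 \<bar>v i\<bar>)" if "i \<in> I" for i
  proof -
    have i: "i < d" "v i \<noteq> 0" using that by (auto simp: I_def)
    have "distributed (gauss d) lborel (\<lambda>x. x i) (normal_density 0 1)"
    proof -
      have "distr (gauss d) lborel (\<lambda>x. x i) = distr (gauss d) borel (\<lambda>x. x i)"
        by (rule distr_cong) auto
      then show ?thesis using comp[OF i(1)] distr_c[OF i(1)]
        by (simp add: distributed_def)
    qed
    from G.normal_density_affine[OF this, of "v i" 0] show ?thesis using i by simp
  qed
  have "distributed (gauss d) lborel (\<lambda>x. \<Sum>i\<in>I. v i * x i) (normal_density (\<Sum>i\<in>I. 0) (sqrt (\<Sum>i\<in>I. \<bar>v i\<bar>\<^sup>2)))"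
    by (rule G.sum_indep_normal[OF fin \<open>I \<noteq> {}\<close> ind]) (use dist in \<open>auto simp: I_def\<close>)
  moreover have "(\<Sum>i\<in>I. v i * x i) = dotp d x v" for x
    unfolding dotp_def I_def by (subst mult.commute, intro sum.mono_neutral_cong_left) auto
  ultimately have "distributed (gauss d) lborel (\<lambda>x. dotp d x v) (normal_density 0 ?s)"
    by (simp add: sqnI)
  then have std: "distributed (gauss d) lborel (\<lambda>x. (dotp d x v - 0) / ?s) std_normal_density"
    using assms by (subst (asm) G.normal_standard_normal_convert) auto
  have "\<Phi> (t / ?s) = measure (distr (gauss d) lborel (\<lambda>x. dotp d x v / ?s)) {..t / ?s}"
    using std by (simp add: \<Phi>_def cdf_def distributed_def)
  also have "\<dots> = measure (gauss d) ((\<lambda>x. dotp d x v / ?s) -` {..t / ?s} \<inter> space (gauss d))"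
    by (rule measure_distr) auto
  also have "(\<lambda>x. dotp d x v / ?s) -` {..t / ?s} \<inter> space (gauss d) = {x \<in> space (gauss d). dotp d x v \<le> t}"
    using assms by (auto simp: divide_le_cancel)
  finally show ?thesis ..
qed

text \<open>The Gaussian expectation of \<open>exp (\<theta> * (sqn d x - c * d))\<close> for
  \<open>\<theta> = (1 - 1 / c) / 2\<close>, the value that minimises it. It decays exponentially in
  \<open>d\<close> for every positive \<open>c\<close> other than 1.\<close>

definition norm_tail :: "nat \<Rightarrow> real \<Rightarrow> real"
  where "norm_tail d c = (sqrt (c * exp (1 - c))) ^ d"

text \<open>Chernoff's bound; the same exponential tilt serves the upper (\<open>c > 1\<close>) and lower (\<open>c < 1\<close>) tails.\<close>

lemma gauss_norm_chernoff:
  assumes "c > 0"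
    and imp: "\<And>x. P x \<Longrightarrow> (1 - 1 / c) * (sqn d x - c * real d) \<ge> 0"
    and [measurable]: "{x \<in> space (gauss d). P x} \<in> sets (gauss d)"
  shows "measure (gauss d) {x \<in> space (gauss d). P x} \<le> norm_tail d c"
proof -
  interpret G: prob_space "gauss d" by (rule prob_space_gauss)
  interpret N: prob_space std_normal_distribution by (rule prob_space_std_normal)
  interpret PN: product_sigma_finite "\<lambda>_::nat. std_normal_distribution" by standard
  let ?\<theta> = "(1 - 1 / c) / 2"
  have one: "(\<integral>\<^sup>+y. ennreal (exp (?\<theta> * (y\<^sup>2 - c))) \<partial>std_normal_distribution) = ennreal (sqrt (c * exp (1 - c)))"
  proof -
    have "(\<integral>\<^sup>+y. ennreal (exp (?\<theta> * (y\<^sup>2 - c))) \<partial>std_normal_distribution) =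
        (\<integral>\<^sup>+y. ennreal (std_normal_density y) * ennreal (exp (?\<theta> * (y\<^sup>2 - c))) \<partial>lborel)"
      by (rule nn_integral_density) auto
    \<comment> \<open>The tilted standard density is a multiple of the centred normal density of
      variance \<open>c\<close>, and the multiple is the value sought.\<close>
    also have "\<dots> = (\<integral>\<^sup>+y. ennreal (sqrt (c * exp (1 - c))) * ennreal (normal_density 0 (sqrt c) y) \<partial>lborel)"
    proof (rule nn_integral_cong)
      fix y :: real
      have "std_normal_density y * exp (?\<theta> * (y\<^sup>2 - c)) = sqrt (c * exp (1 - c)) * normal_density 0 (sqrt c) y"
      proof -
        have "sqrt (exp (1 - c)) = exp ((1 - c) / 2)"
          by (rule real_sqrt_unique) (simp_all add: power2_eq_square mult_exp_exp)
        then have "sqrt (c * exp (1 - c)) * normal_density 0 (sqrt c) y =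
            sqrt c * exp ((1 - c) / 2) * (1 / sqrt (2 * pi * c) * exp (- y\<^sup>2 / (2 * c)))"
          using \<open>c > 0\<close> by (simp add: normal_density_def real_sqrt_mult)
        also have "\<dots> = 1 / sqrt (2 * pi) * (exp ((1 - c) / 2) * exp (- y\<^sup>2 / (2 * c)))"
          using \<open>c > 0\<close> by (simp add: real_sqrt_mult)
        also have "exp ((1 - c) / 2) * exp (- y\<^sup>2 / (2 * c)) = exp (- y\<^sup>2 / 2) * exp (?\<theta> * (y\<^sup>2 - c))"
          unfolding mult_exp_exp using \<open>c > 0\<close> by (intro arg_cong[where f = exp]) (simp add: field_simps)
        finally show ?thesis by (simp add: std_normal_density_def)
      qed
      then show "ennreal (std_normal_density y) * ennreal (exp (?\<theta> * (y\<^sup>2 - c))) =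
          ennreal (sqrt (c * exp (1 - c))) * ennreal (normal_density 0 (sqrt c) y)"
        using \<open>c > 0\<close> by (simp add: ennreal_mult[symmetric])
    qed
    also have "\<dots> = ennreal (sqrt (c * exp (1 - c))) * (\<integral>\<^sup>+y. ennreal (normal_density 0 (sqrt c) y) \<partial>lborel)"
      by (rule nn_integral_cmult) auto
    also have "(\<integral>\<^sup>+y. ennreal (normal_density 0 (sqrt c) y) \<partial>lborel) = 1"
    proof -
      have "prob_space (density lborel (normal_density 0 (sqrt c)))"
        using \<open>c > 0\<close> by (intro prob_space_normal_density) simp
      from prob_space.emeasure_space_1[OF this] show ?thesis by (simp add: emeasure_density)
    qed
    finally show ?thesis by simp
  qed
  have "emeasure (gauss d) {x \<in> space (gauss d). P x} = (\<integral>\<^sup>+x. indicator {x \<in> space (gauss d). P x} x \<partial>gauss d)"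
    by simp
  also have "\<dots> \<le> (\<integral>\<^sup>+x. (\<Prod>i<d. ennreal (exp (?\<theta> * ((x i)\<^sup>2 - c)))) \<partial>gauss d)"
  proof (rule nn_integral_mono)
    fix x
    have pr: "(\<Prod>i<d. ennreal (exp (?\<theta> * ((x i)\<^sup>2 - c)))) = ennreal (exp (?\<theta> * (sqn d x - c * real d)))"
    proof -
      have "(\<Prod>i<d. ennreal (exp (?\<theta> * ((x i)\<^sup>2 - c)))) = ennreal (exp (\<Sum>i<d. ?\<theta> * ((x i)\<^sup>2 - c)))"
        by (simp add: prod_ennreal exp_sum)
      also have "(\<Sum>i<d. ?\<theta> * ((x i)\<^sup>2 - c)) = ?\<theta> * (sqn d x - c * real d)"
        unfolding sum_distrib_left[symmetric] sum_subtractf by (simp add: sqn_def mult.commute)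
      finally show ?thesis .
    qed
    \<comment> \<open>The exponential Markov inequality: on the event the exponent is nonnegative by
      \<open>imp\<close>.\<close>
    show "indicator {x \<in> space (gauss d). P x} x \<le> (\<Prod>i<d. ennreal (exp (?\<theta> * ((x i)\<^sup>2 - c))))"
    proof (cases "P x")
      case True
      then have "?\<theta> * (sqn d x - c * real d) \<ge> 0" using imp[OF True] by simp
      then have "1 \<le> exp (?\<theta> * (sqn d x - c * real d))" by simp
      then show ?thesis unfolding pr by (simp add: indicator_def)
    qed simp
  qed
  also have "\<dots> = (\<Prod>i<d. \<integral>\<^sup>+y. ennreal (exp (?\<theta> * (y\<^sup>2 - c))) \<partial>std_normal_distribution)"
    unfolding gauss_def by (rule PN.product_nn_integral_prod) auto
  also have "\<dots> = ennreal (norm_tail d c)"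
    unfolding one using \<open>c > 0\<close> by (simp add: norm_tail_def ennreal_power)
  finally show ?thesis
    using \<open>c > 0\<close> by (simp add: G.emeasure_eq_measure norm_tail_def)
qed

section \<open>Caps of the sphere against Gaussian half-spaces\<close>

lemma sphere_measure_gauss:
  assumes "d > 0" and [measurable]: "{z \<in> space (PiM {..<d} (\<lambda>_. borel :: real measure)). P z} \<in> sets (PiM {..<d} (\<lambda>_. borel))"
  shows "measure (uniform_sphere d) {z \<in> space (uniform_sphere d). P z} =
    measure (gauss d) {x \<in> space (gauss d). P (radial_projection d x)}"
proof -
  have pm: "radial_projection d \<in> measurable (gauss d) (PiM {..<d} (\<lambda>_. borel))"
    by (simp add: measurable_cong_sets[OF sets_gauss refl])
  have sp: "space (uniform_sphere d) = space (PiM {..<d} (\<lambda>_. borel))"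
    by (rule sets_eq_imp_space_eq) simp
  have "measure (uniform_sphere d) {z \<in> space (uniform_sphere d). P z} =
     measure (gauss d) (radial_projection d -` {z \<in> space (PiM {..<d} (\<lambda>_. borel)). P z} \<inter> space (gauss d))"
    unfolding sp by (subst uniform_sphere_eq_gauss[OF \<open>d > 0\<close>], rule measure_distr[OF pm]) fact
  also have "radial_projection d -` {z \<in> space (PiM {..<d} (\<lambda>_. borel)). P z} \<inter> space (gauss d) =
      {x \<in> space (gauss d). P (radial_projection d x)}"
    using measurable_space[OF pm] by auto
  finally show ?thesis .
qed

lemma dotp_measurable_borel: "(\<lambda>x. dotp d x v) \<in> borel_measurable (PiM {..<d} (\<lambda>_. borel))"
  unfolding dotp_def by (intro borel_measurable_sum borel_measurable_times) (auto intro: measurable_component_singleton)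

lemma dotp_radial_projection: "dotp d (radial_projection d x) v = dotp d x v / enorm d x"
  by (simp add: dotp_def radial_projection_def sum_divide_distrib)

lemma enorm_zero_dotp: "enorm d x = 0 \<Longrightarrow> dotp d x v = 0"
proof -
  assume "enorm d x = 0"
  then have "(\<Sum>j<d. (x j)\<^sup>2) = 0" by (simp add: enorm_def)
  then have "x j = 0" if "j < d" for j using that by (subst (asm) sum_nonneg_eq_0_iff) auto
  then show ?thesis by (simp add: dotp_def)
qed

lemma enorm_nonneg: "0 \<le> enorm d x"
  by (simp add: enorm_eq)

text \<open>For Gaussian \<open>x\<close> the event says that the product with \<open>v\<close> is
  at most the norm of \<open>x\<close>. Unless the norm reaches \<open>sqrt (c * d)\<close>, such an
  \<open>x\<close> lies in a half-space whose Gaussian measure is a value of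
  \<open>\<Phi>\<close>.\<close>

lemma cap_le:
  assumes "d > 0" "sqn d v > 0" "c > 1"
  shows "measure (uniform_sphere d) {z \<in> space (uniform_sphere d). dotp d z v \<le> 1}
    \<le> \<Phi> (sqrt (c * real d) / sqrt (sqn d v)) + norm_tail d c"
proof -
  interpret G: prob_space "gauss d" by (rule prob_space_gauss)
  have "measure (uniform_sphere d) {z \<in> space (uniform_sphere d). dotp d z v \<le> 1} =
      G.prob {x \<in> space (gauss d). dotp d (radial_projection d x) v \<le> 1}"
    by (rule sphere_measure_gauss[OF \<open>d > 0\<close>]) (use dotp_measurable_borel in measurable)
  also have "\<dots> \<le> G.prob ({x \<in> space (gauss d). dotp d x v \<le> sqrt (c * real d)} \<union>
      {x \<in> space (gauss d). c * real d \<le> (enorm d x)\<^sup>2})"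
  proof (rule G.finite_measure_mono)
    show "{x \<in> space (gauss d). dotp d (radial_projection d x) v \<le> 1} \<subseteq>
      {x \<in> space (gauss d). dotp d x v \<le> sqrt (c * real d)} \<union> {x \<in> space (gauss d). c * real d \<le> (enorm d x)\<^sup>2}"
    proof safe
      fix x assume x: "dotp d (radial_projection d x) v \<le> 1" "\<not> c * real d \<le> (enorm d x)\<^sup>2"
      have "dotp d x v \<le> enorm d x"
        using x(1) enorm_zero_dotp[of d x v] enorm_nonneg[of d x]
        by (cases "enorm d x = 0") (auto simp: dotp_radial_projection divide_le_eq split: if_splits)
      also have "\<dots> \<le> sqrt (c * real d)" using x(2) by (intro real_le_rsqrt) simp
      finally show "dotp d x v \<le> sqrt (c * real d)" .
    qed
  qed measurable
  also have "\<dots> \<le> G.prob {x \<in> space (gauss d). dotp d x v \<le> sqrt (c * real d)} +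
      G.prob {x \<in> space (gauss d). c * real d \<le> (enorm d x)\<^sup>2}"
    by (rule measure_Un_le) measurable
  also have "G.prob {x \<in> space (gauss d). c * real d \<le> (enorm d x)\<^sup>2} \<le> norm_tail d c"
  proof (rule gauss_norm_chernoff)
    show "{x \<in> space (gauss d). c * real d \<le> (enorm d x)\<^sup>2} \<in> sets (gauss d)" by measurable
  qed (use \<open>c > 1\<close> in \<open>auto simp: enorm_eq\<close>)
  finally show ?thesis by (simp add: gauss_linear_cdf[OF assms(2)])
qed

lemma \<Phi>_mono: "x \<le> y \<Longrightarrow> \<Phi> x \<le> \<Phi> y"
proof -
  interpret N: prob_space std_normal_distribution by (rule prob_space_std_normal)
  interpret N: finite_borel_measure std_normal_distribution by standard simp
  show "x \<le> y \<Longrightarrow> \<Phi> x \<le> \<Phi> y" unfolding \<Phi>_def by (rule N.cdf_nondecreasing)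
qed

lemma sqn_uminus: "sqn d (\<lambda>i. - v i) = sqn d v" and dotp_uminus: "dotp d x (\<lambda>i. - v i) = - dotp d x v"
  by (simp_all add: sqn_def dotp_def sum_negf)

lemma norm_tail_nonneg: "c > 0 \<Longrightarrow> norm_tail d c \<ge> 0"
  by (simp add: norm_tail_def)

text \<open>The far side of the hyperplane lies in a half-space bounded by a parallel hyperplane
  through the origin, of measure \<open>\<Phi> 0\<close>. As the argument of \<open>\<Phi>\<close>
  in the bound for the near side is nonnegative, that bound serves here too.\<close>

lemma cap_ge_opposite:
  assumes "d > 0" "sqn d v > 0" "c > 1"
  shows "measure (uniform_sphere d) {z \<in> space (uniform_sphere d). dotp d z v \<ge> 1}
    \<le> \<Phi> (sqrt (c * real d) / sqrt (sqn d v)) + norm_tail d c"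
proof -
  interpret G: prob_space "gauss d" by (rule prob_space_gauss)
  have "measure (uniform_sphere d) {z \<in> space (uniform_sphere d). dotp d z v \<ge> 1} =
      G.prob {x \<in> space (gauss d). dotp d (radial_projection d x) v \<ge> 1}"
    by (rule sphere_measure_gauss[OF \<open>d > 0\<close>]) (use dotp_measurable_borel in measurable)
  also have "\<dots> \<le> G.prob {x \<in> space (gauss d). dotp d x (\<lambda>i. - v i) \<le> 0}"
  proof (rule G.finite_measure_mono)
    show "{x \<in> space (gauss d). dotp d (radial_projection d x) v \<ge> 1} \<subseteq> {x \<in> space (gauss d). dotp d x (\<lambda>i. - v i) \<le> 0}"
    proof safe
      fix x assume x: "dotp d (radial_projection d x) v \<ge> 1"
      show "dotp d x (\<lambda>i. - v i) \<le> 0"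
        using x enorm_nonneg[of d x]
        by (cases "enorm d x = 0") (auto simp: dotp_uminus dotp_radial_projection le_divide_eq split: if_splits)
    qed
  qed measurable
  also have "\<dots> = \<Phi> 0" using assms(2) by (subst gauss_linear_cdf) (simp_all add: sqn_uminus)
  also have "\<dots> \<le> \<Phi> (sqrt (c * real d) / sqrt (sqn d v))" using assms by (intro \<Phi>_mono) auto
  also have "\<dots> \<le> \<Phi> (sqrt (c * real d) / sqrt (sqn d v)) + norm_tail d c" using norm_tail_nonneg[of c d] assms by simp
  finally show ?thesis .
qed

text \<open>For \<open>c < 1\<close> the exceptional event is a norm of at most
  \<open>sqrt (c * d)\<close>. The strict inequality on the right matches the condition under which
  a simplex certainly gives a facet.\<close>

lemma cap_less_ge:
  assumes "d > 0" "sqn d v > 0" "0 < c" "c < 1"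
  shows "\<Phi> (sqrt (c * real d) / sqrt (sqn d v)) - norm_tail d c \<le>
    measure (uniform_sphere d) {z \<in> space (uniform_sphere d). dotp d z v < 1}"
proof -
  interpret G: prob_space "gauss d" by (rule prob_space_gauss)
  have "\<Phi> (sqrt (c * real d) / sqrt (sqn d v)) = G.prob {x \<in> space (gauss d). dotp d x v \<le> sqrt (c * real d)}"
    by (simp add: gauss_linear_cdf[OF assms(2)])
  also have "\<dots> \<le> G.prob ({x \<in> space (gauss d). dotp d (radial_projection d x) v < 1} \<union>
      {x \<in> space (gauss d). (enorm d x)\<^sup>2 \<le> c * real d})"
  proof (rule G.finite_measure_mono)
    show "{x \<in> space (gauss d). dotp d x v \<le> sqrt (c * real d)} \<subseteq>
      {x \<in> space (gauss d). dotp d (radial_projection d x) v < 1} \<union> {x \<in> space (gauss d). (enorm d x)\<^sup>2 \<le> c * real d}"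
    proof safe
      fix x assume x: "dotp d x v \<le> sqrt (c * real d)" "\<not> (enorm d x)\<^sup>2 \<le> c * real d"
      have "sqrt (c * real d) < enorm d x" using x(2) enorm_nonneg[of d x] by (intro real_less_lsqrt) auto
      then have "dotp d x v < enorm d x" using x(1) by simp
      then show "dotp d (radial_projection d x) v < 1"
        using enorm_zero_dotp[of d x v] enorm_nonneg[of d x]
        by (cases "enorm d x = 0") (auto simp: dotp_radial_projection divide_less_eq split: if_splits)
    qed
  qed (use dotp_radial_projection in \<open>simp, measurable\<close>)
  also have "\<dots> \<le> G.prob {x \<in> space (gauss d). dotp d (radial_projection d x) v < 1} +
      G.prob {x \<in> space (gauss d). (enorm d x)\<^sup>2 \<le> c * real d}"
    by (rule measure_Un_le) (use dotp_radial_projection in \<open>simp, measurable\<close>)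
  also have "G.prob {x \<in> space (gauss d). (enorm d x)\<^sup>2 \<le> c * real d} \<le> norm_tail d c"
  proof (rule gauss_norm_chernoff)
    show "{x \<in> space (gauss d). (enorm d x)\<^sup>2 \<le> c * real d} \<in> sets (gauss d)" by measurable
  qed (use assms in \<open>auto simp: enorm_eq mult_nonpos_nonpos\<close>)
  also have "G.prob {x \<in> space (gauss d). dotp d (radial_projection d x) v < 1} =
      measure (uniform_sphere d) {z \<in> space (uniform_sphere d). dotp d z v < 1}"
    by (rule sphere_measure_gauss[OF \<open>d > 0\<close>, symmetric]) (use dotp_measurable_borel in measurable)
  finally show ?thesis by simp
qed

section \<open>Facets of a simplicial polytope\<close>

text \<open>The copy of d-dimensional space in use. Affine combinations preserve the coordinates
  \<open>undefined\<close>; that the coefficients sum to 1 is what makes this work.\<close>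

abbreviation vecs :: "nat \<Rightarrow> (nat \<Rightarrow> real) set"
  where "vecs d \<equiv> {x. \<forall>j. j \<ge> d \<longrightarrow> x j = undefined}"

lemma scaleR_fun_apply: "(c *\<^sub>R f) j = c *\<^sub>R f j"
  by (simp add: scaleR_fun_def)

lemma sum_fun_apply: "(\<Sum>i\<in>I. f i) j = (\<Sum>i\<in>I. f i j)"
  by (induction I rule: infinite_finite_induct) auto

lemma dotp_linear: "dotp d (u *\<^sub>R x + w *\<^sub>R y) v = u * dotp d x v + w * dotp d y v"
  by (simp add: dotp_def scaleR_fun_apply sum.distrib sum_distrib_left distrib_right mult.assoc)

lemma dotp_sum: "dotp d (\<Sum>i\<in>I. u i *\<^sub>R x i) v = (\<Sum>i\<in>I. u i * dotp d (x i) v)"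
proof -
  have "dotp d (\<Sum>i\<in>I. u i *\<^sub>R x i) v = (\<Sum>j<d. \<Sum>i\<in>I. u i * (x i j * v j))"
    by (simp add: dotp_def sum_fun_apply scaleR_fun_apply sum_distrib_right mult.assoc)
  also have "\<dots> = (\<Sum>i\<in>I. u i * dotp d (x i) v)"
    by (subst sum.swap) (simp add: dotp_def sum_distrib_left)
  finally show ?thesis .
qed

lemma convex_vecs: "convex (vecs d)"
  unfolding convex_alt by (auto simp: scaleR_fun_apply algebra_simps)

text \<open>A basis, given by spanning and independence on the coordinates below \<open>d\<close>,
  with the normal \<open>v\<close> of the hyperplane through its points. This hyperplane misses the
  origin, which is why linear and not just affine independence is available.\<close>

locale simplex_hyperplane =
  fixes d :: nat and I :: "'i set" and x :: "'i \<Rightarrow> nat \<Rightarrow> real" and v :: "nat \<Rightarrow> real"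
  assumes finI: "finite I" and cardI: "card I = d" and dpos: "d > 0"
    and vec: "\<And>i. i \<in> I \<Longrightarrow> x i \<in> vecs d"
    and on: "\<And>i. i \<in> I \<Longrightarrow> dotp d (x i) v = 1"
    and span: "\<And>z. \<exists>\<alpha>. \<forall>j<d. z j = (\<Sum>i\<in>I. \<alpha> i * x i j)"
    and indep: "\<And>\<alpha>. (\<And>j. j < d \<Longrightarrow> (\<Sum>i\<in>I. \<alpha> i * x i j) = 0) \<Longrightarrow> \<forall>i\<in>I. \<alpha> i = 0"
begin

text \<open>Expanding \<open>z\<close> in the basis and pairing with \<open>v\<close> shows that the
  coefficients sum to 1. This also settles the coordinates from \<open>d\<close> on.\<close>

lemma affine_combination:
  assumes "z \<in> vecs d" "dotp d z v = 1"
  obtains \<alpha> where "sum \<alpha> I = 1" "z = (\<Sum>i\<in>I. \<alpha> i *\<^sub>R x i)"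
proof -
  obtain \<alpha> where \<alpha>: "\<forall>j<d. z j = (\<Sum>i\<in>I. \<alpha> i * x i j)" using span by blast
  have "dotp d z v = dotp d (\<Sum>i\<in>I. \<alpha> i *\<^sub>R x i) v"
    by (rule dotp_cong) (use \<alpha> in \<open>auto simp: sum_fun_apply scaleR_fun_apply\<close>)
  then have 1: "sum \<alpha> I = 1" using assms(2) on by (simp add: dotp_sum)
  have "z j = (\<Sum>i\<in>I. \<alpha> i *\<^sub>R x i) j" for j
  proof (cases "j < d")
    case False
    have "(\<Sum>i\<in>I. \<alpha> i *\<^sub>R x i) j = (\<Sum>i\<in>I. \<alpha> i * undefined)"
      unfolding sum_fun_apply by (intro sum.cong refl) (use vec False in \<open>auto simp: scaleR_fun_apply\<close>)
    also have "\<dots> = undefined" by (simp add: sum_distrib_right[symmetric] 1)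
    finally show ?thesis using assms(1) False by simp
  qed (use \<alpha> in \<open>simp add: sum_fun_apply scaleR_fun_apply\<close>)
  then show ?thesis using that[OF 1] by blast
qed

lemma inj: "inj_on x I"
proof (rule inj_onI)
  fix i k assume ik: "i \<in> I" "k \<in> I" "x i = x k"
  show "i = k"
  proof (rule ccontr)
    assume "i \<noteq> k"
    let ?a = "\<lambda>l. if l = i then 1 else if l = k then -1 else 0 :: real"
    have "(\<Sum>l\<in>I. ?a l * x l j) = 0" for j
    proof -
      have "(\<Sum>l\<in>I. ?a l * x l j) = (\<Sum>l\<in>I. (if l = i then x i j else 0) - (if l = k then x k j else 0))"
        using \<open>i \<noteq> k\<close> by (intro sum.cong) auto
      also have "\<dots> = x i j - x k j" using ik finI by (simp add: sum_subtractf)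
      finally show ?thesis using ik by simp
    qed
    then have "?a i = 0" using indep[of ?a] ik by blast
    then show False by simp
  qed
qed

lemma not_affine_dependent: "\<not> affine_dependent (x ` I)"
proof
  assume "affine_dependent (x ` I)"
  then obtain S u where S: "finite S" "S \<subseteq> x ` I" "sum u S = 0" "\<exists>s\<in>S. u s \<noteq> 0" "(\<Sum>s\<in>S. u s *\<^sub>R s) = 0"
    unfolding affine_dependent_explicit by blast
  let ?a = "\<lambda>i. if x i \<in> S then u (x i) else 0"
  have "(\<Sum>i\<in>I. ?a i * x i j) = 0" for j
  proof -
    have "(\<Sum>i\<in>I. ?a i * x i j) = (\<Sum>s\<in>x ` I. (if s \<in> S then u s else 0) * s j)"
      by (simp add: sum.reindex[OF inj])
    also have "\<dots> = (\<Sum>s\<in>S. u s * s j)"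
      using S(1,2) finI by (intro sum.mono_neutral_cong_right) auto
    also have "\<dots> = (\<Sum>s\<in>S. u s *\<^sub>R s) j" by (simp add: sum_fun_apply scaleR_fun_apply)
    finally show ?thesis by (simp add: S(5))
  qed
  then have "\<forall>i\<in>I. ?a i = 0" using indep[of ?a] by blast
  moreover obtain s where "s \<in> S" "u s \<noteq> 0" using S(4) by blast
  moreover obtain i where "i \<in> I" "s = x i" using S(2) \<open>s \<in> S\<close> by blast
  ultimately show False by auto
qed

lemma affine_combination_in_hull:
  assumes "sum \<alpha> I = 1"
  shows "(\<Sum>i\<in>I. \<alpha> i *\<^sub>R x i) \<in> affine hull (x ` I)"
proof -
  have "(\<Sum>s\<in>x ` I. \<alpha> (the_inv_into I x s) *\<^sub>R s) = (\<Sum>i\<in>I. \<alpha> i *\<^sub>R x i)"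
    unfolding sum.reindex[OF inj] by (intro sum.cong) (auto simp: the_inv_into_f_f[OF inj])
  moreover have "(\<Sum>s\<in>x ` I. \<alpha> (the_inv_into I x s)) = 1"
    unfolding sum.reindex[OF inj] assms[symmetric] by (intro sum.cong) (auto simp: the_inv_into_f_f[OF inj])
  ultimately show ?thesis
    unfolding affine_hull_finite[OF finite_imageI[OF finI]] by (intro CollectI exI conjI)
qed

lemma affine_hull_on: "z \<in> affine hull (x ` I) \<Longrightarrow> dotp d z v = 1"
proof -
  assume "z \<in> affine hull (x ` I)"
  then obtain u where u: "sum u (x ` I) = 1" "(\<Sum>s\<in>x ` I. u s *\<^sub>R s) = z"
    unfolding affine_hull_finite[OF finite_imageI[OF finI]] by blast
  have "dotp d z v = (\<Sum>s\<in>x ` I. u s * dotp d s v)" unfolding u(2)[symmetric] by (rule dotp_sum)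
  also have "\<dots> = sum u (x ` I)" by (intro sum.cong) (auto simp: on)
  finally show ?thesis using u by simp
qed

text \<open>A point of the hyperplane is joined through the centroid of the simplex to a further point of the
  simplex; so a face containing the simplex contains the whole section.\<close>

lemma section_in_face:
  assumes F: "F face_of P" and "P \<subseteq> vecs d" and sub: "x ` I \<subseteq> F"
    and z: "z \<in> P" "dotp d z v = 1"
  shows "z \<in> F"
proof -
  have convF: "convex F" and FP: "F \<subseteq> P" using F by (auto simp: face_of_def)
  obtain \<alpha> where \<alpha>: "sum \<alpha> I = 1" "z = (\<Sum>i\<in>I. \<alpha> i *\<^sub>R x i)"
    using affine_combination[of z] z \<open>P \<subseteq> vecs d\<close> by blast
  \<comment> \<open>The centroid, whose coefficients are all positive, leaves room to move within
    the simplex in every direction of the hyperplane.\<close>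
  define c where "c = (\<Sum>i\<in>I. (1 / real d) *\<^sub>R x i)"
  \<comment> \<open>Small enough that \<open>real d * t * \<alpha> i \<le> 1\<close> for every
    \<open>i\<close>; the denominator exceeds 1, so \<open>t\<close> is strictly below 1.\<close>
  define t where "t = 1 / (1 + real d * (1 + (\<Sum>i\<in>I. \<bar>\<alpha> i\<bar>)))"
  have den: "0 < 1 + real d * (1 + (\<Sum>i\<in>I. \<bar>\<alpha> i\<bar>))"
    by (intro add_pos_nonneg mult_nonneg_nonneg) (auto intro: sum_nonneg)
  have t: "t > 0" "t < 1" 
  proof -
    show "t > 0" using den by (simp add: t_def)
    have "0 < real d * (1 + (\<Sum>i\<in>I. \<bar>\<alpha> i\<bar>))"
      using dpos by (intro mult_pos_pos add_pos_nonneg) (auto intro: sum_nonneg)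
    then show "t < 1" by (simp add: t_def)
  qed
  \<comment> \<open>Solves \<open>c = (1 - t) y + t z\<close> for \<open>y\<close>; the choice of
    \<open>t\<close> makes the coefficients nonnegative.\<close>
  define y where "y = (\<Sum>i\<in>I. ((1 / real d - t * \<alpha> i) / (1 - t)) *\<^sub>R x i)"
  have coef: "1 / real d - t * \<alpha> i \<ge> 0" if "i \<in> I" for i
  proof -
    have "real d * (t * \<alpha> i) \<le> t * (1 + real d * (1 + (\<Sum>i\<in>I. \<bar>\<alpha> i\<bar>)))"
    proof -
      have "\<alpha> i \<le> \<bar>\<alpha> i\<bar>" by simp
      also have "\<dots> \<le> (\<Sum>i\<in>I. \<bar>\<alpha> i\<bar>)" using that finI by (intro member_le_sum) auto
      finally have "real d * \<alpha> i \<le> real d * (1 + (\<Sum>i\<in>I. \<bar>\<alpha> i\<bar>))" by (intro mult_left_mono) auto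
      then have "t * (real d * \<alpha> i) \<le> t * (1 + real d * (1 + (\<Sum>i\<in>I. \<bar>\<alpha> i\<bar>)))"
        using t by (intro mult_left_mono) auto
      then show ?thesis by (simp add: mult_ac)
    qed
    also have "\<dots> = 1" using den by (simp add: t_def)
    finally show ?thesis using dpos by (simp add: field_simps)
  qed
  have sumc: "(\<Sum>i\<in>I. (1 / real d - t * \<alpha> i) / (1 - t)) = 1"
  proof -
    have "(\<Sum>i\<in>I. 1 / real d - t * \<alpha> i) = 1 - t"
      using \<alpha>(1) dpos by (simp add: sum_subtractf sum_distrib_left[symmetric] cardI)
    then show ?thesis using t by (simp add: sum_divide_distrib[symmetric])
  qed
  have yF: "y \<in> F"
    unfolding y_def by (rule convex_sum[OF finI convF sumc]) (use coef t sub in \<open>auto intro: divide_nonneg_pos\<close>)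
  have cF: "c \<in> F"
    unfolding c_def by (rule convex_sum[OF finI convF]) (use cardI dpos sub in auto)
  have cyz: "c = (1 - t) *\<^sub>R y + t *\<^sub>R z"
  proof -
    have "(1 - t) *\<^sub>R y = (\<Sum>i\<in>I. (1 / real d - t * \<alpha> i) *\<^sub>R x i)"
      unfolding y_def scaleR_sum_right using t by (intro sum.cong) auto
    then have "(1 - t) *\<^sub>R y + t *\<^sub>R z = (\<Sum>i\<in>I. (1 / real d - t * \<alpha> i) *\<^sub>R x i + (t * \<alpha> i) *\<^sub>R x i)"
      unfolding \<alpha>(2) by (simp add: scaleR_sum_right sum.distrib)
    also have "\<dots> = c" unfolding c_def by (intro sum.cong) (auto simp: scaleR_add_left[symmetric])
    finally show ?thesis ..
  qed
  show ?thesis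
  proof (cases "y = z")
    case False
    then have "c \<in> open_segment y z"
      unfolding in_segment using t cyz by auto
    then show ?thesis using F yF FP z(1) cF by (auto simp: face_of_def)
  qed (use yF in simp)
qed

lemma face_eq_section:
  assumes F: "F face_of P" and P: "P \<subseteq> vecs d" and sub: "x ` I \<subseteq> F" and aff: "F \<subseteq> affine hull (x ` I)"
  shows "F = {z \<in> P. dotp d z v = 1}"
  using section_in_face[OF F P sub] aff affine_hull_on F by (auto simp: face_of_def)

text \<open>If points of \<open>P\<close> lay strictly on both sides, their segment would cross the
  hyperplane in a point of the face. The face would then contain its endpoints, although it lies in
  the hyperplane.\<close>

lemma one_sided_face:
  assumes F: "F face_of P" and P: "P \<subseteq> vecs d" "convex P" and sub: "x ` I \<subseteq> F" and aff: "F \<subseteq> affine hull (x ` I)"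
  shows "(\<forall>z\<in>P. dotp d z v \<le> 1) \<or> (\<forall>z\<in>P. dotp d z v \<ge> 1)"
proof (rule ccontr)
  assume "\<not> ?thesis"
  then obtain y w where yw: "y \<in> P" "w \<in> P" "dotp d y v > 1" "dotp d w v < 1"
    by (auto simp: not_le)
  define s where "s = (1 - dotp d w v) / (dotp d y v - dotp d w v)"
  have s: "0 < s" "s < 1" using yw by (auto simp: s_def)
  define z where "z = (1 - s) *\<^sub>R w + s *\<^sub>R y"
  have "dotp d z v = dotp d w v + s * (dotp d y v - dotp d w v)"
    unfolding z_def dotp_linear by (simp add: algebra_simps)
  also have "\<dots> = 1" using yw by (simp add: s_def)
  finally have z1: "dotp d z v = 1" .
  have "z \<in> P" unfolding z_def using convexD_alt[OF P(2) yw(2,1), of s] s by simp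
  then have zF: "z \<in> F" using section_in_face[OF F P(1) sub _ z1] by simp
  have "w \<noteq> y" using yw by auto
  then have "z \<in> open_segment w y" unfolding in_segment z_def using s by auto
  then have "y \<in> F" using F zF yw by (auto simp: face_of_def)
  then show False using face_eq_section[OF F P(1) sub aff] yw by auto
qed

text \<open>A weighted mean of two numbers at most 1 equals 1 only if both are 1, which gives the
  face property. The points of the simplex are an affine basis of the section, which gives the
  dimension.\<close>

lemma supporting_section_face:
  assumes P: "P \<subseteq> vecs d" "convex P" and "x ` I \<subseteq> P" and le: "\<forall>z\<in>P. dotp d z v \<le> 1"
  shows "{z \<in> P. dotp d z v = 1} \<in> facets d P"
proof -
  let ?F = "{z \<in> P. dotp d z v = 1}"
  have face: "?F face_of P"
    unfolding face_of_def
  proof (intro conjI ballI impI)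
    show "convex ?F"
      unfolding convex_alt using convexD_alt[OF P(2)] by (auto simp: dotp_linear)
    fix a b z assume ab: "a \<in> P" "b \<in> P" "z \<in> ?F" "z \<in> open_segment a b"
    then obtain u where u: "0 < u" "u < 1" "z = (1 - u) *\<^sub>R a + u *\<^sub>R b"
      unfolding in_segment by blast
    have 1: "(1 - u) * dotp d a v + u * dotp d b v = 1"
      using ab(3) by (simp add: u(3) dotp_linear)
    have a: "(1 - u) * dotp d a v \<le> (1 - u) * 1" using le ab u by (intro mult_left_mono) auto
    have b: "u * dotp d b v \<le> u * 1" using le ab u by (intro mult_left_mono) auto
    have eq: "A = p \<and> B = q" if "A \<le> p" "B \<le> q" "A + B = 1" "p + q = 1" for A B p q :: real
      using that by linarith
    have "(1 - u) * dotp d a v = (1 - u) * 1 \<and> u * dotp d b v = u * 1"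
      by (rule eq[OF a b 1]) simp
    then have "dotp d a v = 1" "dotp d b v = 1" using u by auto
    then show "a \<in> ?F" "b \<in> ?F" using ab by auto
  qed auto
  have "affine hull (x ` I) = affine hull ?F"
  proof
    show "affine hull (x ` I) \<subseteq> affine hull ?F" using assms(3) on by (intro hull_mono) auto
    have "?F \<subseteq> affine hull (x ` I)"
      using affine_combination affine_combination_in_hull P(1) by (smt (verit) mem_Collect_eq subset_iff)
    then show "affine hull ?F \<subseteq> affine hull (x ` I)" by (rule hull_minimal) (rule affine_affine_hull)
  qed
  moreover have "finite (x ` I)" "card (x ` I) = d - 1 + 1"
    using finI cardI dpos by (auto simp: card_image[OF inj])
  ultimately show ?thesis
    using face not_affine_dependent unfolding facets_def has_aff_dim_def by blast
qed

end

text \<open>Differences to a base point reduce the claim to a linearly independent set inside a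
  span. Applied in both directions it compares affine bases, since \<open>has_aff_dim\<close>
  asserts merely that some basis has the given size.\<close>

lemma affine_independent_card_le:
  fixes B C :: "'a::real_vector set"
  assumes "finite B" "finite C" "\<not> affine_dependent B" "B \<noteq> {}" "C \<noteq> {}"
    and sub: "B \<subseteq> affine hull C"
  shows "card B \<le> card C"
proof -
  obtain b c where b: "b \<in> B" and c: "c \<in> C" using assms by blast
  let ?LB = "(\<lambda>x. -b + x) ` (B - {b})" and ?LC = "(\<lambda>x. -c + x) ` (C - {c})"
  have ind: "independent ?LB"
    using affine_dependent_iff_dependent2[OF b] assms(3) by simp
  have hull: "\<exists>s\<in>span ?LC. x = c + s" if "x \<in> B" for x
    using sub that unfolding affine_hull_span2[OF c] by blast
  have "?LB \<subseteq> span ?LC"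
  proof
    fix y assume "y \<in> ?LB"
    then obtain x where x: "x \<in> B" "y = -b + x" by blast
    obtain s t where "s \<in> span ?LC" "x = c + s" "t \<in> span ?LC" "b = c + t"
      using hull[OF x(1)] hull[OF b] by blast
    then have "y = s - t" using x by simp
    then show "y \<in> span ?LC" using \<open>s \<in> _\<close> \<open>t \<in> _\<close> by (simp add: span_diff)
  qed
  then have "card ?LB \<le> card ?LC"
    using independent_span_bound[of ?LC ?LB] ind assms(2) by simp
  moreover have "card ?LB = card B - 1" "card ?LC = card C - 1"
    using b c assms by (auto simp: card_image)
  moreover have "card B > 0" "card C > 0" using assms by (auto simp: card_gt_0_iff)
  ultimately show ?thesis by linarith
qed

text \<open>In a convex combination representing a point of the face, every generator with positive
  weight belongs to the face, because the point lies on an open segment from that generator to the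
  normalised rest. So the point is a combination of generators in the face.\<close>

lemma face_of_polytope_affine_hull:
  fixes S :: "'a::real_vector set"
  assumes "finite S" and F: "F face_of (convex hull S)"
  shows "affine hull F = affine hull (S \<inter> F)"
proof
  show "affine hull (S \<inter> F) \<subseteq> affine hull F" by (rule hull_mono) simp
  have "F \<subseteq> affine hull (S \<inter> F)"
  proof
    fix p assume p: "p \<in> F"
    have FP: "F \<subseteq> convex hull S" using F by (auto simp: face_of_def)
    then obtain u where u: "\<forall>s\<in>S. 0 \<le> u s" "sum u S = 1" "(\<Sum>s\<in>S. u s *\<^sub>R s) = p"
      using p unfolding convex_hull_finite[OF assms(1)] by blast
    have inF: "s \<in> F" if s: "s \<in> S" "u s > 0" for s
    proof (cases "u s = 1")
      case True
      have "sum u (S - {s}) = 0" using u(2) True s assms(1) by (simp add: sum.remove)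
      then have "u t = 0" if "t \<in> S - {s}" for t
        using that u(1) assms(1) by (subst (asm) sum_nonneg_eq_0_iff) auto
      then have "(\<Sum>t\<in>S - {s}. u t *\<^sub>R t) = 0" by (intro sum.neutral) auto
      then have "p = s" using u(3) True s assms(1) by (simp add: sum.remove)
      then show ?thesis using p by simp
    next
      case False
      have us: "sum u (S - {s}) = 1 - u s" using u(2) s assms(1) by (simp add: sum.remove)
      have "sum u (S - {s}) \<ge> 0" using u(1) by (intro sum_nonneg) auto
      then have less: "u s < 1" using us False by linarith
      \<comment> \<open>The rest of the combination, renormalised. Full weight on \<open>s\<close>
        was treated separately, as the divisor would vanish.\<close>
      define q where "q = (\<Sum>t\<in>S - {s}. (u t / (1 - u s)) *\<^sub>R t)"
      have qP: "q \<in> convex hull S"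
        unfolding q_def
      proof (rule convex_sum)
        show "(\<Sum>t\<in>S - {s}. u t / (1 - u s)) = 1"
          using us less by (simp add: sum_divide_distrib[symmetric])
      qed (use assms(1) u(1) less in \<open>auto intro: hull_inc\<close>)
      have "(1 - u s) *\<^sub>R q = (\<Sum>t\<in>S - {s}. u t *\<^sub>R t)"
        unfolding q_def scaleR_sum_right using less by (intro sum.cong) auto
      then have pq: "p = (1 - u s) *\<^sub>R q + u s *\<^sub>R s"
        using u(3) s assms(1) by (simp add: sum.remove add.commute)
      show ?thesis
      proof (cases "q = s")
        case True
        then have "p = s" using pq by (simp add: scaleR_add_left[symmetric])
        then show ?thesis using p by simp
      next
        case False
        then have "p \<in> open_segment q s" unfolding in_segment using pq s less by auto
        moreover have "s \<in> convex hull S" using s by (simp add: hull_inc)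
        ultimately show ?thesis using F p qP unfolding face_of_def by blast
      qed
    qed
    have 0: "u s = 0" if "s \<in> S - S \<inter> F" for s
      using inF[of s] u(1) that by force
    have "(\<Sum>s\<in>S \<inter> F. u s *\<^sub>R s) = p"
      unfolding u(3)[symmetric] using assms(1) 0 by (intro sum.mono_neutral_left) auto
    moreover have "sum u (S \<inter> F) = 1"
      unfolding u(2)[symmetric] using assms(1) 0 by (intro sum.mono_neutral_left) auto
    ultimately show "p \<in> affine hull (S \<inter> F)"
      using affine_hull_finite[of "S \<inter> F"] assms(1) by auto
  qed
  then show "affine hull F \<subseteq> affine hull (S \<inter> F)" by (rule hull_minimal) (rule affine_affine_hull)
qed

text \<open>The normals are a parameter of the locale, later instantiated with the measurable choice
  \<open>sol\<close>.\<close>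

locale general_position =
  fixes d :: nat and N :: "'i set" and z :: "'i \<Rightarrow> nat \<Rightarrow> real" and v :: "'i set \<Rightarrow> nat \<Rightarrow> real"
  assumes finN: "finite N" and d2: "d \<ge> 2" and dN: "d \<le> card N"
    and simplex: "\<And>I. I \<subseteq> N \<Longrightarrow> card I = d \<Longrightarrow> simplex_hyperplane d I z (v I)"
begin

abbreviation "P \<equiv> convex hull (z ` N)"

abbreviation "section I \<equiv> {p \<in> P. dotp d p (v I) = 1}"

lemma P_vecs: "P \<subseteq> vecs d"
proof (rule hull_minimal)
  show "z ` N \<subseteq> vecs d"
  proof (rule image_subsetI)
    fix i assume i: "i \<in> N"
    have "card {i} \<le> d" using d2 by simp
    then obtain I where "{i} \<subseteq> I" "I \<subseteq> N" "card I = d"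
      using exists_subset_between[of "{i}" d N] i dN finN by auto
    then show "z i \<in> vecs d" using simplex_hyperplane.vec[OF simplex] by blast
  qed
qed (rule convex_vecs)

lemma z_in_P: "i \<in> N \<Longrightarrow> z i \<in> P"
  by (simp add: hull_inc)

lemma inj_z: "inj_on z N"
proof (rule inj_onI)
  fix i k assume ik: "i \<in> N" "k \<in> N" "z i = z k"
  have "card {i, k} \<le> d" using d2 card_insert_le_m1[of 2 "{k}" i] by simp
  then obtain I where I: "{i, k} \<subseteq> I" "I \<subseteq> N" "card I = d"
    using exists_subset_between[of "{i, k}" d N] ik dN finN by auto
  then show "i = k" using simplex_hyperplane.inj[OF simplex[OF I(2,3)]] ik by (auto dest: inj_onD)
qed

lemma half_space_hull:
  assumes "\<And>i. i \<in> N \<Longrightarrow> dotp d (z i) w \<le> 1" shows "\<forall>p\<in>P. dotp d p w \<le> 1"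
proof -
  have "P \<subseteq> {p. dotp d p w \<le> 1}"
  proof (rule hull_minimal)
    show "convex {p. dotp d p w \<le> 1}"
      unfolding convex_alt
    proof safe
      fix x y and u :: real assume *: "dotp d x w \<le> 1" "dotp d y w \<le> 1" "0 \<le> u" "u \<le> 1"
      have "(1 - u) * dotp d x w + u * dotp d y w \<le> (1 - u) * 1 + u * 1"
        using * by (intro add_mono mult_left_mono) auto
      then show "dotp d ((1 - u) *\<^sub>R x + u *\<^sub>R y) w \<le> 1" by (simp add: dotp_linear)
    qed
  qed (use assms in auto)
  then show ?thesis by blast
qed

text \<open>A facet has an affine basis among the given points, and comparison of bases shows that
  it has \<open>d\<close> elements. In general position these span a hyperplane, the facet is the
  section by it, and the face property forces the polytope to one side.\<close>

lemma facets_subset: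
  "facets d P \<subseteq> section ` {I. I \<subseteq> N \<and> card I = d \<and>
    ((\<forall>i\<in>N - I. dotp d (z i) (v I) \<le> 1) \<or> (\<forall>i\<in>N - I. dotp d (z i) (v I) \<ge> 1))}"
proof
  fix F assume "F \<in> facets d P"
  then obtain B where F: "F face_of P" and B: "affine hull B = affine hull F" "\<not> affine_dependent B"
    "finite B" "card B = d"
    using d2 by (auto simp: facets_def has_aff_dim_def)
  have hF: "affine hull F = affine hull (z ` N \<inter> F)"
    by (rule face_of_polytope_affine_hull[OF finite_imageI[OF finN] F])
  obtain C where C: "C \<subseteq> z ` N \<inter> F" "\<not> affine_dependent C" "affine hull (z ` N \<inter> F) = affine hull C"
    using affine_basis_exists[of "z ` N \<inter> F"] by blast
  have finC: "finite C" using C(1) finN by (auto intro: finite_subset)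
  have "B \<noteq> {}" using B d2 by auto
  then have "C \<noteq> {}" using B(1) C(3) hF by (metis affine_hull_eq_empty)
  have "B \<subseteq> affine hull C" using B(1) hF C(3) hull_subset[of B affine] by simp
  moreover have "C \<subseteq> affine hull B" using B(1) hF C(3) hull_subset[of C affine] by simp
  ultimately have "card C = d"
    using affine_independent_card_le[OF B(3) finC B(2) \<open>B \<noteq> {}\<close> \<open>C \<noteq> {}\<close>]
      affine_independent_card_le[OF finC B(3) C(2) \<open>C \<noteq> {}\<close> \<open>B \<noteq> {}\<close>] B(4) by simp
  define I where "I = {i \<in> N. z i \<in> C}"
  have zI: "z ` I = C" using C(1) by (auto simp: I_def)
  have IN: "I \<subseteq> N" by (auto simp: I_def)
  have "card I = d"
    using card_image[OF inj_on_subset[OF inj_z IN]] zI \<open>card C = d\<close> by simp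
  interpret S: simplex_hyperplane d I z "v I" by (rule simplex[OF IN \<open>card I = d\<close>])
  have sub: "z ` I \<subseteq> F" using zI C(1) by blast
  have aff: "F \<subseteq> affine hull (z ` I)"
    using hF C(3) zI hull_subset[of F affine] by simp
  have "F = section I" by (rule S.face_eq_section[OF F P_vecs sub aff])
  moreover have "(\<forall>p\<in>P. dotp d p (v I) \<le> 1) \<or> (\<forall>p\<in>P. dotp d p (v I) \<ge> 1)"
    by (rule S.one_sided_face[OF F P_vecs convex_convex_hull sub aff])
  then have "(\<forall>i\<in>N - I. dotp d (z i) (v I) \<le> 1) \<or> (\<forall>i\<in>N - I. dotp d (z i) (v I) \<ge> 1)"
    using z_in_P by blast
  ultimately show "F \<in> section ` {I. I \<subseteq> N \<and> card I = d \<and>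
    ((\<forall>i\<in>N - I. dotp d (z i) (v I) \<le> 1) \<or> (\<forall>i\<in>N - I. dotp d (z i) (v I) \<ge> 1))}"
    using IN \<open>card I = d\<close> by blast
qed

lemma finite_subsets: "finite {I. I \<subseteq> N \<and> card I = d \<and> Q I}"
  by (rule finite_subset[of _ "Pow N"]) (use finN in auto)

lemma finite_facets: "finite (facets d P)"
  by (rule finite_subset[OF facets_subset finite_imageI[OF finite_subsets]])

lemma card_facets_le:
  "card (facets d P) \<le> card {I. I \<subseteq> N \<and> card I = d \<and> (\<forall>i\<in>N - I. dotp d (z i) (v I) \<le> 1)} +
     card {I. I \<subseteq> N \<and> card I = d \<and> (\<forall>i\<in>N - I. dotp d (z i) (v I) \<ge> 1)}"
proof -
  let ?A = "{I. I \<subseteq> N \<and> card I = d \<and> (\<forall>i\<in>N - I. dotp d (z i) (v I) \<le> 1)}"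
  let ?B = "{I. I \<subseteq> N \<and> card I = d \<and> (\<forall>i\<in>N - I. dotp d (z i) (v I) \<ge> 1)}"
  have "card (facets d P) \<le> card (section ` (?A \<union> ?B))"
    by (rule card_mono, rule finite_imageI) (use finite_subsets facets_subset in \<open>auto intro!: finite_UnI\<close>)
  also have "\<dots> \<le> card (?A \<union> ?B)" by (rule card_image_le) (use finite_subsets in auto)
  also have "\<dots> \<le> card ?A + card ?B" by (rule card_Un_le)
  finally show ?thesis .
qed

text \<open>Strict inequalities keep all other points off the hyperplane. The index set can
  therefore be read off the section, and different index sets give different facets.\<close>

lemma card_facets_ge:
  "card {I. I \<subseteq> N \<and> card I = d \<and> (\<forall>i\<in>N - I. dotp d (z i) (v I) < 1)} \<le> card (facets d P)"
proof -
  let ?A = "{I. I \<subseteq> N \<and> card I = d \<and> (\<forall>i\<in>N - I. dotp d (z i) (v I) < 1)}"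
  have on: "dotp d (z i) (v I) = 1 \<longleftrightarrow> i \<in> I" if "I \<in> ?A" "i \<in> N" for I i
  proof -
    interpret S: simplex_hyperplane d I z "v I" by (rule simplex) (use that in auto)
    show ?thesis using that S.on by force
  qed
  have "inj_on section ?A"
  proof (rule inj_onI)
    fix I J assume IJ: "I \<in> ?A" "J \<in> ?A" "section I = section J"
    have "i \<in> I \<longleftrightarrow> i \<in> J" if "i \<in> N" for i
      using on[OF IJ(1) that] on[OF IJ(2) that] IJ(3) z_in_P[OF that] by blast
    then show "I = J" using IJ(1,2) by blast
  qed
  moreover have "section ` ?A \<subseteq> facets d P"
  proof (rule image_subsetI)
    fix I assume I: "I \<in> ?A"
    interpret S: simplex_hyperplane d I z "v I" by (rule simplex) (use I in auto)
    have "dotp d (z i) (v I) \<le> 1" if "i \<in> N" for i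
      using I that S.on by (cases "i \<in> I") (auto intro: less_imp_le)
    then show "section I \<in> facets d P"
      by (intro S.supporting_section_face P_vecs convex_convex_hull half_space_hull)
         (use I z_in_P in auto)
  qed
  ultimately show ?thesis
    using card_inj_on_le[OF _ _ finite_facets] by blast
qed

end

section \<open>The expected number of facets\<close>

text \<open>The row sums of the inverse matrix, written by Cramer's rule: the vector whose product
  with each \<open>x i\<close> is 1. The explicit expression is measurable in the points.\<close>

definition sol :: "nat \<Rightarrow> (nat \<Rightarrow> nat \<Rightarrow> real) \<Rightarrow> nat \<Rightarrow> real"
  where "sol d x = (\<lambda>j. (\<Sum>i<d. rcof d x i j) / rdet d x)"

lemma sol_on:
  assumes "rdet d x \<noteq> 0" "i < d" shows "dotp d (x i) (sol d x) = 1"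
proof -
  let ?B = "\<lambda>i j. rcof d x j i / rdet d x"
  have "dotp d (x i) (sol d x) = dotp d (x i) (mv d ?B (\<lambda>_. 1))"
    by (rule dotp_cong) (simp_all add: sol_def mv_def dotp_def sum_divide_distrib)
  then show ?thesis using mv_inverse[OF is_inv_adjugate[OF assms(1)] assms(2)] by simp
qed

lemma sqn_sol_pos:
  assumes "rdet d x \<noteq> 0" "d > 0" shows "sqn d (sol d x) > 0"
proof (rule ccontr)
  assume "\<not> ?thesis"
  then have "(\<Sum>j<d. (sol d x j)\<^sup>2) = 0" using sqn_nonneg[of d "sol d x"] unfolding sqn_def by linarith
  then have "sol d x j = 0" if "j < d" for j using that by (subst (asm) sum_nonneg_eq_0_iff) auto
  then have "dotp d (x 0) (sol d x) = 0" by (simp add: dotp_def)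
  then show False using sol_on[OF assms] by simp
qed

text \<open>An arbitrary enumeration suffices, because reindexing independent identically
  distributed points preserves their law.\<close>

definition enum :: "nat set \<Rightarrow> nat \<Rightarrow> nat"
  where "enum I = (SOME e. bij_betw e {..<card I} I)"

lemma bij_enum: "finite I \<Longrightarrow> bij_betw (enum I) {..<card I} I"
  unfolding enum_def
  using someI_ex[OF ex_bij_betw_nat_finite[of I]] by (simp only: lessThan_atLeast0)

definition pick :: "nat \<Rightarrow> nat set \<Rightarrow> (nat \<Rightarrow> nat \<Rightarrow> real) \<Rightarrow> nat \<Rightarrow> nat \<Rightarrow> real"
  where "pick d I z = (\<lambda>k\<in>{..<d}. z (enum I k))"

text \<open>The inverse of the square matrix of the points is two-sided: as a left inverse it yields
  expansions in the points, as a right inverse the uniqueness of coefficients.\<close>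

lemma simplex_hyperplane_pick:
  assumes "finite I" "card I = d" "d > 0" "\<And>i. i \<in> I \<Longrightarrow> z i \<in> vecs d" and det: "rdet d (pick d I z) \<noteq> 0"
  shows "simplex_hyperplane d I z (sol d (pick d I z))"
proof
  let ?x = "pick d I z" and ?e = "enum I"
  let ?B = "\<lambda>i j. rcof d ?x j i / rdet d ?x"
  have e: "bij_betw ?e {..<d} I" using bij_enum[OF assms(1)] assms(2) by simp
  have inv: "is_inv d ?x ?B" by (rule is_inv_adjugate[OF det])
  have inv': "is_inv d ?B ?x" by (rule is_inv_sym[OF inv])
  have re: "(\<Sum>i\<in>I. f i) = (\<Sum>k<d. f (?e k))" for f :: "nat \<Rightarrow> real"
    by (rule sum.reindex_bij_betw[OF e, symmetric])
  show "dotp d (z i) (sol d ?x) = 1" if "i \<in> I" for i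
  proof -
    have "i \<in> ?e ` {..<d}" using that by (simp only: bij_betw_imp_surj_on[OF e])
    then obtain k where k: "k < d" "?e k = i" by blast
    then have "?x k = z i" by (auto simp: pick_def)
    then show ?thesis using sol_on[OF det k(1)] by simp
  qed
  show "\<exists>\<alpha>. \<forall>j<d. w j = (\<Sum>i\<in>I. \<alpha> i * z i j)" for w
  proof (intro exI allI impI)
    fix j assume j: "j < d"
    let ?b = "\<lambda>k. \<Sum>l<d. w l * ?B l k"
    have "(\<Sum>i\<in>I. ?b (the_inv_into {..<d} ?e i) * z i j) = (\<Sum>k<d. ?b k * ?x k j)"
      unfolding re
    proof (intro sum.cong refl)
      fix k assume k: "k \<in> {..<d}"
      have "the_inv_into {..<d} ?e (?e k) = k"
        by (rule the_inv_into_f_f[OF bij_betw_imp_inj_on[OF e] k])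
      then show "?b (the_inv_into {..<d} ?e (?e k)) * z (?e k) j = ?b k * ?x k j"
        using k by (simp only: pick_def restrict_apply if_True)
    qed
    also have "\<dots> = (\<Sum>k<d. \<Sum>l<d. w l * (?B l k * ?x k j))"
      by (simp add: sum_distrib_right mult.assoc)
    also have "\<dots> = (\<Sum>l<d. w l * (\<Sum>k<d. ?B l k * ?x k j))"
      by (subst sum.swap) (simp add: sum_distrib_left)
    also have "\<dots> = (\<Sum>l<d. if l = j then w l else 0)"
      using inv' j unfolding is_inv_def by (intro sum.cong refl) auto
    also have "\<dots> = w j" using j by simp
    finally show "w j = (\<Sum>i\<in>I. ?b (the_inv_into {..<d} ?e i) * z i j)" ..
  qed
  show "\<forall>i\<in>I. \<alpha> i = 0" if a: "\<And>j. j < d \<Longrightarrow> (\<Sum>i\<in>I. \<alpha> i * z i j) = 0" for \<alpha>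
  proof
    fix i assume "i \<in> I"
    then have "i \<in> ?e ` {..<d}" by (simp only: bij_betw_imp_surj_on[OF e])
    then obtain k where k: "k < d" "?e k = i" by blast
    have "0 = (\<Sum>j<d. (\<Sum>l<d. \<alpha> (?e l) * ?x l j) * ?B j k)"
    proof -
      have "(\<Sum>l<d. \<alpha> (?e l) * ?x l j) = (\<Sum>l<d. \<alpha> (?e l) * z (?e l) j)" for j
        by (intro sum.cong) (auto simp: pick_def)
      then have "(\<Sum>l<d. \<alpha> (?e l) * ?x l j) = 0" if "j < d" for j
        using a[OF that] unfolding re by (simp only:)
      then show ?thesis by (intro sum.neutral[symmetric]) auto
    qed
    also have "\<dots> = (\<Sum>j<d. \<Sum>l<d. \<alpha> (?e l) * (?x l j * ?B j k))"
      by (simp only: sum_distrib_right mult.assoc)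
    also have "\<dots> = (\<Sum>l<d. \<alpha> (?e l) * (\<Sum>j<d. ?x l j * ?B j k))"
      by (subst sum.swap) (simp only: sum_distrib_left)
    also have "\<dots> = (\<Sum>l<d. if l = k then \<alpha> (?e l) else 0)"
      using inv k unfolding is_inv_def by (intro sum.cong refl) auto
    also have "\<dots> = \<alpha> i" using k by simp
    finally show "\<alpha> i = 0" ..
  qed
qed (use assms in auto)

lemma coord_measurable:
  assumes "i \<in> N" "j < d" shows "(\<lambda>z. z i j) \<in> borel_measurable (sphere_points N d)"
  unfolding measurable_sphere_points by (rule entry_measurable) (use assms in auto)

lemma sol_measurable:
  assumes F: "\<And>i j. i < d \<Longrightarrow> j < d \<Longrightarrow> (\<lambda>\<omega>. F \<omega> i j) \<in> borel_measurable M" and "j < d"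
  shows "(\<lambda>\<omega>. sol d (F \<omega>) j) \<in> borel_measurable M"
  unfolding sol_def
proof (rule borel_measurable_divide)
  show "(\<lambda>\<omega>. \<Sum>i<d. rcof d (F \<omega>) i j) \<in> borel_measurable M"
    by (intro borel_measurable_sum rcof_measurable) (use assms in auto)
  show "(\<lambda>\<omega>. rdet d (F \<omega>)) \<in> borel_measurable M" by (rule rdet_measurable) (rule F)
qed

lemma dotp_sol_measurable:
  assumes F: "\<And>i j. i < d \<Longrightarrow> j < d \<Longrightarrow> (\<lambda>\<omega>. F \<omega> i j) \<in> borel_measurable M"
    and w: "\<And>j. j < d \<Longrightarrow> (\<lambda>\<omega>. w \<omega> j) \<in> borel_measurable M"
  shows "(\<lambda>\<omega>. dotp d (w \<omega>) (sol d (F \<omega>))) \<in> borel_measurable M"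
  unfolding dotp_def
  by (intro borel_measurable_sum borel_measurable_times sol_measurable[OF F]) (use w in auto)

lemma borel_preimage:
  assumes "f \<in> borel_measurable M" "B \<in> sets borel" shows "{x \<in> space M. f x \<in> B} \<in> sets M"
proof -
  have "{x \<in> space M. f x \<in> B} = f -` B \<inter> space M" by auto
  then show ?thesis using measurable_sets[OF assms] by simp
qed

abbreviation side :: "nat \<Rightarrow> nat set \<Rightarrow> nat set \<Rightarrow> real set \<Rightarrow> (nat \<Rightarrow> nat \<Rightarrow> real) \<Rightarrow> bool"
  where "side d N I B z \<equiv> \<forall>j\<in>N - I. dotp d (z j) (sol d (pick d I z)) \<in> B"

text \<open>The set \<open>B\<close> will be \<open>{..1}\<close> or \<open>{1..}\<close>, the two
  closed sides for the upper bound, or \<open>{..<1}\<close>, the open near side for the lower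
  one.\<close>

definition cap_prob :: "nat \<Rightarrow> real set \<Rightarrow> (nat \<Rightarrow> nat \<Rightarrow> real) \<Rightarrow> ennreal"
  where "cap_prob d B x = emeasure (uniform_sphere d) {w \<in> space (uniform_sphere d). dotp d w (sol d x) \<in> B}"

lemma pick_coord_measurable:
  assumes "finite I" "card I = d" "I \<subseteq> N" "k < d" "l < d"
  shows "(\<lambda>z. pick d I z k l) \<in> borel_measurable (sphere_points N d)"
proof -
  have "enum I k \<in> N" using bij_enum[OF assms(1)] assms by (auto simp: bij_betw_def)
  then show ?thesis using coord_measurable[of "enum I k" N l d] assms by (simp add: pick_def)
qed

lemma side_measurable:
  assumes "finite N" "I \<subseteq> N" "card I = d" "B \<in> sets borel"
  shows "{z \<in> space (sphere_points N d). side d N I B z} \<in> sets (sphere_points N d)"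
proof -
  have fI: "finite I" using assms finite_subset by blast
  have m: "(\<lambda>z. dotp d (z j) (sol d (pick d I z))) \<in> borel_measurable (sphere_points N d)" if "j \<in> N - I" for j
    by (rule dotp_sol_measurable) (use that assms fI in \<open>auto intro: pick_coord_measurable coord_measurable\<close>)
  show ?thesis
    by (rule sets.sets_Collect_finite_All, rule borel_preimage[OF m assms(4)]) (use assms in auto)
qed

text \<open>Conditioned on the \<open>d\<close> points indexed by \<open>I\<close>, the others fall
  on the given side independently, each with probability \<open>cap_prob\<close>. The law of the
  \<open>d\<close> points does not depend on \<open>I\<close>, so all index sets contribute
  equally.\<close>

lemma side_probability:
  assumes "finite N" "I \<subseteq> N" "card I = d" "d > 0" "B \<in> sets borel"
  shows "emeasure (sphere_points N d) {z \<in> space (sphere_points N d). side d N I B z} =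
    (\<integral>\<^sup>+x. cap_prob d B x ^ (card N - d) \<partial>sphere_points {..<d} d)"
proof -
  let ?S = "uniform_sphere d" and ?J = "N - I"
  interpret S: prob_space ?S by (rule prob_space_uniform_sphere)
  interpret P: product_sigma_finite "\<lambda>_::nat. ?S" by standard
  have fI: "finite I" "finite ?J" using assms finite_subset by auto
  have e: "bij_betw (enum I) {..<d} I" using bij_enum[OF fI(1)] assms by simp
  have un: "I \<union> ?J = N" using assms by auto
  note B = assms(5)
  let ?f = "\<lambda>z. indicator {z \<in> space (sphere_points N d). side d N I B z} z :: ennreal"
  have fm: "?f \<in> borel_measurable (sphere_points (I \<union> ?J) d)"
    unfolding un using side_measurable[OF assms(1-3) B] by simp
  have wm: "{w \<in> space ?S. dotp d w v \<in> B} \<in> sets ?S" for v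
  proof -
    have "(\<lambda>w. dotp d w v) \<in> borel_measurable ?S" using dotp_measurable_borel by simp
    then show ?thesis using B by (rule borel_preimage)
  qed
  have inner: "(\<integral>\<^sup>+y. ?f (merge I ?J (x, y)) \<partial>sphere_points ?J d) = cap_prob d B (pick d I x) ^ (card N - d)"
    if x: "x \<in> space (sphere_points I d)" for x
  proof -
    have pk: "pick d I (merge I ?J (x, y)) = pick d I x" for y
      unfolding pick_def by (rule restrict_ext) (use e in \<open>auto simp: bij_betw_def merge_def\<close>)
    have "(\<integral>\<^sup>+y. ?f (merge I ?J (x, y)) \<partial>sphere_points ?J d) =
      (\<integral>\<^sup>+y. (\<Prod>j\<in>?J. indicator {w \<in> space ?S. dotp d w (sol d (pick d I x)) \<in> B} (y j)) \<partial>sphere_points ?J d)"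
    proof (rule nn_integral_cong)
      fix y assume y: "y \<in> space (sphere_points ?J d)"
      have sp: "merge I ?J (x, y) \<in> space (sphere_points N d)"
        using x y un by (auto simp: space_PiM PiE_iff merge_def extensional_def)
      have "side d N I B (merge I ?J (x, y)) \<longleftrightarrow> (\<forall>j\<in>?J. y j \<in> {w \<in> space ?S. dotp d w (sol d (pick d I x)) \<in> B})"
        unfolding pk using y by (auto simp: merge_def space_PiM PiE_iff)
      moreover have "(\<Prod>j\<in>?J. indicator C (y j) :: ennreal) = (if \<forall>j\<in>?J. y j \<in> C then 1 else 0)" for C
        using fI(2) by (auto simp: indicator_def intro!: prod_zero)
      ultimately show "?f (merge I ?J (x, y)) =
          (\<Prod>j\<in>?J. indicator {w \<in> space ?S. dotp d w (sol d (pick d I x)) \<in> B} (y j))"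
        using sp fI(2) by (simp add: indicator_def)
    qed
    also have "\<dots> = (\<Prod>j\<in>?J. \<integral>\<^sup>+w. indicator {w \<in> space ?S. dotp d w (sol d (pick d I x)) \<in> B} w \<partial>?S)"
      by (rule P.product_nn_integral_prod) (use fI wm in auto)
    also have "\<dots> = cap_prob d B (pick d I x) ^ (card N - d)"
      unfolding cap_prob_def using wm fI assms by (simp add: card_Diff_subset)
    finally show ?thesis .
  qed
  have cm: "(\<lambda>x. cap_prob d B x ^ (card N - d)) \<in> borel_measurable (sphere_points {..<d} d)"
  proof -
    have "(\<lambda>p. dotp d (snd p) (sol d (fst p))) \<in> borel_measurable (sphere_points {..<d} d \<Otimes>\<^sub>M ?S)"
    proof (rule dotp_sol_measurable)
      show "(\<lambda>p. fst p i j) \<in> borel_measurable (sphere_points {..<d} d \<Otimes>\<^sub>M ?S)" if "i < d" "j < d" for i j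
        by (rule measurable_compose[OF measurable_fst coord_measurable]) (use that in auto)
      show "(\<lambda>p. snd p j) \<in> borel_measurable (sphere_points {..<d} d \<Otimes>\<^sub>M ?S)" if "j < d" for j
        by (rule measurable_compose[OF measurable_snd]) (use that in \<open>auto intro: measurable_component_singleton\<close>)
    qed
    from borel_preimage[OF this B]
    have "(\<lambda>x. emeasure ?S (Pair x -` {p \<in> space (sphere_points {..<d} d \<Otimes>\<^sub>M ?S). dotp d (snd p) (sol d (fst p)) \<in> B}))
        \<in> borel_measurable (sphere_points {..<d} d)"
      by (rule S.measurable_emeasure_Pair)
    moreover have "Pair x -` {p \<in> space (sphere_points {..<d} d \<Otimes>\<^sub>M ?S). dotp d (snd p) (sol d (fst p)) \<in> B} =
        {w \<in> space ?S. dotp d w (sol d x) \<in> B}" if "x \<in> space (sphere_points {..<d} d)" for x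
      using that by (auto simp: space_pair_measure)
    ultimately have "cap_prob d B \<in> borel_measurable (sphere_points {..<d} d)"
      unfolding cap_prob_def by (subst measurable_cong) auto
    then show ?thesis by measurable
  qed
  have re: "distr (sphere_points I d) (sphere_points {..<d} d) (pick d I) = sphere_points {..<d} d"
    unfolding pick_def using distr_PiM_reindex[of I "\<lambda>_. ?S" "enum I" "{..<d}"] e S.prob_space_axioms
    by (auto simp: bij_betw_def)
  have pm: "pick d I \<in> measurable (sphere_points I d) (sphere_points {..<d} d)"
    unfolding pick_def
    by (intro measurable_restrict measurable_component_singleton) (use e in \<open>auto simp: bij_betw_def\<close>)
  have "emeasure (sphere_points N d) {z \<in> space (sphere_points N d). side d N I B z} = (\<integral>\<^sup>+z. ?f z \<partial>sphere_points (I \<union> ?J) d)"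
    unfolding un using side_measurable[OF assms(1-3) B] by simp
  also have "\<dots> = (\<integral>\<^sup>+x. \<integral>\<^sup>+y. ?f (merge I ?J (x, y)) \<partial>sphere_points ?J d \<partial>sphere_points I d)"
    by (rule P.product_nn_integral_fold[OF _ fI fm]) auto
  also have "\<dots> = (\<integral>\<^sup>+x. cap_prob d B (pick d I x) ^ (card N - d) \<partial>sphere_points I d)"
    by (rule nn_integral_cong) (rule inner)
  also have "\<dots> = (\<integral>\<^sup>+x. cap_prob d B x ^ (card N - d) \<partial>distr (sphere_points I d) (sphere_points {..<d} d) (pick d I))"
    using nn_integral_distr[OF pm] cm by simp
  finally show ?thesis unfolding re .
qed

lemma AE_pick_nonsingular:
  assumes "finite N" "I \<subseteq> N" "card I = d"
  shows "AE z in sphere_points N d. rdet d (pick d I z) \<noteq> 0"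
proof -
  interpret S: prob_space "uniform_sphere d" by (rule prob_space_uniform_sphere)
  have fI: "finite I" using assms finite_subset by blast
  have e: "bij_betw (enum I) {..<d} I" using bij_enum[OF fI] assms by simp
  have re: "distr (sphere_points N d) (sphere_points {..<d} d) (pick d I) = sphere_points {..<d} d"
    unfolding pick_def using distr_PiM_reindex[of N "\<lambda>_. uniform_sphere d" "enum I" "{..<d}"] e S.prob_space_axioms assms(2)
    by (auto simp: bij_betw_def)
  have pm: "pick d I \<in> measurable (sphere_points N d) (sphere_points {..<d} d)"
    unfolding pick_def
    by (intro measurable_restrict measurable_component_singleton) (use e assms(2) in \<open>auto simp: bij_betw_def\<close>)
  have rd: "rdet d \<in> borel_measurable (sphere_points {..<d} d)"
    using rdet_measurable_points[of d] by (simp only: measurable_sphere_points)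
  have "{x \<in> space (sphere_points {..<d} d). rdet d x \<noteq> 0} \<in> sets (sphere_points {..<d} d)"
    using rd by measurable
  from AE_distr_iff[OF pm this] show ?thesis
    using AE_sphere_points_nonsingular[of d] by (simp only: re)
qed

lemma of_nat_card_Collect:
  assumes "finite A" shows "of_nat (card {I \<in> A. Q I}) = (\<Sum>I\<in>A. of_bool (Q I) :: ennreal)"
proof -
  have "(\<Sum>I\<in>{I \<in> A. Q I}. 1::ennreal) = (\<Sum>I\<in>A. if Q I then 1 else 0)"
    by (rule sum.inter_filter[OF assms])
  then show ?thesis by (simp add: of_bool_def)
qed

text \<open>Almost surely all choices of \<open>d\<close> points are nonsingular at once, and then
  the facet count lies between sums of indicators over the \<open>n choose d\<close> index sets.
  Measurability is asked of these sums, and \<open>side_probability\<close> gives the expectation of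
  each summand.\<close>

lemma expected_facets_bounds:
  assumes M: "prob_space M" and iid: "iid_uniform_sphere n d M X" and "2 \<le> d" "d \<le> n"
  shows "expected_facets n d M X \<le> of_nat (n choose d) *
      ((\<integral>\<^sup>+x. cap_prob d {..1} x ^ (n - d) \<partial>sphere_points {..<d} d) +
       (\<integral>\<^sup>+x. cap_prob d {1..} x ^ (n - d) \<partial>sphere_points {..<d} d))" (is "_ \<le> ?U")
    and "of_nat (n choose d) * (\<integral>\<^sup>+x. cap_prob d {..<1} x ^ (n - d) \<partial>sphere_points {..<d} d)
      \<le> expected_facets n d M X" (is "?L \<le> _")
proof -
  interpret M: prob_space M by fact
  let ?N = "{1..n}" and ?B = "PiM {..<d} (\<lambda>_. borel) :: (nat \<Rightarrow> real) measure"
  define Z where "Z \<omega> = (\<lambda>i\<in>?N. X i \<omega>)" for \<omega>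
  define A where "A = {I. I \<subseteq> ?N \<and> card I = d}"
  have finA: "finite A" and cardA: "card A = n choose d"
    unfolding A_def using n_subsets[of ?N d] by auto
  have Xm: "X i \<in> measurable M ?B" if "i \<in> ?N" for i
    using iid that unfolding iid_uniform_sphere_def M.indep_vars_def by auto
  have dist: "distr M (PiM ?N (\<lambda>_. ?B)) Z = sphere_points ?N d"
  proof -
    have "distr M (PiM ?N (\<lambda>_. ?B)) Z = PiM ?N (\<lambda>i. distr M ?B (X i))"
      unfolding Z_def using iid \<open>2 \<le> d\<close> \<open>d \<le> n\<close> unfolding iid_uniform_sphere_def
      by (subst M.indep_vars_iff_distr_eq_PiM'[symmetric]) (use Xm in auto)
    also have "\<dots> = sphere_points ?N d"
      using iid unfolding iid_uniform_sphere_def by (intro PiM_cong) auto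
    finally show ?thesis .
  qed
  have sp: "sets (PiM ?N (\<lambda>_. ?B)) = sets (sphere_points ?N d)"
    by (rule sets_PiM_cong) simp_all
  have Zm0: "Z \<in> measurable M (PiM ?N (\<lambda>_. ?B))"
    unfolding Z_def by (rule measurable_restrict) (rule Xm)
  have Zm: "Z \<in> measurable M (sphere_points ?N d)"
    using Zm0 measurable_cong_sets[OF refl sp, of M] by blast
  have dist': "distr M (sphere_points ?N d) Z = sphere_points ?N d"
    using dist distr_cong[OF refl sp, of M Z Z] by simp
  have AEn: "AE \<omega> in M. \<forall>I\<in>A. rdet d (pick d I (Z \<omega>)) \<noteq> 0"
  proof (rule AE_finite_allI[OF finA])
    fix I assume I: "I \<in> A"
    have ms: "{z \<in> space (sphere_points ?N d). rdet d (pick d I z) \<noteq> 0} \<in> sets (sphere_points ?N d)"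
    proof -
      have "(\<lambda>z. rdet d (pick d I z)) \<in> borel_measurable (sphere_points ?N d)"
        by (rule rdet_measurable, rule pick_coord_measurable) (use I in \<open>auto simp: A_def intro: finite_subset\<close>)
      then show ?thesis by measurable
    qed
    have "AE z in sphere_points ?N d. rdet d (pick d I z) \<noteq> 0"
      by (rule AE_pick_nonsingular) (use I in \<open>auto simp: A_def\<close>)
    then show "AE \<omega> in M. rdet d (pick d I (Z \<omega>)) \<noteq> 0"
      using AE_distr_iff[OF Zm ms] by (simp only: dist')
  qed
  have hull: "convex hull ((\<lambda>i. X i \<omega>) ` ?N) = convex hull (Z \<omega> ` ?N)" for \<omega>
  proof -
    have "(\<lambda>i. X i \<omega>) ` ?N = Z \<omega> ` ?N" by (rule image_cong) (auto simp: Z_def)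
    then show ?thesis by simp
  qed
  have gp: "general_position d ?N (Z \<omega>) (\<lambda>I. sol d (pick d I (Z \<omega>)))"
    if \<omega>: "\<omega> \<in> space M" "\<forall>I\<in>A. rdet d (pick d I (Z \<omega>)) \<noteq> 0" for \<omega>
  proof (rule general_position.intro)
    fix I assume I: "I \<subseteq> ?N" "card I = d"
    show "simplex_hyperplane d I (Z \<omega>) (sol d (pick d I (Z \<omega>)))"
    proof (rule simplex_hyperplane_pick)
      show "Z \<omega> i \<in> vecs d" if "i \<in> I" for i
        using measurable_space[OF Xm \<omega>(1), of i] that I by (auto simp: Z_def space_PiM PiE_iff extensional_def)
      show "rdet d (pick d I (Z \<omega>)) \<noteq> 0" using \<omega>(2) I by (auto simp: A_def)
    qed (use I \<open>2 \<le> d\<close> in \<open>auto intro: finite_subset\<close>)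
  qed (use \<open>2 \<le> d\<close> \<open>d \<le> n\<close> in auto)
  have int: "(\<integral>\<^sup>+\<omega>. (\<Sum>I\<in>A. of_bool (side d ?N I B (Z \<omega>))) \<partial>M) =
      of_nat (n choose d) * (\<integral>\<^sup>+x. cap_prob d B x ^ (n - d) \<partial>sphere_points {..<d} d)"
    if B: "B \<in> sets borel" for B
  proof -
    have sm: "{z \<in> space (sphere_points ?N d). side d ?N I B z} \<in> sets (sphere_points ?N d)" if "I \<in> A" for I
      by (rule side_measurable) (use that B in \<open>auto simp: A_def\<close>)
    have ob: "of_bool (side d ?N I B (Z \<omega>)) = (indicator {z \<in> space (sphere_points ?N d). side d ?N I B z} (Z \<omega>) :: ennreal)"
      if "\<omega> \<in> space M" for I \<omega>
      using measurable_space[OF Zm that] by (simp add: indicator_def)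
    have "(\<integral>\<^sup>+\<omega>. (\<Sum>I\<in>A. of_bool (side d ?N I B (Z \<omega>))) \<partial>M) =
       (\<integral>\<^sup>+\<omega>. (\<Sum>I\<in>A. indicator {z \<in> space (sphere_points ?N d). side d ?N I B z} (Z \<omega>)) \<partial>M)"
      by (intro nn_integral_cong sum.cong refl ob)
    also have "\<dots> = (\<Sum>I\<in>A. \<integral>\<^sup>+\<omega>. indicator {z \<in> space (sphere_points ?N d). side d ?N I B z} (Z \<omega>) \<partial>M)"
      by (rule nn_integral_sum) (intro measurable_compose[OF Zm] borel_measurable_indicator sm)
    also have "\<dots> = (\<Sum>I\<in>A. \<integral>\<^sup>+x. cap_prob d B x ^ (n - d) \<partial>sphere_points {..<d} d)"
    proof (rule sum.cong[OF refl])
      fix I assume I: "I \<in> A"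
      have "(\<integral>\<^sup>+\<omega>. indicator {z \<in> space (sphere_points ?N d). side d ?N I B z} (Z \<omega>) \<partial>M) =
         (\<integral>\<^sup>+z. indicator {z \<in> space (sphere_points ?N d). side d ?N I B z} z \<partial>distr M (sphere_points ?N d) Z)"
        by (rule nn_integral_distr[symmetric, OF Zm]) (use sm[OF I] in simp)
      also have "\<dots> = emeasure (sphere_points ?N d) {z \<in> space (sphere_points ?N d). side d ?N I B z}"
        unfolding dist' using sm[OF I] by simp
      also have "\<dots> = (\<integral>\<^sup>+x. cap_prob d B x ^ (card ?N - d) \<partial>sphere_points {..<d} d)"
        by (rule side_probability) (use I B \<open>2 \<le> d\<close> in \<open>auto simp: A_def\<close>)
      finally show "(\<integral>\<^sup>+\<omega>. indicator {z \<in> space (sphere_points ?N d). side d ?N I B z} (Z \<omega>) \<partial>M) =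
        (\<integral>\<^sup>+x. cap_prob d B x ^ (n - d) \<partial>sphere_points {..<d} d)" by simp
    qed
    finally show ?thesis by (simp add: cardA)
  qed
  have bm: "(\<lambda>\<omega>. \<Sum>I\<in>A. of_bool (side d ?N I B (Z \<omega>)) :: ennreal) \<in> borel_measurable M" if B: "B \<in> sets borel" for B
  proof (rule borel_measurable_sum)
    fix I assume I: "I \<in> A"
    have "{z \<in> space (sphere_points ?N d). side d ?N I B z} \<in> sets (sphere_points ?N d)"
      by (rule side_measurable) (use I B in \<open>auto simp: A_def\<close>)
    then have "(\<lambda>\<omega>. indicator {z \<in> space (sphere_points ?N d). side d ?N I B z} (Z \<omega>) :: ennreal) \<in> borel_measurable M"
      by (intro measurable_compose[OF Zm] borel_measurable_indicator)
    moreover have "of_bool (side d ?N I B (Z \<omega>)) = (indicator {z \<in> space (sphere_points ?N d). side d ?N I B z} (Z \<omega>) :: ennreal)"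
      if "\<omega> \<in> space M" for \<omega>
      using measurable_space[OF Zm that] by (simp add: indicator_def)
    ultimately show "(\<lambda>\<omega>. of_bool (side d ?N I B (Z \<omega>)) :: ennreal) \<in> borel_measurable M"
      by (subst measurable_cong) auto
  qed
  have cA: "of_nat (card {I. I \<subseteq> ?N \<and> card I = d \<and> Q I}) = (\<Sum>I\<in>A. of_bool (Q I) :: ennreal)" for Q
  proof -
    have "{I. I \<subseteq> ?N \<and> card I = d \<and> Q I} = {I \<in> A. Q I}" by (auto simp: A_def)
    then show ?thesis using of_nat_card_Collect[OF finA] by simp
  qed
  show "expected_facets n d M X \<le> ?U"
  proof -
    have "expected_facets n d M X \<le> (\<integral>\<^sup>+\<omega>. (\<Sum>I\<in>A. of_bool (side d ?N I {..1} (Z \<omega>))) +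
        (\<Sum>I\<in>A. of_bool (side d ?N I {1..} (Z \<omega>))) \<partial>M)"
      unfolding expected_facets_def
    proof (rule nn_integral_mono_AE, use AEn AE_space in eventually_elim)
      case (elim \<omega>)
      interpret general_position d ?N "Z \<omega>" "\<lambda>I. sol d (pick d I (Z \<omega>))"
        by (rule gp) (use elim in auto)
      have "of_nat (card (facets d (convex hull (Z \<omega> ` ?N)))) \<le>
        (of_nat (card {I. I \<subseteq> ?N \<and> card I = d \<and> side d ?N I {..1} (Z \<omega>)} +
          card {I. I \<subseteq> ?N \<and> card I = d \<and> side d ?N I {1..} (Z \<omega>)}) :: ennreal)"
        using card_facets_le by (intro of_nat_mono) simp
      then show ?case unfolding hull of_nat_add cA .
    qed
    also have "\<dots> = (\<integral>\<^sup>+\<omega>. (\<Sum>I\<in>A. of_bool (side d ?N I {..1} (Z \<omega>))) \<partial>M) +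
        (\<integral>\<^sup>+\<omega>. (\<Sum>I\<in>A. of_bool (side d ?N I {1..} (Z \<omega>))) \<partial>M)"
      by (rule nn_integral_add; rule bm; rule borel_closed; simp)
    also have "\<dots> = ?U"
      by (simp only: int[OF borel_closed[OF closed_atMost]] int[OF borel_closed[OF closed_atLeast]] distrib_left)
    finally show ?thesis .
  qed
  show "?L \<le> expected_facets n d M X"
  proof -
    have "?L = (\<integral>\<^sup>+\<omega>. (\<Sum>I\<in>A. of_bool (side d ?N I {..<1} (Z \<omega>))) \<partial>M)"
      by (rule int[symmetric]) simp
    also have "\<dots> \<le> expected_facets n d M X"
      unfolding expected_facets_def
    proof (rule nn_integral_mono_AE, use AEn AE_space in eventually_elim)
      case (elim \<omega>)
      interpret general_position d ?N "Z \<omega>" "\<lambda>I. sol d (pick d I (Z \<omega>))"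
        by (rule gp) (use elim in auto)
      have "(of_nat (card {I. I \<subseteq> ?N \<and> card I = d \<and> side d ?N I {..<1} (Z \<omega>)}) :: ennreal) \<le>
          of_nat (card (facets d (convex hull (Z \<omega> ` ?N))))"
        using card_facets_ge by (intro of_nat_mono) simp
      then show ?case unfolding hull cA .
    qed
    finally show ?thesis .
  qed
qed

section \<open>The variational problem\<close>

lemma real_distribution_std_normal: "real_distribution std_normal_distribution"
  by (simp add: real_distribution_def real_distribution_axioms_def prob_space_std_normal)

lemma \<Phi>_le_1: "\<Phi> r \<le> 1"
  unfolding \<Phi>_def by (rule real_distribution.cdf_bounded_prob[OF real_distribution_std_normal])

lemma \<Phi>_continuous: "continuous_on UNIV \<Phi>"
proof -
  interpret N: real_distribution std_normal_distribution by (rule real_distribution_std_normal)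
  have "measure std_normal_distribution {x} = 0" for x
  proof -
    have "emeasure std_normal_distribution {x} = (\<integral>\<^sup>+y. ennreal (std_normal_density y) * indicator {x} y \<partial>lborel)"
      by (rule emeasure_density) auto
    also have "\<dots> = 0" by (simp add: nn_integral_0_iff_AE AE_lborel_singleton)
    finally show ?thesis by (simp add: measure_def)
  qed
  then show ?thesis
    unfolding \<Phi>_def[abs_def] continuous_on_eq_continuous_at[OF open_UNIV]
    using N.isCont_cdf by simp
qed

lemma \<Phi>_pos: "\<Phi> r > 0"
proof -
  interpret N: prob_space std_normal_distribution by (rule prob_space_std_normal)
  \<comment> \<open>A lower bound for the density between \<open>r - 1\<close> and \<open>r\<close>,
    where \<open>\<bar>y\<bar> \<le> \<bar>r\<bar> + 1\<close>.\<close>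
  define c where "c = std_normal_density (\<bar>r\<bar> + 1)"
  have c: "c > 0" unfolding c_def by (rule normal_density_pos) simp
  have "ennreal c = (\<integral>\<^sup>+y. ennreal c * indicator {r - 1..r} y \<partial>lborel)"
    by (simp add: nn_integral_cmult)
  also have "\<dots> \<le> (\<integral>\<^sup>+y. ennreal (std_normal_density y) * indicator {..r} y \<partial>lborel)"
  proof (rule nn_integral_mono)
    fix y
    show "ennreal c * indicator {r - 1..r} y \<le> ennreal (std_normal_density y) * indicator {..r} y"
    proof (cases "y \<in> {r - 1..r}")
      case True
      then have "\<bar>y\<bar> \<le> \<bar>r\<bar> + 1" by auto
      then have "y\<^sup>2 \<le> (\<bar>r\<bar> + 1)\<^sup>2" using power_mono[of "\<bar>y\<bar>" "\<bar>r\<bar> + 1" 2] by simp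
      then have "c \<le> std_normal_density y"
        unfolding c_def std_normal_density_def by (intro mult_left_mono) auto
      then show ?thesis using True by (simp add: indicator_def ennreal_leI)
    qed simp
  qed
  also have "\<dots> = emeasure std_normal_distribution {..r}"
    by (rule emeasure_density[symmetric]) auto
  also have "\<dots> = ennreal (\<Phi> r)"
    by (simp add: \<Phi>_def cdf_def N.emeasure_eq_measure)
  finally have "c \<le> \<Phi> r" using c by (simp add: ennreal_le_iff2)
  then show ?thesis using c by simp
qed

text \<open>The two closed half-lines bounded by 0 have the same Gaussian measure, by
  \<open>gauss_linear_cdf\<close> with the coefficients 1 and -1, and together they cover the
  line.\<close>

lemma \<Phi>_0_ge_half: "\<Phi> 0 \<ge> 1 / 2"
proof -
  interpret G: prob_space "gauss 1" by (rule prob_space_gauss)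
  let ?A = "\<lambda>s. {x \<in> space (gauss 1). dotp 1 x (\<lambda>_. s) \<le> 0}"
  have "measure (gauss 1) (?A 1) = \<Phi> 0"
    by (subst gauss_linear_cdf) (simp_all add: sqn_def)
  moreover have "measure (gauss 1) (?A (-1)) = \<Phi> 0"
    by (subst gauss_linear_cdf) (simp_all add: sqn_def)
  moreover have "?A 1 \<union> ?A (-1) = space (gauss 1)" by (auto simp: dotp_def)
  moreover have "measure (gauss 1) (?A 1 \<union> ?A (-1)) \<le> measure (gauss 1) (?A 1) + measure (gauss 1) (?A (-1))"
    by (rule measure_Un_le) measurable
  ultimately show ?thesis using G.prob_space by simp
qed

text \<open>Shift the tail integral to 0 and use
  \<open>(r + y)\<^sup>2 \<ge> r\<^sup>2 + y\<^sup>2\<close> for nonnegative \<open>r\<close> and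
  \<open>y\<close>.\<close>

lemma \<Phi>_tail:
  assumes "r \<ge> 0" shows "1 - \<Phi> r \<le> exp (- r\<^sup>2 / 2) * (1 - \<Phi> 0)"
proof -
  interpret N: prob_space std_normal_distribution by (rule prob_space_std_normal)
  have tail: "ennreal (1 - \<Phi> t) = (\<integral>\<^sup>+y. ennreal (std_normal_density y) * indicator {t<..} y \<partial>lborel)" for t
  proof -
    have "{t<..} = space std_normal_distribution - {..t}" by auto
    then have "measure std_normal_distribution {t<..} = 1 - \<Phi> t"
      using N.prob_compl[of "{..t}"] by (simp add: \<Phi>_def cdf_def)
    then have "ennreal (1 - \<Phi> t) = emeasure std_normal_distribution {t<..}"
      by (simp add: N.emeasure_eq_measure)
    also have "\<dots> = (\<integral>\<^sup>+y. ennreal (std_normal_density y) * indicator {t<..} y \<partial>lborel)"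
      by (rule emeasure_density) auto
    finally show ?thesis .
  qed
  have "ennreal (1 - \<Phi> r) = ennreal \<bar>1\<bar> * (\<integral>\<^sup>+y. ennreal (std_normal_density (r + 1 * y)) * indicator {r<..} (r + 1 * y) \<partial>lborel)"
    unfolding tail by (rule nn_integral_real_affine) auto
  also have "\<dots> \<le> (\<integral>\<^sup>+y. ennreal (exp (- r\<^sup>2 / 2)) * (ennreal (std_normal_density y) * indicator {0<..} y) \<partial>lborel)"
    unfolding abs_one ennreal_1 mult_1_left
  proof (rule nn_integral_mono)
    fix y
    show "ennreal (std_normal_density (r + y)) * indicator {r<..} (r + y) \<le>
        ennreal (exp (- r\<^sup>2 / 2)) * (ennreal (std_normal_density y) * indicator {0<..} y)"
    proof (cases "y > 0")
      case True
      have "- (r + y)\<^sup>2 / 2 \<le> - r\<^sup>2 / 2 + - y\<^sup>2 / 2"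
        using assms True by (simp add: power2_sum)
      then have "exp (- (r + y)\<^sup>2 / 2) \<le> exp (- r\<^sup>2 / 2) * exp (- y\<^sup>2 / 2)"
        unfolding mult_exp_exp by simp
      then have "std_normal_density (r + y) \<le> exp (- r\<^sup>2 / 2) * std_normal_density y"
        unfolding std_normal_density_def by (simp add: divide_right_mono)
      then show ?thesis using True by (simp add: ennreal_mult[symmetric] ennreal_leI)
    qed simp
  qed
  also have "\<dots> = ennreal (exp (- r\<^sup>2 / 2)) * ennreal (1 - \<Phi> 0)"
    unfolding tail by (rule nn_integral_cmult) auto
  also have "\<dots> = ennreal (exp (- r\<^sup>2 / 2) * (1 - \<Phi> 0))"
    using \<Phi>_le_1[of 0] by (simp add: ennreal_mult)
  finally show ?thesis using \<Phi>_le_1[of 0] by (simp add: ennreal_le_iff)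
qed

text \<open>Continuity on a compact interval, outside of which the quadratic term alone brings
  \<open>g\<close> down to at most its value at 0. As \<open>\<Phi>\<close> increases, a maximiser
  may be replaced by its absolute value; a nonnegative one is wanted because \<open>r\<close> will
  be a rescaled distance.\<close>

lemma g_attains_max:
  assumes "\<rho> > 0"
  obtains r where "r \<ge> 0" "\<And>s. g \<rho> s \<le> g \<rho> r"
proof -
  define K where "K = - \<rho> * ln (\<Phi> 0)"
  have K: "K \<ge> 0" using assms \<Phi>_le_1[of 0] \<Phi>_pos[of 0] by (simp add: K_def mult_nonneg_nonpos ln_le_zero_iff)
  \<comment> \<open>Chosen so that \<open>R\<^sup>2 / 2 \<ge> K\<close>, where \<open>K\<close> is
    the size of the logarithmic term at 0; the summand 1 keeps the interval from
    degenerating.\<close>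
  define R where "R = sqrt (2 * K) + 1"
  have R: "R > 0" using K by (simp add: R_def add_nonneg_pos)
  have cont: "continuous_on {-R..R} (g \<rho>)"
    unfolding g_def[abs_def] using \<Phi>_pos
    by (intro continuous_intros continuous_on_subset[OF \<Phi>_continuous]) (auto simp: less_imp_neq[symmetric])
  obtain r where r: "r \<in> {-R..R}" "\<And>s. s \<in> {-R..R} \<Longrightarrow> g \<rho> s \<le> g \<rho> r"
    using continuous_attains_sup[OF compact_Icc _ cont] R by auto
  have max: "g \<rho> s \<le> g \<rho> r" for s
  proof (cases "s \<in> {-R..R}")
    case False
    then have "\<bar>s\<bar> \<ge> R" by auto
    then have "s\<^sup>2 \<ge> R\<^sup>2" using R by (metis abs_ge_zero less_imp_le power2_abs power_mono)
    moreover have "R\<^sup>2 \<ge> 2 * K"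
    proof -
      have "(sqrt (2 * K))\<^sup>2 \<le> R\<^sup>2" unfolding R_def using K by (intro power_mono) auto
      then show ?thesis using K by simp
    qed
    moreover have "\<rho> * ln (\<Phi> s) \<le> 0"
      using assms \<Phi>_le_1[of s] \<Phi>_pos[of s] by (simp add: mult_nonneg_nonpos ln_le_zero_iff)
    ultimately have "g \<rho> s \<le> g \<rho> 0" unfolding g_def K_def by simp
    also have "g \<rho> 0 \<le> g \<rho> r" using r(2)[of 0] R by simp
    finally show ?thesis .
  qed (use r in auto)
  have "g \<rho> r \<le> g \<rho> \<bar>r\<bar>"
  proof -
    have "ln (\<Phi> r) \<le> ln (\<Phi> \<bar>r\<bar>)" using \<Phi>_mono[of r "\<bar>r\<bar>"] \<Phi>_pos[of r] by (intro ln_mono) auto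
    then show ?thesis unfolding g_def using assms by simp
  qed
  then have "\<And>s. g \<rho> s \<le> g \<rho> \<bar>r\<bar>" using max order_trans by blast
  then show ?thesis using that[of "\<bar>r\<bar>"] by simp
qed

text \<open>At the quantile \<open>\<Phi> r = \<rho> / (\<rho> + 1)\<close> the logarithms combine to \<open>ln (\<rho> + 1) - r\<^sup>2 / 2\<close>, which the
  tail bound for \<open>\<Phi>\<close> makes positive.\<close>

lemma g_positive_somewhere:
  assumes "\<rho> > 0"
  shows "\<exists>r. g \<rho> r > 0"
proof -
  define q where "q = \<rho> / (\<rho> + 1)"
  have q: "0 < q" "q < 1" using assms by (auto simp: q_def)
  have g_eq: "g \<rho> r = ln (\<rho> + 1) + \<rho> * (ln (\<Phi> r) - ln q) - r\<^sup>2 / 2" for r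
    using assms by (simp add: g_def q_def ln_div algebra_simps)
  show ?thesis
  \<comment> \<open>For \<open>q\<close> at most \<open>\<Phi> 0\<close> the quantile may be
    negative and out of reach of the tail bound, but then \<open>g \<rho> 0\<close> is already at
    least \<open>ln (\<rho> + 1)\<close>.\<close>
  proof (cases "\<Phi> 0 \<ge> q")
    case True
    then have "ln (\<Phi> 0) \<ge> ln q" using q by (intro ln_mono) auto
    then have "\<rho> * (ln (\<Phi> 0) - ln q) \<ge> 0" using assms by simp
    moreover have "ln (\<rho> + 1) > 0" using assms by (intro ln_gt_zero) simp
    ultimately show ?thesis by (intro exI[of _ 0]) (simp add: g_eq)
  next
    case False
    interpret N: real_distribution std_normal_distribution by (rule real_distribution_std_normal)
    have "(\<Phi> \<longlongrightarrow> 1) at_top" using N.cdf_lim_at_top_prob by (simp add: \<Phi>_def[abs_def])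
    from order_tendstoD(1)[OF this q(2)] eventually_ge_at_top[of 0]
    have "\<forall>\<^sub>F r in at_top. q < \<Phi> r \<and> 0 \<le> r" by (rule eventually_conj)
    then obtain b where b: "q < \<Phi> b" "0 \<le> b" using eventually_happens by force
    obtain r where r: "0 \<le> r" "r \<le> b" "\<Phi> r = q"
      using IVT'[of \<Phi> 0 q b] False b continuous_on_subset[OF \<Phi>_continuous] by auto
    have "1 / (\<rho> + 1) = 1 - \<Phi> r" using assms by (simp add: r(3) q_def field_simps)
    also have "\<dots> \<le> exp (- r\<^sup>2 / 2) * (1 - \<Phi> 0)" by (rule \<Phi>_tail[OF r(1)])
    also have "\<dots> < exp (- r\<^sup>2 / 2) * 1" using \<Phi>_pos[of 0] by (intro mult_strict_left_mono) auto
    finally have "ln (1 / (\<rho> + 1)) < ln (exp (- r\<^sup>2 / 2))" using assms by (subst ln_less_cancel_iff) auto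
    then have "g \<rho> r > 0" using assms by (simp add: g_eq r(3) ln_div)
    then show ?thesis by blast
  qed
qed

text \<open>Stirling's formula to the accuracy needed. Both inductions rest on
  \<open>1 / (n + 1) \<le> ln (n + 1) - ln n \<le> 1 / n\<close>.\<close>

lemma ln_fact_bounds:
  assumes "n \<ge> 1"
  shows "real n * ln (real n) - real n \<le> ln (fact n)"
    and "ln (fact n) \<le> real n * ln (real n) - real n + ln (real n) + 1"
proof -
  have "real n * ln (real n) - real n \<le> ln (fact n) \<and> ln (fact n) \<le> real n * ln (real n) - real n + ln (real n) + 1"
    using assms
  proof (induction n rule: dec_induct)
    case (step n)
    have n: "real n > 0" using step by simp
    let ?m = "real n + 1"
    have lf: "ln (fact (Suc n)) = ln ?m + ln (fact n)"
      by (simp add: ln_mult add.commute)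
    have up: "ln ?m - ln (real n) \<le> 1 / real n"
    proof -
      have "ln (?m / real n) \<le> ?m / real n - 1" using n by (intro ln_le_minus_one) simp
      then show ?thesis using n by (simp add: ln_div field_simps)
    qed
    have lo: "ln ?m - ln (real n) \<ge> 1 / ?m"
    proof -
      have "ln (real n / ?m) \<le> real n / ?m - 1" using n by (intro ln_le_minus_one) simp
      also have "real n / ?m - 1 = - 1 / ?m" using n by (simp add: field_simps)
      finally show ?thesis using n by (simp add: ln_div)
    qed
    have u: "real n * (ln ?m - ln (real n)) \<le> 1" using up n by (simp add: field_simps)
    have l: "?m * (ln ?m - ln (real n)) \<ge> 1" using lo n by (simp add: field_simps)
    have "real (Suc n) * ln (real (Suc n)) - real (Suc n) \<le> ln (fact (Suc n))"
      using u step.IH unfolding lf by (simp add: algebra_simps)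
    moreover have "ln (fact (Suc n)) \<le> real (Suc n) * ln (real (Suc n)) - real (Suc n) + ln (real (Suc n)) + 1"
      using l step.IH unfolding lf by (simp add: algebra_simps)
    ultimately show ?case by blast
  qed simp
  then show "real n * ln (real n) - real n \<le> ln (fact n)"
    "ln (fact n) \<le> real n * ln (real n) - real n + ln (real n) + 1" by auto
qed

text \<open>The linear terms of Stirling's formula cancel because \<open>n = d + k\<close>. The
  error bound is set by the two factorials in the denominator, each contributing at most
  \<open>ln n + 1\<close>.\<close>

lemma ln_choose_bounds:
  assumes "1 \<le> d" "d < n"
  defines "r \<equiv> (real n - real d) / real d"
  shows "\<bar>ln (real (n choose d)) - real d * ((r + 1) * ln (r + 1) - r * ln r)\<bar> \<le> 2 * ln (real n) + 2"
proof -
  define k where "k = n - d"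
  have k: "k \<ge> 1" "n = d + k" "real n = real d + real k" using assms by (auto simp: k_def)
  have pos: "real d > 0" "real k > 0" "real n > 0" using assms k by auto
  have r: "r = real k / real d" "r + 1 = real n / real d" using k pos by (auto simp: r_def field_simps)
  have main: "real d * ((r + 1) * ln (r + 1) - r * ln r) =
      real n * ln (real n) - real d * ln (real d) - real k * ln (real k)"
  proof -
    have "real d * ((r + 1) * ln (r + 1) - r * ln r) = real n * ln (real n / real d) - real k * ln (real k / real d)"
      unfolding r(2) unfolding r(1) using pos by (simp add: right_diff_distrib)
    also have "\<dots> = real n * (ln (real n) - ln (real d)) - real k * (ln (real k) - ln (real d))"
      using pos by (simp add: ln_div)
    finally show ?thesis using k(3) by (simp add: algebra_simps)
  qed
  have "real (n choose d) = fact n / (fact d * fact k)"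
    unfolding k_def using assms by (intro binomial_fact) simp
  then have ch: "ln (real (n choose d)) = ln (fact n) - ln (fact d) - ln (fact k)"
    by (simp add: ln_div ln_mult)
  have le: "ln (real d) \<le> ln (real n)" "ln (real k) \<le> ln (real n)" "0 \<le> ln (real n)" using pos k assms by auto
  show ?thesis
    unfolding main ch
    unfolding abs_le_iff using ln_fact_bounds[of n] ln_fact_bounds[of d] ln_fact_bounds[of k] k(1,3) assms(1,2) le
    by linarith
qed

section \<open>Nonasymptotic bounds\<close>

lemma cap_prob_eq_measure:
  "cap_prob d B x = ennreal (measure (uniform_sphere d) {w \<in> space (uniform_sphere d). dotp d w (sol d x) \<in> B})"
proof -
  interpret S: prob_space "uniform_sphere d" by (rule prob_space_uniform_sphere)
  show ?thesis unfolding cap_prob_def by (rule S.emeasure_eq_measure)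
qed

lemma cap_prob_le_one: "cap_prob d B x \<le> 1"
proof -
  interpret S: prob_space "uniform_sphere d" by (rule prob_space_uniform_sphere)
  show ?thesis unfolding cap_prob_def by (rule S.measure_le_1)
qed

text \<open>The minimum with 1 keeps the bound among the test functions of
  \<open>plane_dist_law\<close>, which take values between 0 and 1. Both closed sides share
  it.\<close>

lemma cap_prob_upper:
  assumes "d > 0" "c > 1" "rdet d x \<noteq> 0" "B = {..1} \<or> B = {1..}"
  shows "cap_prob d B x \<le> ennreal (min 1 (\<Phi> (sqrt (c * real d) * plane_dist d x) + norm_tail d c))"
proof -
  have h: "plane_dist d x = 1 / sqrt (sqn d (sol d x))"
    by (rule plane_dist_eq[OF assms(3) sol_on[OF assms(3)]])
  have p: "sqn d (sol d x) > 0" by (rule sqn_sol_pos[OF assms(3,1)])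
  have "measure (uniform_sphere d) {w \<in> space (uniform_sphere d). dotp d w (sol d x) \<in> B} \<le>
     \<Phi> (sqrt (c * real d) * plane_dist d x) + norm_tail d c"
    using assms(4) cap_le[OF assms(1) p assms(2)] cap_ge_opposite[OF assms(1) p assms(2)]
    by (auto simp: h)
  then have 1: "cap_prob d B x \<le> ennreal (\<Phi> (sqrt (c * real d) * plane_dist d x) + norm_tail d c)"
    unfolding cap_prob_eq_measure by (rule ennreal_leI)
  show ?thesis using 1 cap_prob_le_one[of d B x] by (simp add: min_def)
qed

lemma cap_prob_lower:
  assumes "d > 0" "0 < c" "c < 1" "rdet d x \<noteq> 0"
  shows "ennreal (max 0 (\<Phi> (sqrt (c * real d) * plane_dist d x) - norm_tail d c)) \<le> cap_prob d {..<1} x"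
proof -
  have h: "plane_dist d x = 1 / sqrt (sqn d (sol d x))"
    by (rule plane_dist_eq[OF assms(4) sol_on[OF assms(4)]])
  have p: "sqn d (sol d x) > 0" by (rule sqn_sol_pos[OF assms(4,1)])
  have "max 0 (\<Phi> (sqrt (c * real d) * plane_dist d x) - norm_tail d c) \<le>
     measure (uniform_sphere d) {w \<in> space (uniform_sphere d). dotp d w (sol d x) \<in> {..<1}}"
    using cap_less_ge[OF assms(1) p assms(2,3)] by (auto simp: h)
  then show ?thesis
    unfolding cap_prob_eq_measure by (rule ennreal_leI)
qed

lemma plane_dist_nonneg: "rdet d x \<noteq> 0 \<Longrightarrow> plane_dist d x \<ge> 0"
proof -
  assume x: "rdet d x \<noteq> 0"
  have h: "plane_dist d x = 1 / sqrt (sqn d (sol d x))"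
    by (rule plane_dist_eq[OF x sol_on[OF x]])
  show ?thesis using sqn_nonneg[of d "sol d x"] by (simp add: h)
qed

text \<open>Keeps the expected number of facets positive in every dimension. With
  \<open>c = 1 / 300\<close> the product \<open>c * exp (1 - c)\<close> is at most
  \<open>3 / 300\<close>, so the error is at most \<open>1 / 10\<close>, and
  \<open>1 / 2 - 1 / 10 = 2 / 5\<close>.\<close>

lemma cap_prob_bounded_below:
  assumes "d > 0" "rdet d x \<noteq> 0"
  shows "ennreal (2 / 5) \<le> cap_prob d {..<1} x"
proof -
  let ?c = "1 / 300 :: real"
  have "sqrt (?c * exp (1 - ?c)) \<le> sqrt (1 / 100)"
  proof (rule real_sqrt_le_mono)
    have "exp (1 - ?c) \<le> exp 1" by simp
    also have "\<dots> \<le> 3" by (rule exp_le)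
    finally show "?c * exp (1 - ?c) \<le> 1 / 100" by simp
  qed
  also have "\<dots> = 1 / 10" by (simp add: real_sqrt_divide)
  finally have q: "sqrt (?c * exp (1 - ?c)) \<le> 1 / 10" .
  have "norm_tail d ?c \<le> (1 / 10) ^ d" unfolding norm_tail_def using q by (intro power_mono) auto
  also have "\<dots> \<le> (1 / 10) ^ 1" using assms(1) by (intro power_decreasing) auto
  finally have t: "norm_tail d ?c \<le> 1 / 10" by simp
  have "\<Phi> 0 \<le> \<Phi> (sqrt (?c * real d) * plane_dist d x)"
    using plane_dist_nonneg[OF assms(2)] by (intro \<Phi>_mono mult_nonneg_nonneg) auto
  then have "2 / 5 \<le> max 0 (\<Phi> (sqrt (?c * real d) * plane_dist d x) - norm_tail d ?c)"
    using \<Phi>_0_ge_half t by linarith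
  then have "ennreal (2 / 5) \<le> ennreal (max 0 (\<Phi> (sqrt (?c * real d) * plane_dist d x) - norm_tail d ?c))"
    by (rule ennreal_leI)
  also have "\<dots> \<le> cap_prob d {..<1} x"
    by (rule cap_prob_lower[OF assms(1) _ _ assms(2)]) auto
  finally show ?thesis .
qed

text \<open>The final identity takes the logarithm of the expectation for every
  \<open>n \<ge> 3\<close>, including \<open>d = 2\<close>, which the law of the distance above does
  not cover. Crude bounds on the cap probabilities are enough.\<close>

lemma expected_facets_pos_finite:
  assumes "prob_space M" "iid_uniform_sphere n d M X" "2 \<le> d" "d \<le> n"
  shows "0 < expected_facets n d M X" "expected_facets n d M X < \<infinity>"
proof -
  interpret SP: prob_space "sphere_points {..<d} d"
    by (rule prob_space_PiM) (rule prob_space_uniform_sphere)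
  have "(\<integral>\<^sup>+x. cap_prob d B x ^ (n - d) \<partial>sphere_points {..<d} d) \<le> (\<integral>\<^sup>+x. 1 \<partial>sphere_points {..<d} d)" for B
    using power_mono_ennreal[OF cap_prob_le_one, of d B _ "n - d"] assms by (intro nn_integral_mono) simp
  then have 1: "(\<integral>\<^sup>+x. cap_prob d B x ^ (n - d) \<partial>sphere_points {..<d} d) \<le> 1" for B
    by (simp add: SP.emeasure_space_1)
  have "expected_facets n d M X \<le> of_nat (n choose d) * (1 + 1)"
    by (rule order_trans[OF expected_facets_bounds(1)[OF assms]]) (intro mult_left_mono add_mono 1, simp)
  also have "\<dots> < \<infinity>" by (simp add: ennreal_mult_less_top of_nat_less_top)
  finally show "expected_facets n d M X < \<infinity>" .
  have "ennreal ((2 / 5) ^ (n - d)) = (\<integral>\<^sup>+x. ennreal (2 / 5) ^ (n - d) \<partial>sphere_points {..<d} d)"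
    by (simp add: SP.emeasure_space_1 ennreal_power)
  also have "\<dots> \<le> (\<integral>\<^sup>+x. cap_prob d {..<1} x ^ (n - d) \<partial>sphere_points {..<d} d)"
  proof (rule nn_integral_mono_AE)
    show "AE x in sphere_points {..<d} d. ennreal (2 / 5) ^ (n - d) \<le> cap_prob d {..<1} x ^ (n - d)"
      using AE_sphere_points_nonsingular
      by eventually_elim (intro power_mono_ennreal cap_prob_bounded_below, use assms in auto)
  qed
  finally have "of_nat (n choose d) * ennreal ((2 / 5) ^ (n - d)) \<le> expected_facets n d M X"
    using expected_facets_bounds(2)[OF assms] by (meson mult_left_mono order_trans zero_le)
  moreover have "0 < of_nat (n choose d) * ennreal ((2 / 5) ^ (n - d))"
    using assms by (auto simp: ennreal_zero_less_mult_iff)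
  ultimately show "0 < expected_facets n d M X" by (rule less_le_trans[rotated])
qed

text \<open>Equal to \<open>(d + 1) * (d - 1) / 2 - d\<close>, the exponent of
  \<open>plane_dist_law_beta\<close> at the limiting value \<open>\<beta> = -1\<close>.\<close>

definition dist_exponent :: "nat \<Rightarrow> real"
  where "dist_exponent d = ((real d)\<^sup>2 - 2 * real d - 1) / 2"

lemma plane_dist_law_dist_exponent:
  fixes \<psi> :: "real \<Rightarrow> real"
  assumes "d \<ge> 3" "continuous_on UNIV \<psi>" "\<And>r. 0 \<le> \<psi> r" "\<And>r. \<psi> r \<le> 1"
  shows "(\<integral>\<^sup>+x. ennreal (\<psi> (plane_dist d x)) \<partial>sphere_points {..<d} d) * (\<integral>\<^sup>+\<eta>. beta_weight (dist_exponent d) (\<eta>\<^sup>2) \<partial>lborel) =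
    (\<integral>\<^sup>+\<eta>. ennreal (\<psi> \<bar>\<eta>\<bar>) * beta_weight (dist_exponent d) (\<eta>\<^sup>2) \<partial>lborel)"
proof -
  obtain e where e: "d = Suc e" using assms(1) by (cases d) auto
  have "dist_exponent d = real ((e + 2) * e) / 2 - real (Suc e)"
    by (simp add: dist_exponent_def e power2_eq_square field_simps)
  then show ?thesis
    using plane_dist_law[of e \<psi>] assms e by simp
qed

lemma dist_exponent_bounds:
  assumes "d \<ge> 3"
  shows "dist_exponent d \<ge> 0" "dist_exponent d \<le> (real d)\<^sup>2 / 2" "real d * (real d - 3) / 2 \<le> dist_exponent d"
proof -
  have d: "real d \<ge> 3" using assms by simp
  then have dd: "real d * real d \<ge> 3 * real d" by (intro mult_right_mono) auto
  have "real d * real d - 2 * real d - 1 \<ge> 0" using d dd by linarith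
  then show "dist_exponent d \<ge> 0" by (simp add: dist_exponent_def power2_eq_square)
  show "dist_exponent d \<le> (real d)\<^sup>2 / 2" using d by (simp add: dist_exponent_def)
  show "real d * (real d - 3) / 2 \<le> dist_exponent d" using d unfolding dist_exponent_def power2_eq_square by (simp add: field_simps)
qed

text \<open>On the interval of half-width \<open>1 / d\<close> the weight is at least
  \<open>exp (- 1)\<close>, since the exponent is at most \<open>d\<^sup>2 / 2\<close> and
  \<open>ln (1 - x) \<ge> - 2 * x\<close> for \<open>x = \<eta>\<^sup>2\<close> there. A loss
  polynomial in \<open>d\<close> is invisible on the exponential scale.\<close>

lemma beta_weight_integral_ge:
  assumes "d \<ge> 3"
  shows "ennreal (2 / real d * exp (- 1)) \<le> (\<integral>\<^sup>+\<eta>. beta_weight (dist_exponent d) (\<eta>\<^sup>2) \<partial>lborel)"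
proof -
  have d: "real d \<ge> 3" using assms by simp
  let ?I = "{- (1 / real d)..1 / real d}"
  have "ennreal (2 / real d * exp (- 1)) = (\<integral>\<^sup>+\<eta>. ennreal (exp (- 1)) * indicator ?I \<eta> \<partial>lborel)"
    using d by (subst nn_integral_cmult) (auto simp: ennreal_mult[symmetric] mult.commute)
  also have "\<dots> \<le> (\<integral>\<^sup>+\<eta>. beta_weight (dist_exponent d) (\<eta>\<^sup>2) \<partial>lborel)"
  proof (rule nn_integral_mono)
    fix \<eta> :: real
    show "ennreal (exp (- 1)) * indicator ?I \<eta> \<le> beta_weight (dist_exponent d) (\<eta>\<^sup>2)"
    proof (cases "\<eta> \<in> ?I")
      case True
      then have a: "\<bar>\<eta>\<bar> \<le> 1 / real d" by auto
      then have sq: "\<eta>\<^sup>2 \<le> 1 / (real d)\<^sup>2" using power_mono[OF a, of 2] by (simp add: power_divide)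
      have "(real d)\<^sup>2 \<ge> 3\<^sup>2" using d by (intro power_mono) auto
      then have half: "1 / (real d)\<^sup>2 \<le> 1 / 2" using d by (intro divide_left_mono) auto
      have x: "\<eta>\<^sup>2 \<le> 1 / 2" using sq half by linarith
      have "ln (1 - \<eta>\<^sup>2) \<ge> - \<eta>\<^sup>2 - 2 * (\<eta>\<^sup>2)\<^sup>2" using x by (intro ln_one_minus_pos_lower_bound) auto
      moreover have "2 * (\<eta>\<^sup>2)\<^sup>2 \<le> \<eta>\<^sup>2"
        using mult_right_mono[OF x, of "\<eta>\<^sup>2"] by (simp add: power2_eq_square)
      ultimately have "ln (1 - \<eta>\<^sup>2) \<ge> - (2 * \<eta>\<^sup>2)" by linarith
      then have "dist_exponent d * ln (1 - \<eta>\<^sup>2) \<ge> dist_exponent d * - (2 * \<eta>\<^sup>2)"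
        using dist_exponent_bounds(1)[OF assms] by (intro mult_left_mono) auto
      moreover have "dist_exponent d * (2 * \<eta>\<^sup>2) \<le> (real d)\<^sup>2 / 2 * (2 * (1 / (real d)\<^sup>2))"
        using dist_exponent_bounds(2)[OF assms] sq by (intro mult_mono) auto
      moreover have "(real d)\<^sup>2 / 2 * (2 * (1 / (real d)\<^sup>2)) = 1" using d by simp
      ultimately have "dist_exponent d * ln (1 - \<eta>\<^sup>2) \<ge> - 1" by linarith
      then have "exp (- 1) \<le> (1 - \<eta>\<^sup>2) powr dist_exponent d" using x by (auto simp: powr_def)
      then show ?thesis using True x by (simp add: beta_weight_def ennreal_leI)
    qed simp
  qed
  finally show ?thesis .
qed

text \<open>With \<open>s = sqrt (c * d) * \<eta>\<close>, integrand and weight are bounded together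
  by the exponential of \<open>d * a * (\<rho> * ln (\<Phi> s) - s\<^sup>2 / 2)\<close> plus the
  error \<open>2 * k * T\<close>. The factor \<open>a\<close> absorbs the difference between
  \<open>k / d\<close> and \<open>\<rho>\<close>, the factor \<open>c\<close>, and the lower-order
  part of the exponent.\<close>

lemma expected_facets_le:
  assumes M: "prob_space M" "iid_uniform_sphere n d M X" and d: "3 \<le> d" "d \<le> n"
    and c: "c > 1" and a: "0 \<le> a" "a * \<rho> * real d \<le> real n - real d" "a * c * real d \<le> real d - 3"
    and m: "\<And>s. \<rho> * ln (\<Phi> s) - s\<^sup>2 / 2 \<le> m"
  shows "expected_facets n d M X \<le> ennreal (real (n choose d) *
     (2 * exp 1 * real d * exp (real d * (a * m) + 2 * (real n - real d) * norm_tail d c)))"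
proof -
  define T where "T = norm_tail d c"
  define k where "k = n - d"
  have T0: "T \<ge> 0" using c by (simp add: T_def norm_tail_nonneg)
  have k: "real k = real n - real d" using d by (simp add: k_def of_nat_diff)
  have d0: "real d > 0" using d by simp
  define \<psi> where "\<psi> r = (min 1 (\<Phi> (sqrt (c * real d) * r) + T)) ^ k" for r
  define K where "K = exp (real d * (a * m) + 2 * real k * T)"
  have base: "0 \<le> min 1 (\<Phi> s + T)" for s using \<Phi>_pos[of s] T0 by simp
  have cont: "continuous_on UNIV \<psi>"
    unfolding \<psi>_def by (intro continuous_intros continuous_on_compose2[OF \<Phi>_continuous]) auto
  have \<psi>0: "0 \<le> \<psi> r" for r unfolding \<psi>_def by (intro zero_le_power base)
  have \<psi>1: "\<psi> r \<le> 1" for r unfolding \<psi>_def by (intro power_le_one base) simp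
  have pw: "\<psi> \<eta> * (1 - \<eta>\<^sup>2) powr dist_exponent d \<le> K" if \<eta>: "0 \<le> \<eta>" "\<eta> < 1" for \<eta>
  proof -
    define s where "s = sqrt (c * real d) * \<eta>"
    have s0: "s \<ge> 0" using \<eta> c d0 by (simp add: s_def)
    \<comment> \<open>This turns the additive error into a factor:
      \<open>\<Phi> s + T \<le> \<Phi> s * exp (2 * T)\<close>.\<close>
    have P: "\<Phi> s \<ge> 1 / 2" using \<Phi>_mono[OF s0] \<Phi>_0_ge_half by linarith
    have "\<eta>\<^sup>2 < 1" using \<eta> by (simp add: power_less_one_iff abs_square_less_1)
    have "\<Phi> s + T \<le> \<Phi> s * (1 + 2 * T)" using mult_right_mono[OF P, of "2 * T"] T0 by (simp add: algebra_simps)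
    also have "\<dots> \<le> \<Phi> s * exp (2 * T)" using exp_ge_add_one_self[of "2 * T"] \<Phi>_pos[of s] by (intro mult_left_mono) auto
    also have "\<dots> = exp (ln (\<Phi> s) + 2 * T)" using \<Phi>_pos[of s] by (simp add: exp_add)
    finally have "min 1 (\<Phi> s + T) \<le> exp (ln (\<Phi> s) + 2 * T)" by simp
    then have "\<psi> \<eta> \<le> exp (ln (\<Phi> s) + 2 * T) ^ k"
      unfolding \<psi>_def s_def[symmetric] by (intro power_mono base)
    also have "\<dots> = exp (real k * (ln (\<Phi> s) + 2 * T))" by (simp add: exp_of_nat_mult)
    finally have 1: "\<psi> \<eta> \<le> exp (real k * (ln (\<Phi> s) + 2 * T))" .
    have "ln (1 - \<eta>\<^sup>2) \<le> - \<eta>\<^sup>2" using \<open>\<eta>\<^sup>2 < 1\<close> ln_le_minus_one[of "1 - \<eta>\<^sup>2"] by simp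
    then have "dist_exponent d * ln (1 - \<eta>\<^sup>2) \<le> dist_exponent d * - \<eta>\<^sup>2"
      using dist_exponent_bounds(1)[OF d(1)] by (intro mult_left_mono)
    also have "\<dots> \<le> - (real d * (a * s\<^sup>2 / 2))"
    proof -
      have s2: "s\<^sup>2 = c * real d * \<eta>\<^sup>2" using c d0 by (simp add: s_def power_mult_distrib)
      have "real d * (a * s\<^sup>2 / 2) = (a * c * real d) * (real d * \<eta>\<^sup>2 / 2)" by (simp add: s2)
      also have "\<dots> \<le> (real d - 3) * (real d * \<eta>\<^sup>2 / 2)" using a(3) by (intro mult_right_mono) auto
      also have "\<dots> = real d * (real d - 3) / 2 * \<eta>\<^sup>2" by simp
      also have "\<dots> \<le> dist_exponent d * \<eta>\<^sup>2" using dist_exponent_bounds(3)[OF d(1)] by (intro mult_right_mono) auto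
      finally show ?thesis by simp
    qed
    finally have "dist_exponent d * ln (1 - \<eta>\<^sup>2) \<le> - (real d * (a * s\<^sup>2 / 2))" .
    then have 2: "(1 - \<eta>\<^sup>2) powr dist_exponent d \<le> exp (- (real d * (a * s\<^sup>2 / 2)))" using \<open>\<eta>\<^sup>2 < 1\<close> by (simp add: powr_def)
    have "\<psi> \<eta> * (1 - \<eta>\<^sup>2) powr dist_exponent d \<le> exp (real k * (ln (\<Phi> s) + 2 * T)) * exp (- (real d * (a * s\<^sup>2 / 2)))"
      using 1 2 by (intro mult_mono) auto
    also have "\<dots> = exp (real k * (ln (\<Phi> s) + 2 * T) - real d * (a * s\<^sup>2 / 2))" by (simp add: mult_exp_exp)
    \<comment> \<open>As \<open>ln (\<Phi> s) \<le> 0\<close>, replacing \<open>k\<close> by the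
      smaller number \<open>a * \<rho> * d\<close> weakens the bound and brings out the common
      factor \<open>a\<close>.\<close>
    also have "\<dots> \<le> K"
    proof -
      have "ln (\<Phi> s) \<le> 0" using \<Phi>_le_1[of s] \<Phi>_pos[of s] by (simp add: ln_le_zero_iff)
      then have "real k * ln (\<Phi> s) \<le> (a * \<rho> * real d) * ln (\<Phi> s)"
        using a(2) k by (intro mult_right_mono_neg) auto
      moreover have "(real d * a) * (\<rho> * ln (\<Phi> s) - s\<^sup>2 / 2) \<le> (real d * a) * m"
        using a(1) by (intro mult_left_mono m) simp
      ultimately show ?thesis unfolding K_def by (simp add: algebra_simps)
    qed
    finally show ?thesis .
  qed
  let ?I = "\<integral>\<^sup>+x. ennreal (\<psi> (plane_dist d x)) \<partial>sphere_points {..<d} d"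
  let ?Z = "\<integral>\<^sup>+\<eta>. beta_weight (dist_exponent d) (\<eta>\<^sup>2) \<partial>lborel"
  interpret SP: prob_space "sphere_points {..<d} d"
    by (rule prob_space_PiM) (rule prob_space_uniform_sphere)
  have "?I \<le> (\<integral>\<^sup>+x. 1 \<partial>sphere_points {..<d} d)" using \<psi>1 by (intro nn_integral_mono) simp
  then have "?I \<le> 1" by (simp add: SP.emeasure_space_1)
  then have "?I < \<infinity>" by (rule le_less_trans) simp
  then obtain i where i: "i \<ge> 0" "?I = ennreal i" by (cases ?I) auto
  have "?I * ?Z \<le> ennreal (2 * K)"
  proof -
    have "?I * ?Z = (\<integral>\<^sup>+\<eta>. ennreal (\<psi> \<bar>\<eta>\<bar>) * beta_weight (dist_exponent d) (\<eta>\<^sup>2) \<partial>lborel)"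
      by (rule plane_dist_law_dist_exponent[OF d(1) cont \<psi>0 \<psi>1])
    also have "\<dots> \<le> (\<integral>\<^sup>+\<eta>. ennreal K * indicator {-1..1::real} \<eta> \<partial>lborel)"
    proof (rule nn_integral_mono)
      fix \<eta> :: real
      show "ennreal (\<psi> \<bar>\<eta>\<bar>) * beta_weight (dist_exponent d) (\<eta>\<^sup>2) \<le> ennreal K * indicator {-1..1} \<eta>"
      proof (cases "\<eta>\<^sup>2 < 1")
        case True
        then have "\<bar>\<eta>\<bar> < 1" by (simp add: abs_square_less_1)
        moreover from this have "\<eta> \<in> {-1..1}" by auto
        ultimately show ?thesis
          using pw[of "\<bar>\<eta>\<bar>"] True \<psi>0 by (simp add: beta_weight_def ennreal_mult[symmetric] ennreal_leI)
      qed (simp add: beta_weight_def)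
    qed
    also have "\<dots> = ennreal K * 2" by (subst nn_integral_cmult) auto
    also have "\<dots> = ennreal (2 * K)" by (simp add: ennreal_mult' K_def mult.commute)
    finally show ?thesis .
  qed
  moreover have "?I * ennreal (2 / real d * exp (- 1)) \<le> ?I * ?Z"
    by (intro mult_left_mono beta_weight_integral_ge[OF d(1)]) simp
  ultimately have "?I * ennreal (2 / real d * exp (- 1)) \<le> ennreal (2 * K)"
    by (rule order_trans[rotated])
  then have "ennreal (i * (2 / real d * exp (- 1))) \<le> ennreal (2 * K)"
    unfolding i(2) ennreal_mult'[OF i(1), symmetric] .
  then have "i * (2 / real d * exp (- 1)) \<le> 2 * K" by (simp add: ennreal_le_iff K_def)
  then have iK: "i \<le> exp 1 * real d * K" using d0 by (simp add: exp_minus field_simps)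
  have IB: "(\<integral>\<^sup>+x. cap_prob d B x ^ (n - d) \<partial>sphere_points {..<d} d) \<le> ennreal (exp 1 * real d * K)"
    if "B = {..1} \<or> B = {1..}" for B
  proof -
    have "(\<integral>\<^sup>+x. cap_prob d B x ^ (n - d) \<partial>sphere_points {..<d} d) \<le> ?I"
    proof (rule nn_integral_mono_AE)
      show "AE x in sphere_points {..<d} d. cap_prob d B x ^ (n - d) \<le> ennreal (\<psi> (plane_dist d x))"
        using AE_sphere_points_nonsingular
      proof eventually_elim
        case (elim x)
        have "cap_prob d B x ^ (n - d) \<le> ennreal (min 1 (\<Phi> (sqrt (c * real d) * plane_dist d x) + T)) ^ k"
          unfolding k_def T_def by (intro power_mono_ennreal cap_prob_upper elim c that) (use d in simp)
        then show ?case unfolding \<psi>_def ennreal_power[OF base] .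
      qed
    qed
    also have "\<dots> \<le> ennreal (exp 1 * real d * K)" unfolding i(2) by (rule ennreal_leI[OF iK])
    finally show ?thesis .
  qed
  have "expected_facets n d M X \<le> of_nat (n choose d) * (ennreal (exp 1 * real d * K) + ennreal (exp 1 * real d * K))"
    by (rule order_trans[OF expected_facets_bounds(1)[OF M]]) (use d in \<open>auto intro!: mult_left_mono add_mono IB\<close>)
  also have "\<dots> = ennreal (real (n choose d) * (2 * exp 1 * real d * K))"
    using d0 by (simp add: ennreal_of_nat_eq_real_of_nat ennreal_plus[symmetric] ennreal_mult[symmetric] K_def del: ennreal_plus)
  finally show ?thesis unfolding K_def T_def k .
qed

text \<open>Only distances between \<open>r / sqrt d\<close> and \<open>R / sqrt d\<close> are kept;
  there \<open>\<Phi>\<close> is bounded below through the left end and the weight through the right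
  end. The term \<open>R ^ 4\<close> is the quadratic error of \<open>ln (1 - x)\<close>, and
  \<open>(R - r) / (2 * d)\<close> comes from the length of the window and the bound 2 for the
  normalising integral.\<close>

lemma expected_facets_ge:
  assumes M: "prob_space M" "iid_uniform_sphere n d M X" and d: "3 \<le> d" "d \<le> n"
    and c: "0 < c" "c < 1" and r: "0 \<le> r" "r < R" "R\<^sup>2 \<le> real d / 2" and T: "norm_tail d c \<le> 1 / 4"
  shows "ennreal (real (n choose d) * ((R - r) / (2 * real d) *
      exp ((real n - real d) * (ln (\<Phi> (sqrt c * r)) - 4 * norm_tail d c) - real d * R\<^sup>2 / 2 - R ^ 4)))
    \<le> expected_facets n d M X"
proof -
  define T where "T = norm_tail d c"
  define k where "k = n - d"
  have T0: "T \<ge> 0" "T \<le> 1 / 4" using c T by (simp_all add: T_def norm_tail_nonneg)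
  have k: "real k = real n - real d" using d by (simp add: k_def of_nat_diff)
  have d0: "real d > 0" using d by simp
  have sd: "sqrt (real d) > 0" "sqrt (real d) \<le> real d"
  proof -
    show "sqrt (real d) > 0" using d0 by simp
    have "real d \<le> (real d)\<^sup>2" using d by (intro self_le_power) auto
    then show "sqrt (real d) \<le> real d" by (intro real_le_lsqrt) auto
  qed
  define \<psi> where "\<psi> x = (max 0 (\<Phi> (sqrt (c * real d) * x) - T)) ^ k" for x
  define K where "K = exp (real k * (ln (\<Phi> (sqrt c * r)) - 4 * T) - real d * R\<^sup>2 / 2 - R ^ 4)"
  have base: "0 \<le> max 0 (\<Phi> s - T)" "max 0 (\<Phi> s - T) \<le> 1" for s using \<Phi>_le_1[of s] T0 by simp_all
  have cont: "continuous_on UNIV \<psi>"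
    unfolding \<psi>_def by (intro continuous_intros continuous_on_compose2[OF \<Phi>_continuous]) auto
  have \<psi>0: "0 \<le> \<psi> r" for r unfolding \<psi>_def by (intro zero_le_power base)
  have \<psi>1: "\<psi> r \<le> 1" for r unfolding \<psi>_def by (intro power_le_one base)
  let ?J = "{r / sqrt (real d)..R / sqrt (real d)}"
  have pw: "\<eta>\<^sup>2 < 1 \<and> K \<le> \<psi> \<eta> * (1 - \<eta>\<^sup>2) powr dist_exponent d" if \<eta>: "\<eta> \<in> ?J" for \<eta>
  proof -
    have \<eta>r: "r \<le> sqrt (real d) * \<eta>" "sqrt (real d) * \<eta> \<le> R" using \<eta> sd by (auto simp: field_simps)
    have \<eta>0: "0 \<le> \<eta>" using \<eta>r(1) r(1) sd by (meson order_trans zero_le_mult_iff not_less)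
    have "(sqrt (real d) * \<eta>)\<^sup>2 \<le> R\<^sup>2" using \<eta>r \<eta>0 sd by (intro power_mono) auto
    then have dx: "real d * \<eta>\<^sup>2 \<le> R\<^sup>2" by (simp add: power_mult_distrib)
    then have "real d * \<eta>\<^sup>2 \<le> real d * (1 / 2)" using r(3) by simp
    then have x: "\<eta>\<^sup>2 \<le> 1 / 2" using d0 by (subst (asm) mult_le_cancel_left_pos)
    let ?P = "\<Phi> (sqrt c * r)"
    have P: "?P \<ge> 1 / 2" using \<Phi>_mono[of 0 "sqrt c * r"] \<Phi>_0_ge_half r(1) c by simp
    \<comment> \<open>As \<open>?P \<ge> 1 / 2\<close>, subtracting \<open>T\<close> costs at most
      the factor \<open>1 - 2 * T\<close>, and \<open>T \<le> 1 / 4\<close> makes this factor at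
      least \<open>exp (- (4 * T))\<close>.\<close>
    have "exp (- (4 * T)) \<le> 1 - 2 * T"
    proof -
      have "ln (1 - 2 * T) \<ge> - (2 * T) - 2 * (2 * T)\<^sup>2" using T0 by (intro ln_one_minus_pos_lower_bound) auto
      moreover have "2 * (2 * T)\<^sup>2 \<le> 2 * T" using T0 mult_right_mono[of "T" "1/4" T] by (simp add: power2_eq_square)
      ultimately have "- (4 * T) \<le> ln (1 - 2 * T)" by linarith
      then show ?thesis using T0 by (simp add: ln_ge_iff)
    qed
    then have "?P * exp (- (4 * T)) \<le> ?P * (1 - 2 * T)" using P by (intro mult_left_mono) auto
    moreover have "exp (ln ?P - 4 * T) = ?P * exp (- (4 * T))" using P unfolding diff_conv_add_uminus exp_add by simp
    ultimately have "exp (ln ?P - 4 * T) \<le> ?P * (1 - 2 * T)" by simp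
    also have "\<dots> \<le> ?P - T" using mult_right_mono[OF P, of "2 * T"] T0 by (simp add: algebra_simps)
    also have "\<dots> \<le> max 0 (\<Phi> (sqrt (c * real d) * \<eta>) - T)"
    proof -
      have "sqrt c * r \<le> sqrt c * (sqrt (real d) * \<eta>)" using \<eta>r c by (intro mult_left_mono) auto
      then have "?P \<le> \<Phi> (sqrt (c * real d) * \<eta>)" by (intro \<Phi>_mono) (simp add: real_sqrt_mult mult.assoc)
      then show ?thesis by simp
    qed
    finally have "exp (ln ?P - 4 * T) ^ k \<le> \<psi> \<eta>" unfolding \<psi>_def by (intro power_mono) auto
    then have 1: "exp (real k * (ln ?P - 4 * T)) \<le> \<psi> \<eta>" by (simp add: exp_of_nat_mult)
    have "ln (1 - \<eta>\<^sup>2) \<ge> - \<eta>\<^sup>2 - 2 * (\<eta>\<^sup>2)\<^sup>2" using x by (intro ln_one_minus_pos_lower_bound) auto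
    then have "dist_exponent d * (- \<eta>\<^sup>2 - 2 * (\<eta>\<^sup>2)\<^sup>2) \<le> dist_exponent d * ln (1 - \<eta>\<^sup>2)"
      using dist_exponent_bounds(1)[OF d(1)] by (intro mult_left_mono) auto
    moreover have "dist_exponent d * (\<eta>\<^sup>2 + 2 * (\<eta>\<^sup>2)\<^sup>2) \<le> (real d)\<^sup>2 / 2 * (\<eta>\<^sup>2 + 2 * (\<eta>\<^sup>2)\<^sup>2)"
      using dist_exponent_bounds(2)[OF d(1)] by (intro mult_right_mono) auto
    moreover have "(real d)\<^sup>2 / 2 * (\<eta>\<^sup>2 + 2 * (\<eta>\<^sup>2)\<^sup>2) = real d * (real d * \<eta>\<^sup>2) / 2 + (real d * \<eta>\<^sup>2)\<^sup>2"
      by (simp add: power2_eq_square algebra_simps)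
    moreover have "real d * (real d * \<eta>\<^sup>2) / 2 \<le> real d * R\<^sup>2 / 2" using dx d0 by (intro divide_right_mono mult_left_mono) auto
    moreover have "(real d * \<eta>\<^sup>2)\<^sup>2 \<le> (R\<^sup>2)\<^sup>2" using dx by (intro power_mono) auto
    moreover have "(R\<^sup>2)\<^sup>2 = R ^ 4" by simp
    moreover have "dist_exponent d * (- \<eta>\<^sup>2 - 2 * (\<eta>\<^sup>2)\<^sup>2) = - (dist_exponent d * (\<eta>\<^sup>2 + 2 * (\<eta>\<^sup>2)\<^sup>2))" by (simp add: algebra_simps)
    ultimately have "- (real d * R\<^sup>2 / 2) - R ^ 4 \<le> dist_exponent d * ln (1 - \<eta>\<^sup>2)"
      by argo
    then have 2: "exp (- (real d * R\<^sup>2 / 2) - R ^ 4) \<le> (1 - \<eta>\<^sup>2) powr dist_exponent d" using x by (auto simp: powr_def)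
    have "K = exp (real k * (ln ?P - 4 * T)) * exp (- (real d * R\<^sup>2 / 2) - R ^ 4)"
      unfolding K_def mult_exp_exp by (simp add: algebra_simps)
    also have "\<dots> \<le> \<psi> \<eta> * (1 - \<eta>\<^sup>2) powr dist_exponent d" using 1 2 \<psi>0 by (intro mult_mono) auto
    finally show ?thesis using x by simp
  qed
  let ?I = "\<integral>\<^sup>+x. ennreal (\<psi> (plane_dist d x)) \<partial>sphere_points {..<d} d"
  let ?Z = "\<integral>\<^sup>+\<eta>. beta_weight (dist_exponent d) (\<eta>\<^sup>2) \<partial>lborel"
  interpret SP: prob_space "sphere_points {..<d} d"
    by (rule prob_space_PiM) (rule prob_space_uniform_sphere)
  have "?I \<le> (\<integral>\<^sup>+x. 1 \<partial>sphere_points {..<d} d)" using \<psi>1 by (intro nn_integral_mono) simp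
  then have "?I \<le> 1" by (simp add: SP.emeasure_space_1)
  then have "?I < \<infinity>" by (rule le_less_trans) simp
  then obtain i where i: "i \<ge> 0" "?I = ennreal i" by (cases ?I) auto
  have "ennreal (K * ((R - r) / sqrt (real d))) = (\<integral>\<^sup>+\<eta>. ennreal K * indicator ?J \<eta> \<partial>lborel)"
    using r sd by (subst nn_integral_cmult)
      (auto simp: ennreal_mult[symmetric] K_def divide_right_mono diff_divide_distrib)
  also have "\<dots> \<le> (\<integral>\<^sup>+\<eta>. ennreal (\<psi> \<bar>\<eta>\<bar>) * beta_weight (dist_exponent d) (\<eta>\<^sup>2) \<partial>lborel)"
  proof (rule nn_integral_mono)
    fix \<eta> :: real
    show "ennreal K * indicator ?J \<eta> \<le> ennreal (\<psi> \<bar>\<eta>\<bar>) * beta_weight (dist_exponent d) (\<eta>\<^sup>2)"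
    proof (cases "\<eta> \<in> ?J")
      case True
      have "0 \<le> r / sqrt (real d)" using r sd by simp
      then have "\<bar>\<eta>\<bar> = \<eta>" using True by auto
      then show ?thesis
        using pw[OF True] True \<psi>0 by (simp add: beta_weight_def ennreal_mult[symmetric] ennreal_leI)
    qed simp
  qed
  also have "\<dots> = ?I * ?Z"
    by (rule plane_dist_law_dist_exponent[OF d(1) cont \<psi>0 \<psi>1, symmetric])
  also have "\<dots> \<le> ?I * 2"
    by (intro mult_left_mono beta_weight_integral_finite dist_exponent_bounds d) simp
  also have "\<dots> = ennreal (i * 2)" using i by (simp add: ennreal_mult')
  finally have "K * ((R - r) / sqrt (real d)) \<le> i * 2" using i by (simp add: ennreal_le_iff)
  moreover have "K * ((R - r) / real d) \<le> K * ((R - r) / sqrt (real d))"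
    using sd d0 r by (intro mult_left_mono divide_left_mono) (auto simp: K_def)
  ultimately have iK: "(R - r) / (2 * real d) * K \<le> i" by (simp add: mult.commute)
  have "ennreal i \<le> (\<integral>\<^sup>+x. cap_prob d {..<1} x ^ (n - d) \<partial>sphere_points {..<d} d)"
    unfolding i(2)[symmetric]
  proof (rule nn_integral_mono_AE)
    show "AE x in sphere_points {..<d} d. ennreal (\<psi> (plane_dist d x)) \<le> cap_prob d {..<1} x ^ (n - d)"
      using AE_sphere_points_nonsingular
    proof eventually_elim
      case (elim x)
      have "ennreal (max 0 (\<Phi> (sqrt (c * real d) * plane_dist d x) - T)) ^ k \<le> cap_prob d {..<1} x ^ (n - d)"
        unfolding k_def T_def by (intro power_mono_ennreal cap_prob_lower elim c) (use d in simp)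
      then show ?case unfolding \<psi>_def ennreal_power[OF base(1)] .
    qed
  qed
  then have "ennreal ((R - r) / (2 * real d) * K) \<le> (\<integral>\<^sup>+x. cap_prob d {..<1} x ^ (n - d) \<partial>sphere_points {..<d} d)"
    using ennreal_leI[OF iK] by (rule order_trans[rotated])
  then have "of_nat (n choose d) * ennreal ((R - r) / (2 * real d) * K) \<le>
      of_nat (n choose d) * (\<integral>\<^sup>+x. cap_prob d {..<1} x ^ (n - d) \<partial>sphere_points {..<d} d)"
    by (rule mult_left_mono) simp
  also have "\<dots> \<le> expected_facets n d M X"
    by (rule expected_facets_bounds(2)[OF M]) (use d in auto)
  finally show ?thesis
    unfolding K_def T_def k ennreal_of_nat_eq_real_of_nat by (subst ennreal_mult') auto
qed

section \<open>Exponential growth rate\<close>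

text \<open>The strict inequality \<open>ln c < c - 1\<close> for \<open>c \<noteq> 1\<close> puts
  the base of the power below 1.\<close>

lemma norm_tail_tendsto_0:
  assumes "0 < c" "c \<noteq> 1" and d: "filterlim d at_top sequentially"
  shows "(\<lambda>n. norm_tail (d n) c) \<longlonglongrightarrow> 0"
proof -
  have "ln c < c - 1"
    using assms(1,2) ln_le_minus_one[of c] ln_eq_minus_one[of c] by (cases "ln c = c - 1") auto
  then have "ln c + (1 - c) < 0" by simp
  then have "exp (ln c + (1 - c)) < 1" by (subst exp_less_one_iff)
  then have "c * exp (1 - c) < 1" using assms(1) by (simp add: exp_add)
  then have "sqrt (c * exp (1 - c)) < 1" by simp
  then have "(\<lambda>m. sqrt (c * exp (1 - c)) ^ m) \<longlonglongrightarrow> 0"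
    using assms(1) by (intro LIMSEQ_realpow_zero) auto
  from filterlim_compose[OF this d] show ?thesis unfolding norm_tail_def .
qed

context
  fixes \<rho> :: real and d :: "nat \<Rightarrow> nat"
  assumes rho: "\<rho> > 0"
    and d_range: "\<And>n. n \<ge> 3 \<Longrightarrow> d n \<in> {2..n - 1}"
    and ratio: "(\<lambda>n. (real n - real (d n)) / real (d n)) \<longlonglongrightarrow> \<rho>"
begin

text \<open>Eventually \<open>n \<le> (\<rho> + 2) * d n\<close>, so the dimension grows at least
  linearly.\<close>

lemma dim_at_top: "filterlim d at_top sequentially"
proof (unfold filterlim_at_top, rule allI)
  fix Z :: nat
  have "eventually (\<lambda>n. (real n - real (d n)) / real (d n) < \<rho> + 1) sequentially"
    by (rule order_tendstoD[OF ratio]) simp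
  moreover have "eventually (\<lambda>n. real n \<ge> (\<rho> + 2) * real Z) sequentially"
    by (rule eventually_at_top_linorderI[of "nat \<lceil>(\<rho> + 2) * real Z\<rceil>"]) linarith
  moreover have "eventually (\<lambda>n. n \<ge> 3) sequentially" by (rule eventually_ge_at_top)
  ultimately show "eventually (\<lambda>n. Z \<le> d n) sequentially"
  proof eventually_elim
    case (elim n)
    have "real (d n) > 0" using d_range[OF elim(3)] by auto
    then have "real n \<le> (\<rho> + 2) * real (d n)" using elim(1) by (simp add: field_simps)
    then have "(\<rho> + 2) * real Z \<le> (\<rho> + 2) * real (d n)" using elim(2) by linarith
    then show ?case using rho by simp
  qed
qed

lemma real_dim_at_top: "filterlim (\<lambda>n. real (d n)) at_top sequentially"
  by (rule filterlim_compose[OF filterlim_real_sequentially dim_at_top])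

lemma eventually_dim: "eventually (\<lambda>n. 3 \<le> d n \<and> d n < n \<and> 3 \<le> n) sequentially"
  using filterlim_at_top[THEN iffD1, OF dim_at_top, rule_format, of 3] eventually_ge_at_top[of 3]
proof eventually_elim
  case (elim n)
  then show ?case using d_range[of n] by auto
qed

lemma ln_dim_negligible: "(\<lambda>n. ln (real (d n)) / real (d n)) \<longlonglongrightarrow> 0"
  by (rule filterlim_compose[OF ln_x_over_x_tendsto_0 real_dim_at_top])

lemma const_negligible: "(\<lambda>n. C / real (d n)) \<longlonglongrightarrow> 0"
  by (rule real_tendsto_divide_at_top[OF tendsto_const real_dim_at_top])

text \<open>Divide \<open>ln_choose_bounds\<close> by \<open>d n\<close>. The error is negligible
  because \<open>n / d n\<close> converges, so that \<open>ln n\<close> and \<open>ln (d n)\<close>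
  differ by a bounded amount.\<close>

lemma ln_choose_limit:
  "(\<lambda>n. ln (real (n choose d n)) / real (d n)) \<longlonglongrightarrow> (\<rho> + 1) * ln (\<rho> + 1) - \<rho> * ln \<rho>"
proof -
  define r where "r n = (real n - real (d n)) / real (d n)" for n
  define b where "b n = (2 * ln (real n) + 2) / real (d n)" for n
  have r: "r \<longlonglongrightarrow> \<rho>" using ratio by (simp add: r_def[abs_def])
  have R: "(\<lambda>n. (r n + 1) * ln (r n + 1) - r n * ln (r n)) \<longlonglongrightarrow> (\<rho> + 1) * ln (\<rho> + 1) - \<rho> * ln \<rho>"
    using rho by (intro tendsto_intros r) auto
  have r1: "(\<lambda>n. ln (r n + 1)) \<longlonglongrightarrow> ln (\<rho> + 1)"
    using rho by (intro tendsto_ln tendsto_add tendsto_const r) simp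
  have "(\<lambda>n. 2 * (ln (r n + 1) / real (d n) + ln (real (d n)) / real (d n)) + 2 / real (d n)) \<longlonglongrightarrow> 2 * (0 + 0) + 0"
    by (intro tendsto_add tendsto_mult tendsto_const ln_dim_negligible const_negligible
        real_tendsto_divide_at_top[OF r1 real_dim_at_top])
  then have lim: "(\<lambda>n. 2 * (ln (r n + 1) / real (d n) + ln (real (d n)) / real (d n)) + 2 / real (d n)) \<longlonglongrightarrow> 0" by simp
  have b0: "b \<longlonglongrightarrow> 0"
  proof (rule Lim_transform_eventually[OF lim])
    show "\<forall>\<^sub>F n in sequentially. 2 * (ln (r n + 1) / real (d n) + ln (real (d n)) / real (d n)) + 2 / real (d n) = b n"
      using eventually_dim
    proof eventually_elim
      case (elim n)
      then have "r n + 1 = real n / real (d n)" by (simp add: r_def field_simps)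
      then have "ln (real n) = ln (r n + 1) + ln (real (d n))" using elim by (simp add: ln_div)
      then show ?case by (simp add: b_def add_divide_distrib distrib_left)
    qed
  qed
  have "(\<lambda>n. ln (real (n choose d n)) / real (d n) - ((r n + 1) * ln (r n + 1) - r n * ln (r n))) \<longlonglongrightarrow> 0"
  proof (rule tendsto_rabs_zero_cancel, rule tendsto_sandwich[OF _ _ tendsto_const b0])
    show "\<forall>\<^sub>F n in sequentially. \<bar>ln (real (n choose d n)) / real (d n) - ((r n + 1) * ln (r n + 1) - r n * ln (r n))\<bar> \<le> b n"
      using eventually_dim
    proof eventually_elim
      case (elim n)
      let ?f = "(r n + 1) * ln (r n + 1) - r n * ln (r n)"
      have d: "real (d n) > 0" using elim by simp
      have "\<bar>ln (real (n choose d n)) - real (d n) * ?f\<bar> \<le> 2 * ln (real n) + 2"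
        unfolding r_def by (rule ln_choose_bounds) (use elim in auto)
      then have "\<bar>ln (real (n choose d n)) - real (d n) * ?f\<bar> / real (d n) \<le> b n"
        unfolding b_def using d by (intro divide_right_mono) auto
      moreover have "ln (real (n choose d n)) / real (d n) - ?f = (ln (real (n choose d n)) - real (d n) * ?f) / real (d n)"
        using d by (simp add: field_simps)
      ultimately show ?case using d by (simp add: abs_divide)
    qed
  qed simp
  from tendsto_add[OF this R] show ?thesis by simp
qed

context
  fixes M :: "nat \<Rightarrow> 'a measure" and X :: "nat \<Rightarrow> nat \<Rightarrow> 'a \<Rightarrow> nat \<Rightarrow> real"
  assumes prob: "\<And>n. n \<ge> 3 \<Longrightarrow> prob_space (M n)"
    and iid: "\<And>n. n \<ge> 3 \<Longrightarrow> iid_uniform_sphere n (d n) (M n) (X n)"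
begin

definition mean_facets :: "nat \<Rightarrow> real"
  where "mean_facets n = enn2real (expected_facets n (d n) (M n) (X n))"

lemma mean_facets_pos: "n \<ge> 3 \<Longrightarrow> mean_facets n > 0 \<and> expected_facets n (d n) (M n) (X n) = ennreal (mean_facets n)"
proof -
  assume n: "n \<ge> 3"
  then have "2 \<le> d n" "d n \<le> n" using d_range[OF n] by auto
  from expected_facets_pos_finite[OF prob[OF n] iid[OF n] this]
  show ?thesis unfolding mean_facets_def by (auto simp: enn2real_positive_iff)
qed

text \<open>The slack \<open>a < 1\<close> stays fixed while \<open>n\<close> grows. The side
  conditions of \<open>expected_facets_le\<close> amount to
  \<open>a * \<rho> \<le> (n - d) / d\<close> and \<open>3 / d \<le> 1 - a * c\<close>, which hold
  eventually.\<close>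

lemma growth_rate_upper:
  assumes a: "0 < a" "a < 1" and max: "\<And>s. g \<rho> s \<le> G" and \<epsilon>: "\<epsilon> > 0"
  defines "H \<equiv> (\<rho> + 1) * ln (\<rho> + 1) - \<rho> * ln \<rho>"
  shows "eventually (\<lambda>n. ln (mean_facets n) / real (d n) < H + a * (G - H) + \<epsilon>) sequentially"
proof -
  \<comment> \<open>The midpoint of 1 and \<open>1 / a\<close>, so that \<open>c > 1\<close> and
    \<open>a * c < 1\<close>.\<close>
  define c where "c = (1 / a + 1) / 2"
  have c: "c > 1" "a * c < 1" using a by (auto simp: c_def field_simps)
  have m: "\<rho> * ln (\<Phi> s) - s\<^sup>2 / 2 \<le> G - H" for s using max[of s] by (simp add: g_def H_def)
  let ?r = "\<lambda>n. (real n - real (d n)) / real (d n)"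
  define U where "U n = ln (real (n choose d n)) / real (d n) +
     ((1 + ln 2) / real (d n) + ln (real (d n)) / real (d n) + (a * (G - H) + 2 * ?r n * norm_tail (d n) c))" for n
  have "U \<longlonglongrightarrow> H + (0 + 0 + (a * (G - H) + 2 * \<rho> * 0))"
    unfolding U_def H_def using c
    by (intro tendsto_add tendsto_mult ln_choose_limit const_negligible ln_dim_negligible tendsto_const ratio
        norm_tail_tendsto_0 dim_at_top) auto
  then have "eventually (\<lambda>n. U n < H + a * (G - H) + \<epsilon>) sequentially"
    by (rule order_tendstoD) (use \<epsilon> in simp)
  moreover have "eventually (\<lambda>n. a * \<rho> < ?r n) sequentially"
    by (rule order_tendstoD[OF ratio]) (use a rho in simp)
  moreover have "eventually (\<lambda>n. 3 / real (d n) < 1 - a * c) sequentially"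
    by (rule order_tendstoD[OF const_negligible]) (use c in simp)
  ultimately show ?thesis using eventually_dim
  proof eventually_elim
    case (elim n)
    then have n: "n \<ge> 3" "d n \<le> n" "3 \<le> d n" and d0: "real (d n) > 0" by auto
    let ?B = "real (n choose d n) * (2 * exp 1 * real (d n) *
        exp (real (d n) * (a * (G - H)) + 2 * (real n - real (d n)) * norm_tail (d n) c))"
    have ch: "real (n choose d n) > 0" using n by simp
    have "a * \<rho> * real (d n) \<le> real n - real (d n)" "a * c * real (d n) \<le> real (d n) - 3"
      using elim(2,3) d0 by (simp_all add: field_simps)
    from expected_facets_le[OF prob[OF n(1)] iid[OF n(1)] n(3,2) c(1) less_imp_le[OF a(1)] this m]
    have "ennreal (mean_facets n) \<le> ennreal ?B" using mean_facets_pos[OF n(1)] by simp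
    then have "mean_facets n \<le> ?B" using d0 by (subst (asm) ennreal_le_iff) auto
    then have "ln (mean_facets n) \<le> ln ?B" using mean_facets_pos[OF n(1)] by (intro ln_mono) auto
    also have "ln ?B = ln (real (n choose d n)) + (1 + ln 2 + ln (real (d n)) +
        (real (d n) * (a * (G - H)) + 2 * (real n - real (d n)) * norm_tail (d n) c))"
      using ch d0 by (simp add: ln_mult)
    also have "\<dots> = real (d n) * U n" using d0 by (simp add: U_def field_simps)
    finally have "ln (mean_facets n) / real (d n) \<le> U n" using d0 by (simp add: field_simps)
    then show ?case using elim(1) by linarith
  qed
qed

text \<open>Here \<open>c < 1\<close> and \<open>R > r\<close> are the fixed slacks. The window
  length, the dimension factor and the term \<open>R ^ 4\<close> vanish after taking logarithms and
  dividing by \<open>d n\<close>.\<close>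

lemma growth_rate_lower:
  assumes c: "0 < c" "c < 1" and r: "0 \<le> r" "r < R" and \<epsilon>: "\<epsilon> > 0"
  defines "H \<equiv> (\<rho> + 1) * ln (\<rho> + 1) - \<rho> * ln \<rho>"
  shows "eventually (\<lambda>n. H + \<rho> * ln (\<Phi> (sqrt c * r)) - R\<^sup>2 / 2 - \<epsilon> < ln (mean_facets n) / real (d n)) sequentially"
proof -
  let ?r = "\<lambda>n. (real n - real (d n)) / real (d n)"
  define U where "U n = ln (real (n choose d n)) / real (d n) +
     (ln ((R - r) / 2) / real (d n) - ln (real (d n)) / real (d n) +
      (?r n * (ln (\<Phi> (sqrt c * r)) - 4 * norm_tail (d n) c) - R\<^sup>2 / 2 - R ^ 4 / real (d n)))" for n
  have tau0: "(\<lambda>n. norm_tail (d n) c) \<longlonglongrightarrow> 0"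
    using c by (intro norm_tail_tendsto_0 dim_at_top) auto
  have "U \<longlonglongrightarrow> H + (0 - 0 + (\<rho> * (ln (\<Phi> (sqrt c * r)) - 4 * 0) - R\<^sup>2 / 2 - 0))"
    unfolding U_def H_def
    by (intro tendsto_add tendsto_diff tendsto_mult ln_choose_limit const_negligible ln_dim_negligible tendsto_const ratio tau0)
  then have "eventually (\<lambda>n. H + \<rho> * ln (\<Phi> (sqrt c * r)) - R\<^sup>2 / 2 - \<epsilon> < U n) sequentially"
    by (rule order_tendstoD) (use \<epsilon> in simp)
  moreover have "eventually (\<lambda>n. norm_tail (d n) c < 1 / 4) sequentially"
    by (rule order_tendstoD[OF tau0]) simp
  moreover have "eventually (\<lambda>n. R\<^sup>2 / real (d n) < 1 / 2) sequentially"
    by (rule order_tendstoD[OF const_negligible]) simp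
  ultimately show ?thesis using eventually_dim
  proof eventually_elim
    case (elim n)
    then have n: "n \<ge> 3" "d n \<le> n" "3 \<le> d n" and d0: "real (d n) > 0" by auto
    let ?B = "real (n choose d n) * ((R - r) / (2 * real (d n)) *
      exp ((real n - real (d n)) * (ln (\<Phi> (sqrt c * r)) - 4 * norm_tail (d n) c) - real (d n) * R\<^sup>2 / 2 - R ^ 4))"
    have ch: "real (n choose d n) > 0" using n by simp
    have B0: "?B > 0" using ch r d0 by simp
    have "R\<^sup>2 \<le> real (d n) / 2" using elim(3) d0 by (simp add: field_simps)
    then have "ennreal ?B \<le> ennreal (mean_facets n)"
      using expected_facets_ge[OF prob iid, of n c r R] n c r elim(2) mean_facets_pos[OF n(1)] by simp
    then have "?B \<le> mean_facets n" using mean_facets_pos[OF n(1)] by (subst (asm) ennreal_le_iff) auto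
    then have "ln ?B \<le> ln (mean_facets n)" using B0 by (intro ln_mono) auto
    moreover have "ln ?B = ln (real (n choose d n)) + (ln ((R - r) / 2) - ln (real (d n)) +
        ((real n - real (d n)) * (ln (\<Phi> (sqrt c * r)) - 4 * norm_tail (d n) c) - real (d n) * R\<^sup>2 / 2 - R ^ 4))"
      using ch d0 r by (simp add: ln_mult ln_div)
    moreover have "\<dots> = real (d n) * U n" using d0 by (simp add: U_def field_simps)
    ultimately have "U n \<le> ln (mean_facets n) / real (d n)" using d0 by (simp add: field_simps)
    then show ?case using elim(1) by linarith
  qed
qed

text \<open>The slack is kept fixed while \<open>n\<close> tends to infinity and is removed
  afterwards. A single parameter \<open>a\<close> approaching 1 from below drives all slacks, and
  half the gap between \<open>y\<close> and the limit is spent on \<open>\<epsilon>\<close>.\<close>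

lemma facets_growth_rate:
  assumes r: "0 \<le> r" and max: "\<And>s. g \<rho> s \<le> g \<rho> r"
  shows "(\<lambda>n. ln (mean_facets n) / real (d n)) \<longlonglongrightarrow> g \<rho> r"
proof (rule order_tendstoI)
  define H where "H = (\<rho> + 1) * ln (\<rho> + 1) - \<rho> * ln \<rho>"
  fix y assume y: "g \<rho> r < y"
  have "((\<lambda>a. H + a * (g \<rho> r - H) + (y - g \<rho> r) / 2) \<longlongrightarrow> H + 1 * (g \<rho> r - H) + (y - g \<rho> r) / 2) (at_left 1)"
    by (intro tendsto_intros)
  then have "eventually (\<lambda>a. H + a * (g \<rho> r - H) + (y - g \<rho> r) / 2 < y) (at_left (1::real))"
    by (rule order_tendstoD) (use y in \<open>simp add: field_simps\<close>)
  moreover have "eventually (\<lambda>a. a \<in> {0<..<1}) (at_left (1::real))"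
    by (rule eventually_at_leftI[of 0]) auto
  ultimately have "eventually (\<lambda>a. H + a * (g \<rho> r - H) + (y - g \<rho> r) / 2 < y \<and> a \<in> {0<..<1}) (at_left (1::real))"
    by (rule eventually_conj)
  then obtain a where a: "H + a * (g \<rho> r - H) + (y - g \<rho> r) / 2 < y" "0 < a" "a < 1"
    using eventually_happens'[OF trivial_limit_at_left_real] by force
  from growth_rate_upper[OF a(2,3) max, of "(y - g \<rho> r) / 2"] y
  have "\<forall>\<^sub>F n in sequentially. ln (mean_facets n) / real (d n) < H + a * (g \<rho> r - H) + (y - g \<rho> r) / 2"
    by (simp add: H_def)
  then show "\<forall>\<^sub>F n in sequentially. ln (mean_facets n) / real (d n) < y"
    by eventually_elim (use a(1) in linarith)
next
  define H where "H = (\<rho> + 1) * ln (\<rho> + 1) - \<rho> * ln \<rho>"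
  fix y assume y: "y < g \<rho> r"
  \<comment> \<open>The lower rate with \<open>c = a\<close> and \<open>R = r + (1 - a)\<close>;
    both slacks disappear as \<open>a\<close> tends to 1.\<close>
  let ?F = "\<lambda>a. H + \<rho> * ln (\<Phi> (sqrt a * r)) - (r + (1 - a))\<^sup>2 / 2 - (g \<rho> r - y) / 2"
  have ph: "(\<Phi> \<longlongrightarrow> \<Phi> x) (at x)" for x
    using \<Phi>_continuous by (simp add: continuous_on_eq_continuous_at isCont_def)
  have "isCont \<Phi> (sqrt 1 * r)"
    using \<Phi>_continuous by (simp add: continuous_on_eq_continuous_at)
  then have "(?F \<longlongrightarrow> H + \<rho> * ln (\<Phi> (sqrt 1 * r)) - (r + (1 - 1))\<^sup>2 / 2 - (g \<rho> r - y) / 2) (at_left 1)"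
    using \<Phi>_pos[of "sqrt 1 * r"] by (intro tendsto_intros isCont_tendsto_compose[of _ \<Phi>]) auto
  moreover have "H + \<rho> * ln (\<Phi> (sqrt 1 * r)) - (r + (1 - 1))\<^sup>2 / 2 - (g \<rho> r - y) / 2 = (g \<rho> r + y) / 2"
    by (simp add: g_def H_def field_simps)
  ultimately have "(?F \<longlongrightarrow> (g \<rho> r + y) / 2) (at_left 1)" by (simp only:)
  then have "eventually (\<lambda>a. y < ?F a) (at_left (1::real))"
    by (rule order_tendstoD) (use y in simp)
  moreover have "eventually (\<lambda>a. a \<in> {0<..<1}) (at_left (1::real))"
    by (rule eventually_at_leftI[of 0]) auto
  ultimately have "eventually (\<lambda>a. y < ?F a \<and> a \<in> {0<..<1}) (at_left (1::real))"
    by (rule eventually_conj)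
  then obtain a where a: "y < ?F a" "0 < a" "a < 1"
    using eventually_happens'[OF trivial_limit_at_left_real] by force
  have "\<forall>\<^sub>F n in sequentially. ?F a < ln (mean_facets n) / real (d n)"
    using growth_rate_lower[OF a(2,3) r, of "r + (1 - a)" "(g \<rho> r - y) / 2"] y a by (simp add: H_def)
  then show "\<forall>\<^sub>F n in sequentially. y < ln (mean_facets n) / real (d n)"
    by eventually_elim (use a(1) in linarith)
qed

end

end

theorem theorem10:
  fixes \<rho> :: real
    and d :: "nat \<Rightarrow> nat"
    and M :: "nat \<Rightarrow> 'a measure"
    and X :: "nat \<Rightarrow> nat \<Rightarrow> 'a \<Rightarrow> nat \<Rightarrow> real"
  assumes "\<rho> > 0"
    and "\<And>n. n \<ge> 3 \<Longrightarrow> d n \<in> {2..n - 1}"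
    and "(\<exists>c. \<forall>n\<ge>3. d n = c) \<or> filterlim d at_top sequentially"
    and "(\<lambda>n. (real n - real (d n)) / real (d n)) \<longlonglongrightarrow> \<rho>"
    and "\<And>n. n \<ge> 3 \<Longrightarrow> prob_space (M n)"
    and "\<And>n. n \<ge> 3 \<Longrightarrow> iid_uniform_sphere n (d n) (M n) (X n)"
  shows "\<exists>r\<^sub>\<rho>. (\<forall>r. g \<rho> r \<le> g \<rho> r\<^sub>\<rho>) \<and> g \<rho> r\<^sub>\<rho> > 0 \<and>
    (\<exists>h. h \<in> o(\<lambda>n. real (d n)) \<and>
      (\<forall>n\<ge>3. expected_facets n (d n) (M n) (X n) =
        ennreal (exp (real (d n) * g \<rho> r\<^sub>\<rho> + h n))))"
proof -
  obtain r where r: "r \<ge> 0" "\<And>s. g \<rho> s \<le> g \<rho> r" using g_attains_max[OF assms(1)] by blast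
  obtain s where "g \<rho> s > 0" using g_positive_somewhere[OF assms(1)] by blast
  then have pos: "g \<rho> r > 0" using r(2)[of s] by linarith
  let ?E = "\<lambda>n. enn2real (expected_facets n (d n) (M n) (X n))"
  \<comment> \<open>The error term is defined by the identity to be shown, so the identity holds for
    every \<open>n \<ge> 3\<close> and only the growth of \<open>h\<close> is asymptotic.\<close>
  define h where "h n = ln (?E n) - real (d n) * g \<rho> r" for n
  have mean_facets_eq: "mean_facets d M X n = ?E n" for n by (rule mean_facets_def; fact)
  have ev: "\<forall>\<^sub>F n in sequentially. 3 \<le> d n \<and> d n < n \<and> 3 \<le> n" by (rule eventually_dim; fact)
  have rate: "(\<lambda>n. ln (mean_facets d M X n) / real (d n)) \<longlonglongrightarrow> g \<rho> r" by (rule facets_growth_rate; fact)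
  have "(\<lambda>n. ln (?E n) / real (d n)) \<longlonglongrightarrow> g \<rho> r"
    using rate by (simp only: mean_facets_eq)
  from tendsto_diff[OF this tendsto_const[of "g \<rho> r"]]
  have "(\<lambda>n. ln (?E n) / real (d n) - g \<rho> r) \<longlonglongrightarrow> 0" by simp
  then have "(\<lambda>n. h n / real (d n)) \<longlonglongrightarrow> 0"
  proof (rule Lim_transform_eventually)
    show "\<forall>\<^sub>F n in sequentially. ln (?E n) / real (d n) - g \<rho> r = h n / real (d n)"
      using ev by eventually_elim (simp add: h_def diff_divide_distrib)
  qed
  moreover have "eventually (\<lambda>n. real (d n) \<noteq> 0) sequentially"
    using ev by eventually_elim simp
  ultimately have "h \<in> o(\<lambda>n. real (d n))" by (intro smalloI_tendsto)
  moreover have "expected_facets n (d n) (M n) (X n) = ennreal (exp (real (d n) * g \<rho> r + h n))" if "n \<ge> 3" for n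
  proof -
    have "mean_facets d M X n > 0 \<and> expected_facets n (d n) (M n) (X n) = ennreal (mean_facets d M X n)" by (rule mean_facets_pos; fact)
    then have "?E n > 0 \<and> expected_facets n (d n) (M n) (X n) = ennreal (?E n)" unfolding mean_facets_eq .
    then show ?thesis by (simp add: h_def)
  qed
  ultimately show ?thesis using r(2) pos by blast
qed

end
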